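(* Assume $k^\star\le\bar k_n\lesssim\log n/\log\log n$. Let $k_0\in\mathbb N$ be a fixed constant such that $k_0\le k^\star$, and let $\nu_0\in\mathcal M_{k_0}\setminus\mathcal M_{k_0-1}$ be a fixed distribution. Moreover, assume that the prior distribution $\Pi$ satisfies conditions (P1), (P2) and (P3) described in the context. Then there exist universal constants $\tau>0$ and $M>0$ such that $$\sup_{\nu^\star\in\mathcal M_{k^\star}:\,\mathsf W_1(\nu^\star,\nu_0)<\tau}\mathsf P^{(n)}_{\nu^\star*\Phi}\Big[\Pi\big(\mathsf W_1(\nu,\nu^\star)\ge M\epsilon_{n,k^\star,k_0,1}\,\big|\,X_{1:n}\big)\Big]=o(1),$$ where $$\epsilon_{n,k^\star,k_0,1}:=(k^\star)^{\frac{6k^\star-4k_0+3}{4(k^\star-k_0)+2}}\Big(\frac{\log^2n}{n}\Big)^{\frac{1}{4(k^\star-k_0)+2}}.$$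
   Context: Notation. $\mathbb N=\{1,2,\dots\}$, $[k]:=\{1,\dots,k\}$, $\Delta_k:=\{w\in[0,1]^k:\sum_{j=1}^k w_j=1\}$. For positive sequences, $a_n\lesssim b_n$ means that there is a constant $C>0$ with $a_n\le Cb_n$ for any $n\in\mathbb N$; $o(1)$ is as $n\to\infty$. Fix $L>0$. $\mathcal M_k$ is the set of distributions $\sum_{j=1}^k w_j\delta_{\theta_j}$ with $(w_1,\dots,w_k)\in\Delta_k$ and $\theta_1,\dots,\theta_k\in[-L,L]$ ($\delta_\theta$ is the Dirac measure at $\theta$; $\mathcal M_0$ is read as the empty set), and $\mathcal M:=\bigcup_{k\in\mathbb N}\mathcal M_k$. $\Phi$ is the standard normal distribution and, for $\nu=\sum_j w_j\delta_{\theta_j}$, $\nu*\Phi=\sum_j w_j\mathrm N(\theta_j,1)$. $\mathsf P_G^{(n)}$ denotes probability or expectation when $X_1,\dots,X_n$ are i.i.d. from $G$, $p_G^{(n)}$ is the joint Lebesgue density, and $X_{1:n}=(X_1,\dots,X_n)$. For $\nu=\sum_{j=1}^kw_j\delta_{\theta_j}$ and $\nu'=\sum_{h=1}^{k'}w'_h\delta_{\theta'_h}$, $\mathsf W_1(\nu,\nu')$ is the infimum of $\sum_{j,h}p_{jh}|\theta_j-\theta'_h|$ over all $(p_{jh})\in[0,1]^{k\times k'}$ with $\sum_hp_{jh}=w_j$ and $\sum_jp_{jh}=w'_h$. Setting. The data are i.i.d. from $\nu^\star*\Phi$ with $\nu^\star\in\mathcal M_{k^\star}$; both the true mixing distribution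 $\nu^\star$ and the true number of components $k^\star\in\mathbb N$ may vary with $n$, and $\bar k_n$ is a known upper bound on $k^\star$. The prior $\Pi$ first samples $k\in\mathbb N$ from $\Pi(k)$ and then samples the atoms $\theta\in[-L,L]^k$ from $\Pi(\theta|k)$ and the weights $w\in\Delta_k$ from $\Pi(w|k)$, which induces a distribution on $\mathcal M$ through $\nu=\sum_{j=1}^kw_j\delta_{\theta_j}$. The posterior is $\Pi(\mathrm d\nu|X_{1:n}):=p^{(n)}_{\nu*\Phi}(X_{1:n})\Pi(\mathrm d\nu)\big/\int p^{(n)}_{\nu*\Phi}(X_{1:n})\Pi(\mathrm d\nu)$. Conditions on the prior. (P1) The prior on $k$ is sample size dependent. There are a constant $c_1>0$ and a sufficiently large constant $A>0$ such that for any $n\in\mathbb N$ and any $k^\circ\in\mathbb N$, $\Pi(k=k^\circ+1)/\Pi(k=k^\circ)\le c_1e^{-A\bar k_n\log n}$. Additionally, there are constants $c_2>0$ and $c_3>0$ such that for any $n\in\mathbb N$ and any $k^\dagger\in[\bar k_n]$, $\Pi(k=k^\dagger)\ge c_2e^{-(c_3\bar k_n\log n)k^\dagger}$. (P2) For any $k\in\mathbb N$ and any $(w_1^0,\dots,w_k^0)\in\Delta_k$, there are positive constants $c_4$ and $c_5$ such that for any $\eta\in(0,1/k)$, $\Pi\big(\sum_{j=1}^k|w_j-w_j^0|\le\eta\,\big|\,k\big)\ge c_4\eta^{c_5k}$. (P3) For any $k\in\mathbb N$ and any $\theta^0\in[-L,L]^k$, there are positive constants $c_6$ and $c_7$ such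 that for any $\eta>0$, $\Pi\big(\max_{1\le j\le k}|\theta_j-\theta_j^0|\le\eta\,\big|\,k\big)\ge c_6\eta^{c_7k}$.
   Formalization: The constants c4, c5, c6, c7 in (P2), (P3) are taken uniform in k and in the centres w^0, θ^0; (P3) is required only for η in (0,1/k), since it cannot hold for all η>0; the bound on the upper bound for k* is required for n≥3. *)

theory Defs
  imports "HOL-Probability.Probability"
begin

section \<open>Mixing distributions\<close>

text \<open>Vectors indexed by \<open>[k]\<close> are extensional functions on \<open>{1..k}\<close>, so that they are points
  of the product space \<open>\<Pi>\<^sub>M j\<in>{1..k}. borel\<close>.\<close>

definition weight_simplex :: "nat \<Rightarrow> (nat \<Rightarrow> real) set" where
  "weight_simplex k = {w \<in> {1..k} \<rightarrow>\<^sub>E {0..1}. (\<Sum>j\<in>{1..k}. w j) = 1}"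

definition atom_cube :: "real \<Rightarrow> nat \<Rightarrow> (nat \<Rightarrow> real) set" where
  "atom_cube L k = ({1..k} \<rightarrow>\<^sub>E {-L..L})"

text \<open>The measure \<open>\<Sum>\<^sub>j w\<^sub>j \<delta>\<^bsub>\<theta>\<^sub>j\<^esub>\<close>, as the image under \<open>\<theta>\<close> of the measure on \<open>{1..k}\<close>
  with point masses \<open>w\<^sub>j\<close>; see \<open>emeasure_mixing\<close> below.\<close>

definition mixing :: "nat \<Rightarrow> (nat \<Rightarrow> real) \<Rightarrow> (nat \<Rightarrow> real) \<Rightarrow> real measure" where
  "mixing k w \<theta> = distr (point_measure {1..k} (\<lambda>j. ennreal (w j))) borel \<theta>"

text \<open>\<open>mixing_dists L 0\<close> is empty because \<open>weight_simplex 0\<close> is.\<close>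

definition mixing_dists :: "real \<Rightarrow> nat \<Rightarrow> real measure set" where
  "mixing_dists L k = {mixing k w \<theta> |w \<theta>. w \<in> weight_simplex k \<and> \<theta> \<in> atom_cube L k}"

definition all_mixing_dists :: "real \<Rightarrow> real measure set" where
  "all_mixing_dists L = (\<Union>k\<in>{1..}. mixing_dists L k)"

definition couplings ::
  "nat \<Rightarrow> (nat \<Rightarrow> real) \<Rightarrow> nat \<Rightarrow> (nat \<Rightarrow> real) \<Rightarrow> (nat \<Rightarrow> nat \<Rightarrow> real) set" where
  "couplings k w k' w' = {p.
     (\<forall>j\<in>{1..k}. \<forall>h\<in>{1..k'}. p j h \<in> {0..1}) \<and>
     (\<forall>j\<in>{1..k}. (\<Sum>h\<in>{1..k'}. p j h) = w j) \<and>
     (\<forall>h\<in>{1..k'}. (\<Sum>j\<in>{1..k}. p j h) = w' h)}"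

text \<open>The atoms and weights representing a finitely supported distribution are not unique, but
  the least transport cost is the same for every representation. The infimum below therefore also
  ranges over the representations, which makes it a function of the two distributions. It is
  meaningful only if both are finitely supported.\<close>

definition W1 :: "real measure \<Rightarrow> real measure \<Rightarrow> real" where
  "W1 \<nu> \<nu>' = Inf {c. \<exists>k w \<theta> k' w' \<theta>' p.
     w \<in> weight_simplex k \<and> \<nu> = mixing k w \<theta> \<and>
     w' \<in> weight_simplex k' \<and> \<nu>' = mixing k' w' \<theta>' \<and>
     p \<in> couplings k w k' w' \<and>
     c = (\<Sum>j\<in>{1..k}. \<Sum>h\<in>{1..k'}. p j h * \<bar>\<theta> j - \<theta>' h\<bar>)}"

section \<open>Gaussian location mixtures\<close>

definition gauss_mixture :: "real measure \<Rightarrow> real measure" where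
  "gauss_mixture \<nu> = convolution \<nu> (density lborel std_normal_density)"

text \<open>The continuous version \<open>x \<mapsto> \<integral> \<phi>(x - \<theta>) d\<nu>(\<theta>)\<close> of the Lebesgue density of
  \<open>gauss_mixture \<nu>\<close>; see \<open>gauss_mixture_eq_density\<close> below.\<close>

definition mixture_density :: "real measure \<Rightarrow> real \<Rightarrow> ennreal" where
  "mixture_density \<nu> x = (\<integral>\<^sup>+\<theta>. ennreal (normal_density \<theta> 1 x) \<partial>\<nu>)"

definition joint_density :: "nat \<Rightarrow> real measure \<Rightarrow> (nat \<Rightarrow> real) \<Rightarrow> ennreal" where
  "joint_density n \<nu> x = (\<Prod>i\<in>{1..n}. mixture_density \<nu> (x i))"

definition sample_law :: "nat \<Rightarrow> real measure \<Rightarrow> (nat \<Rightarrow> real) measure" where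
  "sample_law n \<nu> = (\<Pi>\<^sub>M i\<in>{1..n}. gauss_mixture \<nu>)"

section \<open>Prior and posterior\<close>

definition weight_space :: "nat \<Rightarrow> (nat \<Rightarrow> real) measure" where
  "weight_space k = restrict_space (\<Pi>\<^sub>M j\<in>{1..k}. borel) (weight_simplex k)"

definition atom_space :: "real \<Rightarrow> nat \<Rightarrow> (nat \<Rightarrow> real) measure" where
  "atom_space L k = restrict_space (\<Pi>\<^sub>M j\<in>{1..k}. borel) (atom_cube L k)"

text \<open>The set of mixing distributions with the \<open>\<sigma>\<close>-algebra generated by the evaluations
  \<open>\<nu> \<mapsto> \<nu> B\<close>, that is, the Borel \<open>\<sigma>\<close>-algebra of weak convergence.\<close>

definition mixing_space :: "real \<Rightarrow> real measure measure" where
  "mixing_space L = restrict_space (prob_algebra borel) (all_mixing_dists L)"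

text \<open>The law of \<open>\<nu> = \<Sum>\<^sub>j w\<^sub>j \<delta>\<^bsub>\<theta>\<^sub>j\<^esub>\<close> when \<open>k\<close> is drawn from \<open>K\<close> and then, independently
  given \<open>k\<close>, \<open>\<theta>\<close> from \<open>T k\<close> and \<open>w\<close> from \<open>V k\<close>.\<close>

definition mixing_prior :: "real \<Rightarrow> nat measure \<Rightarrow> (nat \<Rightarrow> (nat \<Rightarrow> real) measure) \<Rightarrow>
    (nat \<Rightarrow> (nat \<Rightarrow> real) measure) \<Rightarrow> real measure measure" where
  "mixing_prior L K T V =
     K \<bind> (\<lambda>k. distr (T k \<Otimes>\<^sub>M V k) (mixing_space L) (\<lambda>(\<theta>, w). mixing k w \<theta>))"

definition posterior ::
    "real measure measure \<Rightarrow> nat \<Rightarrow> (nat \<Rightarrow> real) \<Rightarrow> real measure measure" where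
  "posterior P n x =
     density P (\<lambda>\<nu>. joint_density n \<nu> x / (\<integral>\<^sup>+\<nu>'. joint_density n \<nu>' x \<partial>P))"

text \<open>Only the prior on \<open>k\<close> depends on the sample size.\<close>

definition prior_family :: "real \<Rightarrow> (nat \<Rightarrow> nat measure) \<Rightarrow> (nat \<Rightarrow> (nat \<Rightarrow> real) measure) \<Rightarrow>
    (nat \<Rightarrow> (nat \<Rightarrow> real) measure) \<Rightarrow> bool" where
  "prior_family L K T V \<longleftrightarrow>
     (\<forall>n\<ge>1. K n \<in> space (prob_algebra (count_space {1..}))) \<and>
     (\<forall>k\<ge>1. T k \<in> space (prob_algebra (atom_space L k))) \<and>
     (\<forall>k\<ge>1. V k \<in> space (prob_algebra (weight_space k)))"

text \<open>The bound on the ratio of successive prior masses is multiplied out, so a prior on \<open>k\<close> with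
  bounded support is admitted, and mass zero at \<open>k\<close> forces mass zero at \<open>k + 1\<close>.\<close>

definition prior_P1 :: "(nat \<Rightarrow> nat) \<Rightarrow> real \<Rightarrow> real \<Rightarrow> real \<Rightarrow> real \<Rightarrow> (nat \<Rightarrow> nat measure) \<Rightarrow> bool" where
  "prior_P1 kbar A c1 c2 c3 K \<longleftrightarrow>
     (\<forall>n\<ge>1. \<forall>k\<ge>1.
        measure (K n) {k + 1} \<le> c1 * exp (- A * real (kbar n) * ln (real n)) * measure (K n) {k}) \<and>
     (\<forall>n\<ge>1. \<forall>k\<in>{1..kbar n}.
        measure (K n) {k} \<ge> c2 * exp (- (c3 * real (kbar n) * ln (real n)) * real k))"

text \<open>The constants in the next two conditions are uniform in \<open>k\<close> and in the centre of the ball.\<close>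

definition prior_P2 :: "real \<Rightarrow> real \<Rightarrow> (nat \<Rightarrow> (nat \<Rightarrow> real) measure) \<Rightarrow> bool" where
  "prior_P2 c4 c5 V \<longleftrightarrow>
     (\<forall>k\<ge>1. \<forall>w0\<in>weight_simplex k. \<forall>\<eta>\<in>{0<..<1 / real k}.
        measure (V k) {w \<in> space (V k). (\<Sum>j\<in>{1..k}. \<bar>w j - w0 j\<bar>) \<le> \<eta>}
          \<ge> c4 * \<eta> powr (c5 * real k))"

text \<open>A polynomial lower bound on a probability cannot hold for arbitrarily large \<open>\<eta>\<close>, so the
  radius is restricted to the same range as for the weights.\<close>

definition prior_P3 :: "real \<Rightarrow> real \<Rightarrow> real \<Rightarrow> (nat \<Rightarrow> (nat \<Rightarrow> real) measure) \<Rightarrow> bool" where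
  "prior_P3 L c6 c7 T \<longleftrightarrow>
     (\<forall>k\<ge>1. \<forall>\<theta>0\<in>atom_cube L k. \<forall>\<eta>\<in>{0<..<1 / real k}.
        measure (T k) {\<theta> \<in> space (T k). (MAX j\<in>{1..k}. \<bar>\<theta> j - \<theta>0 j\<bar>) \<le> \<eta>}
          \<ge> c6 * \<eta> powr (c7 * real k))"

text \<open>The exponents are real: subtraction on \<open>nat\<close> would truncate.\<close>

definition rate :: "nat \<Rightarrow> nat \<Rightarrow> nat \<Rightarrow> real" where
  "rate n ks k0 =
     real ks powr ((6 * real ks - 4 * real k0 + 3) / (4 * (real ks - real k0) + 2)) *
     ((ln (real n))\<^sup>2 / real n) powr (1 / (4 * (real ks - real k0) + 2))"

section \<open>Consistency of the encoding\<close>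

lemma emeasure_mixing:
  assumes "B \<in> sets borel"
  shows "emeasure (mixing k w \<theta>) B = (\<Sum>j\<in>{1..k}. ennreal (w j) * indicator B (\<theta> j))"
proof -
  have "emeasure (mixing k w \<theta>) B
      = emeasure (point_measure {1..k} (\<lambda>j. ennreal (w j))) (\<theta> -` B \<inter> {1..k})"
    unfolding mixing_def using assms
    by (subst emeasure_distr) (auto simp: space_point_measure measurable_def sets_point_measure)
  also have "\<dots> = (\<Sum>j\<in>\<theta> -` B \<inter> {1..k}. ennreal (w j))"
    by (rule emeasure_point_measure_finite) auto
  also have "\<dots> = (\<Sum>j\<in>{1..k}. ennreal (w j) * indicator B (\<theta> j))"
    by (rule sum.mono_neutral_cong_left) (auto simp: indicator_def)
  finally show ?thesis .
qed

lemma mixing_in_prob_algebra: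
  assumes "w \<in> weight_simplex k"
  shows "mixing k w \<theta> \<in> space (prob_algebra borel)"
proof -
  have "emeasure (mixing k w \<theta>) UNIV = (\<Sum>j\<in>{1..k}. ennreal (w j))"
    by (simp add: emeasure_mixing)
  also have "\<dots> = 1"
    using assms by (subst sum_ennreal) (auto simp: weight_simplex_def PiE_iff)
  finally show ?thesis
    by (auto simp: space_prob_algebra mixing_def intro!: prob_spaceI)
qed

lemma gauss_mixture_eq_density:
  assumes "\<nu> \<in> space (prob_algebra borel)"
  shows "gauss_mixture \<nu> = density lborel (mixture_density \<nu>)"
proof (rule measure_eqI)
  interpret nu: prob_space \<nu> using assms by (simp add: space_prob_algebra)
  have [measurable_cong]: "sets \<nu> = sets borel" using assms by (simp add: space_prob_algebra)
  have shift: "normal_density \<theta> 1 (\<theta> + y) = std_normal_density y" for \<theta> y :: real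
    by (simp add: normal_density_def)
  have [measurable]: "(\<lambda>(\<theta>, x). normal_density \<theta> 1 x) \<in> borel_measurable (borel \<Otimes>\<^sub>M borel)"
    unfolding normal_density_def by measurable
  interpret pair_sigma_finite \<nu> lborel ..
  show "sets (gauss_mixture \<nu>) = sets (density lborel (mixture_density \<nu>))"
    by (simp add: gauss_mixture_def)
  fix B assume "B \<in> sets (gauss_mixture \<nu>)"
  then have [measurable]: "B \<in> sets borel" by (simp add: gauss_mixture_def)
  have "emeasure (gauss_mixture \<nu>) B
      = (\<integral>\<^sup>+\<theta>. \<integral>\<^sup>+y. indicator B (\<theta> + y) \<partial>density lborel std_normal_density \<partial>\<nu>)"
    unfolding gauss_mixture_def
    by (rule convolution_emeasure')
       (auto simp: \<open>sets \<nu> = sets borel\<close> nu.finite_measure_axioms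
         intro!: prob_space.finite_measure prob_space_normal_density)
  also have "\<dots> = (\<integral>\<^sup>+\<theta>. \<integral>\<^sup>+y. ennreal (std_normal_density y) * indicator B (\<theta> + y) \<partial>lborel \<partial>\<nu>)"
    by (intro nn_integral_cong) (simp add: nn_integral_density)
  also have "\<dots> = (\<integral>\<^sup>+\<theta>. \<integral>\<^sup>+x. ennreal (normal_density \<theta> 1 x) * indicator B x \<partial>lborel \<partial>\<nu>)"
  proof (rule nn_integral_cong)
    fix \<theta> :: real
    show "(\<integral>\<^sup>+y. ennreal (std_normal_density y) * indicator B (\<theta> + y) \<partial>lborel)
        = (\<integral>\<^sup>+x. ennreal (normal_density \<theta> 1 x) * indicator B x \<partial>lborel)"
      by (subst (2) nn_integral_real_affine[where c=1 and t=\<theta>]) (auto simp: shift)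
  qed
  also have "\<dots> = (\<integral>\<^sup>+x. \<integral>\<^sup>+\<theta>. ennreal (normal_density \<theta> 1 x) * indicator B x \<partial>\<nu> \<partial>lborel)"
    by (rule Fubini'[symmetric]) simp
  also have "\<dots> = (\<integral>\<^sup>+x. mixture_density \<nu> x * indicator B x \<partial>lborel)"
    unfolding mixture_density_def
    by (intro nn_integral_cong nn_integral_multc) measurable
  also have "\<dots> = emeasure (density lborel (mixture_density \<nu>)) B"
    unfolding mixture_density_def by (subst emeasure_density) measurable
  finally show "emeasure (gauss_mixture \<nu>) B = emeasure (density lborel (mixture_density \<nu>)) B" .
qed

lemma measurable_mixing:
  assumes "k \<ge> 1"
  shows "(\<lambda>(\<theta>, w). mixing k w \<theta>) \<in> (atom_space L k \<Otimes>\<^sub>M weight_space k) \<rightarrow>\<^sub>M mixing_space L"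
  unfolding mixing_space_def
proof (rule measurable_restrict_space2)
  let ?N = "atom_space L k \<Otimes>\<^sub>M weight_space k"
  have space: "space ?N = atom_cube L k \<times> weight_simplex k"
    by (auto simp: space_pair_measure atom_space_def weight_space_def space_restrict_space
        space_PiM weight_simplex_def atom_cube_def PiE_iff extensional_def)
  show "(\<lambda>(\<theta>, w). mixing k w \<theta>) \<in> space ?N \<rightarrow> all_mixing_dists L"
    using assms unfolding space by (auto simp: all_mixing_dists_def mixing_dists_def)
  have coord: "(\<lambda>x. x j) \<in> borel_measurable (atom_space L k)"
      "(\<lambda>x. x j) \<in> borel_measurable (weight_space k)" if "j \<in> {1..k}" for j
    using that by (auto simp: atom_space_def weight_space_def
        intro!: measurable_restrict_space1 measurable_component_singleton)
  have [measurable]: "(\<lambda>p. fst p j) \<in> borel_measurable ?N"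
      "(\<lambda>p. snd p j) \<in> borel_measurable ?N" if "j \<in> {1..k}" for j
    using measurable_compose[OF measurable_fst coord(1)[OF that]]
      measurable_compose[OF measurable_snd coord(2)[OF that]] by auto
  show "(\<lambda>(\<theta>, w). mixing k w \<theta>) \<in> ?N \<rightarrow>\<^sub>M prob_algebra borel"
  proof (rule measurable_prob_algebraI)
    show "prob_space ((\<lambda>(\<theta>, w). mixing k w \<theta>) p)" if "p \<in> space ?N" for p
      using that mixing_in_prob_algebra[of "snd p" k "fst p"]
      unfolding space by (auto simp: space_prob_algebra)
    show "(\<lambda>(\<theta>, w). mixing k w \<theta>) \<in> ?N \<rightarrow>\<^sub>M subprob_algebra borel"
    proof (rule measurable_subprob_algebra)
      show "subprob_space ((\<lambda>(\<theta>, w). mixing k w \<theta>) p)" if "p \<in> space ?N" for p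
        using that mixing_in_prob_algebra[of "snd p" k "fst p"]
        unfolding space by (auto simp: space_prob_algebra prob_space_imp_subprob_space)
      show "sets ((\<lambda>(\<theta>, w). mixing k w \<theta>) p) = sets borel" for p
        by (simp add: mixing_def case_prod_beta)
      fix B :: "real set" assume [measurable]: "B \<in> sets borel"
      show "(\<lambda>p. emeasure ((\<lambda>(\<theta>, w). mixing k w \<theta>) p) B) \<in> borel_measurable ?N"
        unfolding case_prod_beta emeasure_mixing[OF \<open>B \<in> sets borel\<close>]
        by (intro borel_measurable_sum) measurable
    qed
  qed
qed

lemma mixing_prior_in_prob_algebra:
  assumes "prior_family L K T V" and "n \<ge> 1"
  shows "mixing_prior L (K n) T V \<in> space (prob_algebra (mixing_space L))"
proof -
  have K: "K n \<in> space (prob_algebra (count_space {1..}))"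
    using assms by (auto simp: prior_family_def)
  have kernel: "(\<lambda>k. distr (T k \<Otimes>\<^sub>M V k) (mixing_space L) (\<lambda>(\<theta>, w). mixing k w \<theta>))
      \<in> count_space {1..} \<rightarrow>\<^sub>M prob_algebra (mixing_space L)"
  proof (subst measurable_count_space_eq1, intro Pi_I)
    fix k :: nat assume "k \<in> {1..}"
    then have "k \<ge> 1" and T: "prob_space (T k)" "sets (T k) = sets (atom_space L k)"
      and V: "prob_space (V k)" "sets (V k) = sets (weight_space k)"
      using assms by (auto simp: prior_family_def space_prob_algebra)
    have "sets (T k \<Otimes>\<^sub>M V k) = sets (atom_space L k \<Otimes>\<^sub>M weight_space k)"
      using T V by (intro sets_pair_measure_cong)
    then have "(\<lambda>(\<theta>, w). mixing k w \<theta>) \<in> (T k \<Otimes>\<^sub>M V k) \<rightarrow>\<^sub>M mixing_space L"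
      using measurable_mixing[OF \<open>k \<ge> 1\<close>, of L] by (simp cong: measurable_cong_sets)
    then show "distr (T k \<Otimes>\<^sub>M V k) (mixing_space L) (\<lambda>(\<theta>, w). mixing k w \<theta>)
        \<in> space (prob_algebra (mixing_space L))"
      using T V by (auto simp: space_prob_algebra intro!: prob_space.prob_space_distr prob_space_pair)
  qed
  show ?thesis
    unfolding mixing_prior_def using measurable_bind_prob_space[OF measurable_const[OF K] kernel, of "count_space {()}"]
    by (auto dest: measurable_space)
qed

end

theory Submission
  imports Defs
begin

text \<open>
  Posterior mass is bounded by separating the true mixing distribution \<open>\<nu>*\<close>, with \<open>k*\<close> atoms,
  from every \<open>\<nu>\<close> that is far from it in \<open>W\<^sub>1\<close>, in terms of the affinity \<open>\<integral> \<surd>(p q)\<close> of the mixture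
  densities. Since \<open>W\<^sub>1\<close> is the \<open>L\<^sup>1\<close> distance of the distribution functions, a large \<open>W\<^sub>1\<close> forces
  a large difference \<open>\<Delta>\<close> of the distribution functions on some gap between consecutive atoms of
  \<open>\<nu>\<close> and \<open>\<nu>*\<close>. The step function jumping in that gap is interpolated at all atoms \<open>\<theta>\<close> by a
  polynomial in \<open>exp (\<theta>/\<surd>k)\<close>, which is the Gaussian expectation of an explicit function \<open>h\<close>;
  hence \<open>\<Delta> = \<integral> h (p - q)\<close>, and the affinity is at most \<open>1 - \<Delta>\<^sup>2 / (8 sup\<^sub>\<theta> E\<^sub>\<theta> h\<^sup>2)\<close>. Near \<open>\<nu>\<^sub>0\<close> every
  short window contains at most \<open>2(k* - k\<^sub>0) + 2\<close> of the atoms, so that only \<open>2(k* - k\<^sub>0) + 1\<close>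
  of the divided differences involve the length of the gap; this gives the exponent of the rate.

  Likelihoods are compared multiplicatively: moving atoms and weights by \<open>n\<^sup>-\<^sup>3\<close> changes the
  likelihood by a bounded factor as soon as \<open>\<Sum> \<bar>X\<^sub>i\<bar> \<le> n\<^sup>2\<close>. This bounds the evidence from below
  on a prior ball around \<open>\<nu>*\<close>, and reduces the supremum of the likelihood ratio over far
  \<open>\<nu>\<close> with at most \<open>k*\<close> atoms to a finite net, to which Markov's inequality for the square root
  of the likelihood ratio applies. Mixtures with more than \<open>k*\<close> atoms are killed by the prior,
  since their likelihood ratios have expectation one.
\<close>

text \<open>The number k of atoms of the truth may grow, so factors exponential in k are not free.
  They are absorbed by \<open>M\<close>: with q = 2(k - k0) + 1 one has k \<le> k0 * q, hence R^k
  \<le> (R^k0)^q, and \<open>W1\<close> enters the separation to the power q. The factors of type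
  k^k have to be tracked, and they make up the power of k in the rate: k^q because one of fewer than
  2k gaps is selected, and sqrt(k)^(2k-1) because \<theta> \<mapsto> exp (\<theta> / sqrt k)
  contracts gaps by the order of sqrt k. The scale 1 / sqrt k balances this contraction against the
  second moments of exponentials of degree up to 2k, which it keeps below exp (4k).

  The squared logarithm comes from the prior: with kbar \<le> C log n, (P1) gives k a mass of at
  least c2 exp (- c3 C k log^2 n). Hence n(1 - affinity) is required to be of order k log^2 n, which
  also covers the logarithm of the size of the net, of order k log n.\<close>

declare One_nat_def [simp del]

section \<open>The Wasserstein distance of finitely supported distributions\<close>

lemma weight_simplexI:
  assumes "w \<in> extensional {1..k}" "\<And>j. j \<in> {1..k} \<Longrightarrow> 0 \<le> w j" "(\<Sum>j\<in>{1..k}. w j) = 1"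
  shows "w \<in> weight_simplex k"
proof -
  have "w j \<le> 1" if "j \<in> {1..k}" for j
    using member_le_sum[of j "{1..k}" w] assms that by auto
  then show ?thesis using assms by (auto simp: weight_simplex_def PiE_iff)
qed

lemma weight_simplex_nonneg: "w \<in> weight_simplex k \<Longrightarrow> j \<in> {1..k} \<Longrightarrow> 0 \<le> w j"
  and weight_simplex_le_1: "w \<in> weight_simplex k \<Longrightarrow> j \<in> {1..k} \<Longrightarrow> w j \<le> 1"
  and weight_simplex_sum: "w \<in> weight_simplex k \<Longrightarrow> (\<Sum>j\<in>{1..k}. w j) = 1"
  by (auto simp: weight_simplex_def PiE_iff)

lemma weight_simplex_pos: "w \<in> weight_simplex k \<Longrightarrow> k \<ge> 1"
  by (cases k) (auto simp: weight_simplex_def)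

lemma integral_mixing:
  assumes "w \<in> weight_simplex k" and [measurable]: "f \<in> borel_measurable borel"
  shows "(\<integral>x. f x \<partial>mixing k w \<theta>) = (\<Sum>j\<in>{1..k}. w j * (f (\<theta> j) :: real))"
proof -
  have "point_measure {1..k} (\<lambda>j. ennreal (w j)) = point_measure {1..k} (\<lambda>j. ennreal (\<bar>w j\<bar>))"
    using assms(1) unfolding point_measure_def
    by (intro density_cong) (auto simp: AE_count_space weight_simplex_nonneg)
  then show ?thesis
    unfolding mixing_def using weight_simplex_nonneg[OF assms(1)]
    by (subst integral_distr) (auto simp: lebesgue_integral_point_measure_finite)
qed

lemma nn_integral_mixing:
  assumes [measurable]: "f \<in> borel_measurable borel"
  shows "(\<integral>\<^sup>+x. f x \<partial>mixing k w \<theta>) = (\<Sum>j\<in>{1..k}. ennreal (w j) * f (\<theta> j))"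
  unfolding mixing_def
  by (subst nn_integral_distr) (auto simp: nn_integral_point_measure_finite mult.commute)

abbreviation transport_costs :: "real measure \<Rightarrow> real measure \<Rightarrow> real set" where
  "transport_costs \<nu> \<nu>' \<equiv> {c. \<exists>k w \<theta> k' w' \<theta>' p.
     w \<in> weight_simplex k \<and> \<nu> = mixing k w \<theta> \<and>
     w' \<in> weight_simplex k' \<and> \<nu>' = mixing k' w' \<theta>' \<and>
     p \<in> couplings k w k' w' \<and>
     c = (\<Sum>j\<in>{1..k}. \<Sum>h\<in>{1..k'}. p j h * \<bar>\<theta> j - \<theta>' h\<bar>)}"

lemma transport_cost_nonneg: "c \<in> transport_costs \<nu> \<nu>' \<Longrightarrow> 0 \<le> c"
  by (auto simp: couplings_def intro!: sum_nonneg)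

lemma W1_le_cost:
  assumes "w \<in> weight_simplex k" "w' \<in> weight_simplex k'" "p \<in> couplings k w k' w'"
  shows "W1 (mixing k w \<theta>) (mixing k' w' \<theta>') \<le> (\<Sum>j\<in>{1..k}. \<Sum>h\<in>{1..k'}. p j h * \<bar>\<theta> j - \<theta>' h\<bar>)"
  unfolding W1_def
proof (rule cInf_lower)
  show "bdd_below (transport_costs (mixing k w \<theta>) (mixing k' w' \<theta>'))"
    using transport_cost_nonneg by (rule bdd_belowI)
qed (use assms in blast)

text \<open>Shows that some transport cost exists, so that the infimum in \<open>W1\<close> is taken
  over a nonempty set, and gives the crude bound by the diameter.\<close>

lemma product_coupling:
  assumes "w \<in> weight_simplex k" "w' \<in> weight_simplex k'"
  shows "(\<lambda>j h. w j * w' h) \<in> couplings k w k' w'"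
  using weight_simplex_nonneg[OF assms(1)] weight_simplex_nonneg[OF assms(2)]
    weight_simplex_le_1[OF assms(1)] weight_simplex_le_1[OF assms(2)]
    weight_simplex_sum[OF assms(1)] weight_simplex_sum[OF assms(2)]
  by (auto simp: couplings_def mult_le_one simp flip: sum_distrib_left sum_distrib_right)

text \<open>The easy half of Kantorovich duality: every coupling writes the difference of the
  integrals as a sum of \<open>p j h * (f (\<theta> j) - f (\<theta>' h))\<close>. It provides the
  lower bounds on \<open>W1\<close> with which \<open>local_window\<close> finds atoms near those of
  \<nu>0.\<close>

lemma W1_Lipschitz:
  fixes f :: "real \<Rightarrow> real"
  assumes "\<nu> \<in> mixing_dists L k" "\<nu>' \<in> mixing_dists L k'" and [measurable]: "f \<in> borel_measurable borel"
    and lip: "\<And>x y. \<bar>f x - f y\<bar> \<le> \<bar>x - y\<bar>"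
  shows "\<bar>(\<integral>x. f x \<partial>\<nu>) - (\<integral>x. f x \<partial>\<nu>')\<bar> \<le> W1 \<nu> \<nu>'"
  unfolding W1_def
proof (rule cInf_greatest)
  \<comment> \<open>The infimum of the empty set carries no information; the hypotheses on \<nu> and
    \<nu>' provide a representation of each.\<close>
  show "transport_costs \<nu> \<nu>' \<noteq> {}"
    using assms(1,2) product_coupling unfolding mixing_dists_def by blast
  fix c assume "c \<in> transport_costs \<nu> \<nu>'"
  then obtain k w \<theta> k' w' \<theta>' p where w: "w \<in> weight_simplex k" "w' \<in> weight_simplex k'"
    and \<nu>: "\<nu> = mixing k w \<theta>" "\<nu>' = mixing k' w' \<theta>'" and p: "p \<in> couplings k w k' w'"
    and c: "c = (\<Sum>j\<in>{1..k}. \<Sum>h\<in>{1..k'}. p j h * \<bar>\<theta> j - \<theta>' h\<bar>)" by blast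
  have p0: "0 \<le> p j h" if "j \<in> {1..k}" "h \<in> {1..k'}" for j h
    using p that by (auto simp: couplings_def)
  have "(\<integral>x. f x \<partial>\<nu>) = (\<Sum>j\<in>{1..k}. \<Sum>h\<in>{1..k'}. p j h * f (\<theta> j))"
    using p by (simp add: \<nu> integral_mixing[OF w(1)] couplings_def flip: sum_distrib_right)
  moreover have "(\<integral>x. f x \<partial>\<nu>') = (\<Sum>h\<in>{1..k'}. \<Sum>j\<in>{1..k}. p j h * f (\<theta>' h))"
    using p by (simp add: \<nu> integral_mixing[OF w(2)] couplings_def flip: sum_distrib_right)
  then have "(\<integral>x. f x \<partial>\<nu>') = (\<Sum>j\<in>{1..k}. \<Sum>h\<in>{1..k'}. p j h * f (\<theta>' h))"
    by (simp add: sum.swap[of _ "{1..k}"])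
  ultimately have "(\<integral>x. f x \<partial>\<nu>) - (\<integral>x. f x \<partial>\<nu>') = (\<Sum>j\<in>{1..k}. \<Sum>h\<in>{1..k'}. p j h * (f (\<theta> j) - f (\<theta>' h)))"
    by (simp add: sum_subtractf right_diff_distrib)
  also have "\<bar>\<dots>\<bar> \<le> (\<Sum>j\<in>{1..k}. \<Sum>h\<in>{1..k'}. p j h * \<bar>\<theta> j - \<theta>' h\<bar>)"
    using p0 lip
    by (intro order.trans[OF sum_abs] sum_mono) (auto simp: abs_mult intro!: mult_left_mono)
  finally show "\<bar>(\<integral>x. f x \<partial>\<nu>) - (\<integral>x. f x \<partial>\<nu>')\<bar> \<le> c" by (simp add: c)
qed

text \<open>Caps the rate: if some distribution is at distance \<open>M * rate\<close> from the
  truth, then \<open>M * rate\<close> is at most \<open>2 * L\<close>. The far case of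
  \<open>affinity_separation\<close> uses this.\<close>

lemma W1_le_diameter:
  assumes "\<nu> \<in> mixing_dists L k" "\<nu>' \<in> mixing_dists L k'"
  shows "W1 \<nu> \<nu>' \<le> 2 * L"
proof -
  obtain w \<theta> w' \<theta>' where w: "w \<in> weight_simplex k" "w' \<in> weight_simplex k'"
    and \<theta>: "\<theta> \<in> atom_cube L k" "\<theta>' \<in> atom_cube L k'" and \<nu>: "\<nu> = mixing k w \<theta>" "\<nu>' = mixing k' w' \<theta>'"
    using assms by (auto simp: mixing_dists_def)
  have "\<bar>\<theta> j - \<theta>' h\<bar> \<le> 2 * L" if "j \<in> {1..k}" "h \<in> {1..k'}" for j h
  proof -
    have "\<theta> j \<in> {-L..L}" "\<theta>' h \<in> {-L..L}" using \<theta> that by (auto simp: atom_cube_def)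
    then show ?thesis by auto
  qed
  then have "W1 \<nu> \<nu>' \<le> (\<Sum>j\<in>{1..k}. \<Sum>h\<in>{1..k'}. w j * w' h * (2 * L))"
    unfolding \<nu>
    by (intro order.trans[OF W1_le_cost[OF w product_coupling[OF w]]] sum_mono mult_left_mono)
       (auto simp: weight_simplex_nonneg[OF w(1)] weight_simplex_nonneg[OF w(2)])
  also have "\<dots> = (\<Sum>j\<in>{1..k}. w j) * (\<Sum>h\<in>{1..k'}. w' h) * (2 * L)"
    by (simp only: sum_distrib_right[symmetric] sum_distrib_left[symmetric])
  finally show ?thesis by (simp only: weight_simplex_sum[OF w(1)] weight_simplex_sum[OF w(2)])
qed

section \<open>The monotone coupling on the line\<close>

lemma sum_mixed_difference:
  fixes C :: "nat \<Rightarrow> nat \<Rightarrow> real"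
  assumes "c \<le> d"
  shows "(\<Sum>h\<in>{c+1..d}. C j h - C i h - C j (h-1) + C i (h-1)) = C j d - C i d - C j c + C i c"
  using assms by (induction d rule: dec_induct) auto

text \<open>Telescoping in both indices: the mass that a joint distribution function
  \<open>C\<close> assigns to a rectangle of cells.\<close>

lemma sum_mixed_difference2:
  fixes C :: "nat \<Rightarrow> nat \<Rightarrow> real"
  assumes "a \<le> b" "c \<le> d"
  shows "(\<Sum>j\<in>{a+1..b}. \<Sum>h\<in>{c+1..d}. C j h - C (j-1) h - C j (h-1) + C (j-1) (h-1))
       = C b d - C a d - C b c + C a c"
  unfolding sum_mixed_difference[OF assms(2)]
  using assms(1) by (induction b rule: dec_induct) auto

text \<open>The gap after \<open>r\<close> is crossed exactly when \<open>r\<close> separates the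
  two indices; the first indicator records a crossing to the right, the second one to the left. This
  turns the cost of a coupling into a sum over gaps.\<close>

lemma abs_diff_eq_sum_gaps:
  fixes t :: "nat \<Rightarrow> real"
  assumes "mono_on {1..l} t" "j \<in> {1..l}" "h \<in> {1..l}"
  shows "\<bar>t j - t h\<bar> = (\<Sum>r\<in>{1..<l}. (of_bool (j \<le> r \<and> r < h) + of_bool (h \<le> r \<and> r < j)) * (t (Suc r) - t r))"
proof -
  have *: "t h - t j = (\<Sum>r\<in>{1..<l}. (of_bool (j \<le> r \<and> r < h) + of_bool (h \<le> r \<and> r < j)) * (t (Suc r) - t r))"
    if "j \<le> h" "j \<in> {1..l}" "h \<in> {1..l}" for j h
  proof -
    have "t h - t j = (\<Sum>r\<in>{j..<h}. t (Suc r) - t r)" using that by (simp add: sum_Suc_diff')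
    also have "\<dots> = (\<Sum>r\<in>{1..<l}. (of_bool (j \<le> r \<and> r < h) + of_bool (h \<le> r \<and> r < j)) * (t (Suc r) - t r))"
      using that by (intro sum.mono_neutral_cong_left) auto
    finally show ?thesis .
  qed
  show ?thesis
  proof (cases "j \<le> h")
    case True
    then have "t j \<le> t h" using assms by (auto simp: mono_on_def)
    then show ?thesis using *[of j h] assms True by simp
  next
    case False
    then have "t h \<le> t j" using assms by (auto simp: mono_on_def)
    then show ?thesis using *[of h j] assms False by (simp add: add.commute)
  qed
qed

text \<open>The monotone coupling has joint distribution function \<open>min (F j) (G h)\<close>; its cost is the
  \<open>L\<^sup>1\<close> distance of the distribution functions.\<close>

lemma W1_le_cdf_distance:
  assumes "u \<in> weight_simplex l" "v \<in> weight_simplex l" "mono_on {1..l} t"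
  shows "W1 (mixing l u t) (mixing l v t)
    \<le> (\<Sum>r\<in>{1..<l}. \<bar>\<Sum>i\<in>{1..r}. u i - v i\<bar> * (t (Suc r) - t r))"
proof -
  let ?cut = "\<lambda>j h r. of_bool (j \<le> r \<and> r < h) + of_bool (h \<le> r \<and> r < j) :: real"
  let ?gap = "\<lambda>r. t (Suc r) - t r"
  define F where "F j = (\<Sum>i\<in>{1..j}. u i)" for j
  define G where "G j = (\<Sum>i\<in>{1..j}. v i)" for j
  define C where "C j h = min (F j) (G h)" for j h
  define p where "p j h = C j h - C (j-1) h - C j (h-1) + C (j-1) (h-1)" for j h
  have step: "F j = F (j-1) + u j" "G j = G (j-1) + v j" if "j \<in> {1..l}" for j
    using that by (cases j; simp add: F_def G_def)+
  have incr: "F (j-1) \<le> F j" "G (j-1) \<le> G j" if "j \<in> {1..l}" for j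
    using step[OF that] weight_simplex_nonneg[OF assms(1) that] weight_simplex_nonneg[OF assms(2) that]
    by auto
  have F0: "F 0 = 0" "G 0 = 0" and Fl: "F l = 1" "G l = 1"
    using assms by (auto simp: F_def G_def weight_simplex_sum)
  have bnd: "0 \<le> F j" "0 \<le> G j" "F j \<le> 1" "G j \<le> 1" if "j \<le> l" for j
  proof -
    show "0 \<le> F j" "0 \<le> G j"
      using that assms unfolding F_def G_def by (auto intro!: sum_nonneg simp: weight_simplex_nonneg)
    have "F j \<le> F l" "G j \<le> G l"
      using that assms unfolding F_def G_def by (auto intro!: sum_mono2 simp: weight_simplex_nonneg)
    then show "F j \<le> 1" "G j \<le> 1" using Fl by auto
  qed
  \<comment> \<open>The minimum has increasing differences in its two arguments, and
    \<open>F\<close> and \<open>G\<close> are increasing.\<close>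
  have p0: "0 \<le> p j h" if "j \<in> {1..l}" "h \<in> {1..l}" for j h
    using incr(1)[OF that(1)] incr(2)[OF that(2)] unfolding p_def C_def by linarith
  have rect: "(\<Sum>j\<in>{a+1..b}. \<Sum>h\<in>{c+1..d}. p j h) = C b d - C a d - C b c + C a c" if "a \<le> b" "c \<le> d" for a b c d
    unfolding p_def by (rule sum_mixed_difference2[OF that])
  have row: "(\<Sum>h\<in>{1..l}. p j h) = u j" if "j \<in> {1..l}" for j
  proof -
    have "(\<Sum>h\<in>{0+1..l}. p j h) = C j l - C (j-1) l - C j 0 + C (j-1) 0"
      unfolding p_def by (rule sum_mixed_difference) simp
    also have "\<dots> = F j - F (j-1)" using that bnd[of j] bnd[of "j-1"] by (auto simp: C_def F0 Fl)
    finally show ?thesis using step[OF that] by simp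
  qed
  have col: "(\<Sum>j\<in>{1..l}. p j h) = v h" if "h \<in> {1..l}" for h
  proof -
    have "(\<Sum>j\<in>{0+1..l}. p j h) = C l h - C l (h-1) - C 0 h + C 0 (h-1)"
      unfolding p_def using sum_mixed_difference[of 0 l "\<lambda>h j. C j h" h "h-1"]
      by (simp add: algebra_simps)
    also have "\<dots> = G h - G (h-1)" using that bnd[of h] bnd[of "h-1"] by (auto simp: C_def F0 Fl)
    finally show ?thesis using step[OF that] by simp
  qed
  have "p j h \<le> 1" if "j \<in> {1..l}" "h \<in> {1..l}" for j h
    using member_le_sum[of h "{1..l}" "p j"] row[OF that(1)] p0 that weight_simplex_le_1[OF assms(1) that(1)]
    by auto
  then have "p \<in> couplings l u l v"
    using p0 row col by (auto simp: couplings_def)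
  then have "W1 (mixing l u t) (mixing l v t) \<le> (\<Sum>j\<in>{1..l}. \<Sum>h\<in>{1..l}. p j h * \<bar>t j - t h\<bar>)"
    by (rule W1_le_cost[OF assms(1,2)])
  also have "\<dots> = (\<Sum>j\<in>{1..l}. \<Sum>h\<in>{1..l}. \<Sum>r\<in>{1..<l}.
      p j h * ?cut j h r * ?gap r)"
    using assms(3) by (intro sum.cong refl) (simp add: abs_diff_eq_sum_gaps sum_distrib_left mult.assoc)
  also have "\<dots> = (\<Sum>j\<in>{1..l}. \<Sum>r\<in>{1..<l}. \<Sum>h\<in>{1..l}.
      p j h * ?cut j h r * ?gap r)"
    by (intro sum.cong[OF refl] sum.swap)
  also have "\<dots> = (\<Sum>r\<in>{1..<l}. \<Sum>j\<in>{1..l}. \<Sum>h\<in>{1..l}.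
      p j h * ?cut j h r * ?gap r)"
    by (rule sum.swap)
  also have "\<dots> = (\<Sum>r\<in>{1..<l}. \<bar>\<Sum>i\<in>{1..r}. u i - v i\<bar> * ?gap r)"
  proof (intro sum.cong refl)
    \<comment> \<open>The mass crossing the gap to the right is
      \<open>F r - min (F r) (G r)\<close>, to the left \<open>G r - min (F r) (G r)\<close>. At
      most one of them is nonzero, and their sum is the distance of \<open>F r\<close> and
      \<open>G r\<close>.\<close>
    fix r assume r: "r \<in> {1..<l}"
    have "(\<Sum>j\<in>{1..l}. \<Sum>h\<in>{1..l}. p j h * of_bool (j \<le> r \<and> r < h)) = (\<Sum>j\<in>{1..l}. of_bool (j \<le> r) * (\<Sum>h\<in>{1..l}. of_bool (r < h) * p j h))"
      by (intro sum.cong refl) (auto simp: sum_distrib_left intro!: sum.cong)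
    also have "\<dots> = (\<Sum>j\<in>{0+1..r}. \<Sum>h\<in>{r+1..l}. p j h)"
      using r by (intro sum.mono_neutral_cong_right) (auto intro!: sum.mono_neutral_cong_right)
    finally have 1: "(\<Sum>j\<in>{1..l}. \<Sum>h\<in>{1..l}. p j h * of_bool (j \<le> r \<and> r < h)) = C r l - C r r"
      using r bnd[of l] bnd[of r] by (subst (asm) rect) (auto simp: C_def F0)
    have "(\<Sum>j\<in>{1..l}. \<Sum>h\<in>{1..l}. p j h * of_bool (h \<le> r \<and> r < j)) = (\<Sum>j\<in>{1..l}. of_bool (r < j) * (\<Sum>h\<in>{1..l}. of_bool (h \<le> r) * p j h))"
      by (intro sum.cong refl) (auto simp: sum_distrib_left intro!: sum.cong)
    also have "\<dots> = (\<Sum>j\<in>{r+1..l}. \<Sum>h\<in>{0+1..r}. p j h)"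
      using r by (intro sum.mono_neutral_cong_right) (auto intro!: sum.mono_neutral_cong_right)
    finally have 2: "(\<Sum>j\<in>{1..l}. \<Sum>h\<in>{1..l}. p j h * of_bool (h \<le> r \<and> r < j)) = C l r - C r r"
      using r bnd[of l] bnd[of r] by (subst (asm) rect) (auto simp: C_def F0)
    have "(\<Sum>j\<in>{1..l}. \<Sum>h\<in>{1..l}. p j h * ?cut j h r)
        = \<bar>\<Sum>i\<in>{1..r}. u i - v i\<bar>"
      using 1 2 r bnd[of l] bnd[of r] F_def[of r] G_def[of r]
      by (auto simp: distrib_left sum.distrib C_def Fl sum_subtractf)
    then show "(\<Sum>j\<in>{1..l}. \<Sum>h\<in>{1..l}. p j h * ?cut j h r * ?gap r)
        = \<bar>\<Sum>i\<in>{1..r}. u i - v i\<bar> * ?gap r"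
      by (simp flip: sum_distrib_right)
  qed
  finally show ?thesis .
qed

section \<open>Common supports and minimal representations\<close>

lemma finite_set_strict_enumeration:
  fixes T :: "real set"
  assumes "finite T"
  obtains t :: "nat \<Rightarrow> real" where "bij_betw t {1..card T} T" "strict_mono_on {1..card T} t"
proof
  define xs where "xs = sorted_list_of_set T"
  have xs: "sorted_wrt (<) xs" "set xs = T" "length xs = card T" "distinct xs"
    using assms by (auto simp: xs_def)
  show sm: "strict_mono_on {1..card T} (\<lambda>i. xs ! (i - 1))"
    using xs by (auto simp: strict_mono_on_def sorted_wrt_iff_nth_less)
  have "(\<lambda>i. xs ! (i - 1)) ` {1..card T} = (\<lambda>i. xs ! i) ` ((\<lambda>i. i - 1) ` {1..card T})"
    by (simp add: image_image)
  also have "(\<lambda>i. i - 1) ` {1..card T} = {..<card T}"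
    by (force simp: image_iff intro: bexI[of _ "Suc _"])
  also have "(\<lambda>i. xs ! i) ` {..<card T} = T"
    using xs by (auto simp: set_conv_nth)
  finally show "bij_betw (\<lambda>i. xs ! (i - 1)) {1..card T} T"
    using strict_mono_on_imp_inj_on[OF sm] by (simp add: bij_betw_def)
qed

text \<open>Stated for semirings because it is applied to real weights, for integrals, and to
  \<open>ennreal\<close> weights, for the measures of sets.\<close>

lemma sum_over_fibres:
  fixes f :: "nat \<Rightarrow> 'b::semiring_0" and \<theta> t :: "nat \<Rightarrow> 'a"
  assumes "bij_betw t {1..l} T" "\<theta> ` {j\<in>{1..k}. f j \<noteq> 0} \<subseteq> T"
  shows "(\<Sum>i\<in>{1..l}. (\<Sum>j\<in>{j\<in>{1..k}. \<theta> j = t i}. f j) * g (t i)) = (\<Sum>j\<in>{1..k}. f j * g (\<theta> j))"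
proof -
  have "(\<Sum>i\<in>{1..l}. (\<Sum>j\<in>{j\<in>{1..k}. \<theta> j = t i}. f j) * g (t i)) = (\<Sum>x\<in>T. (\<Sum>j\<in>{j\<in>{1..k}. \<theta> j = x}. f j) * g x)"
    using sum.reindex_bij_betw[OF assms(1), of "\<lambda>x. (\<Sum>j\<in>{j\<in>{1..k}. \<theta> j = x}. f j) * g x"] by simp
  also have "\<dots> = (\<Sum>x\<in>T. \<Sum>j\<in>{j\<in>{1..k}. \<theta> j = x \<and> f j \<noteq> 0}. f j * g (\<theta> j))"
  proof (rule sum.cong[OF refl])
    fix x
    have "(\<Sum>j\<in>{j\<in>{1..k}. \<theta> j = x \<and> f j \<noteq> 0}. f j * g (\<theta> j)) = (\<Sum>j\<in>{j\<in>{1..k}. \<theta> j = x}. f j * g x)"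
      by (rule sum.mono_neutral_cong_left) auto
    then show "(\<Sum>j\<in>{j\<in>{1..k}. \<theta> j = x}. f j) * g x = (\<Sum>j\<in>{j\<in>{1..k}. \<theta> j = x \<and> f j \<noteq> 0}. f j * g (\<theta> j))"
      by (simp only: sum_distrib_right)
  qed
  also have "\<dots> = (\<Sum>j\<in>{j\<in>{1..k}. f j \<noteq> 0}. f j * g (\<theta> j))"
  proof -
    have T: "finite T" by (rule bij_betw_finite[OF assms(1), THEN iffD1, OF finite_atLeastAtMost])
    have eq: "{j\<in>{1..k}. \<theta> j = x \<and> f j \<noteq> 0} = {j \<in> {j\<in>{1..k}. f j \<noteq> 0}. \<theta> j = x}" for x by auto
    show ?thesis unfolding eq by (rule sum.group[OF _ T assms(2)]) simp
  qed
  also have "\<dots> = (\<Sum>j\<in>{1..k}. f j * g (\<theta> j))"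
    by (rule sum.mono_neutral_left) auto
  finally show ?thesis .
qed

text \<open>With \<open>T\<close> the union of the atoms of two distributions, both become weight
  vectors over one increasing list of atoms, the form in which \<open>W1_le_cdf_distance\<close>
  compares them.\<close>

lemma mixing_reindex:
  assumes w: "w \<in> weight_simplex k" and t: "bij_betw t {1..l} T" "\<theta> ` {j\<in>{1..k}. w j \<noteq> 0} \<subseteq> T"
  obtains u where "u \<in> weight_simplex l" "mixing k w \<theta> = mixing l u t"
    "\<And>g :: real \<Rightarrow> real. (\<Sum>i\<in>{1..l}. u i * g (t i)) = (\<Sum>j\<in>{1..k}. w j * g (\<theta> j))"
proof -
  define u where "u = (\<lambda>i\<in>{1..l}. \<Sum>j\<in>{j\<in>{1..k}. \<theta> j = t i}. w j)"
  have sums: "(\<Sum>i\<in>{1..l}. u i * g (t i)) = (\<Sum>j\<in>{1..k}. w j * g (\<theta> j))" for g :: "real \<Rightarrow> real"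
    using sum_over_fibres[OF t] by (simp add: u_def)
  have "u \<in> weight_simplex l"
    using sums[of "\<lambda>_. 1"] weight_simplex_sum[OF w] weight_simplex_nonneg[OF w]
    by (intro weight_simplexI) (auto simp: u_def intro!: sum_nonneg)
  moreover have "mixing k w \<theta> = mixing l u t"
  proof (rule measure_eqI)
    show "sets (mixing k w \<theta>) = sets (mixing l u t)" by (simp add: mixing_def)
    fix B assume "B \<in> sets (mixing k w \<theta>)"
    then have B: "B \<in> sets borel" by (simp add: mixing_def)
    have sub: "\<theta> ` {j\<in>{1..k}. ennreal (w j) \<noteq> 0} \<subseteq> T"
      using t(2) weight_simplex_nonneg[OF w] by (force simp: ennreal_eq_0_iff)
    have "(\<Sum>j\<in>{j\<in>{1..k}. \<theta> j = t i}. ennreal (w j)) = ennreal (u i)" if "i \<in> {1..l}" for i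
      using that weight_simplex_nonneg[OF w] by (simp add: u_def) (subst sum_ennreal, auto)
    then show "emeasure (mixing k w \<theta>) B = emeasure (mixing l u t) B"
      unfolding emeasure_mixing[OF B] using sum_over_fibres[OF t(1) sub, of "indicator B"] by simp
  qed
  ultimately show ?thesis using sums that by blast
qed

lemma mixing_dists_mono:
  assumes "k \<le> k'" "L \<ge> 0"
  shows "mixing_dists L k \<subseteq> mixing_dists L k'"
proof
  fix \<nu> assume "\<nu> \<in> mixing_dists L k"
  then obtain w \<theta> where w: "w \<in> weight_simplex k" and \<theta>: "\<theta> \<in> atom_cube L k" and \<nu>: "\<nu> = mixing k w \<theta>"
    by (auto simp: mixing_dists_def)
  define w' where "w' = (\<lambda>j\<in>{1..k'}. if j \<le> k then w j else 0)"
  \<comment> \<open>The padding atom 0 lies in [-L, L] because \<open>L \<ge> 0\<close>.\<close>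
  define \<theta>' where "\<theta>' = (\<lambda>j\<in>{1..k'}. if j \<le> k then \<theta> j else 0)"
  have "(\<Sum>j\<in>{1..k'}. w' j) = (\<Sum>j\<in>{1..k}. w j)"
    using assms by (intro sum.mono_neutral_cong_right) (auto simp: w'_def)
  then have "w' \<in> weight_simplex k'"
    using weight_simplex_nonneg[OF w] weight_simplex_sum[OF w]
    by (intro weight_simplexI) (auto simp: w'_def)
  moreover have "\<theta>' \<in> atom_cube L k'"
    using \<theta> assms by (auto simp: \<theta>'_def atom_cube_def PiE_iff)
  moreover have "\<nu> = mixing k' w' \<theta>'"
  proof (rule measure_eqI)
    show "sets \<nu> = sets (mixing k' w' \<theta>')" by (simp add: \<nu> mixing_def)
    fix B assume "B \<in> sets \<nu>"
    then have B: "B \<in> sets borel" by (simp add: \<nu> mixing_def)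
    show "emeasure \<nu> B = emeasure (mixing k' w' \<theta>') B"
      unfolding \<nu> emeasure_mixing[OF B] using assms
      by (intro sum.mono_neutral_cong_left) (auto simp: w'_def \<theta>'_def)
  qed
  ultimately show "\<nu> \<in> mixing_dists L k'" by (auto simp: mixing_dists_def)
qed

text \<open>A repeated atom or a zero weight would leave at most \<open>k - 1\<close> distinct atoms
  carrying mass, and padding would make this a representation with exactly \<open>k - 1\<close>
  components.\<close>

lemma exact_mixing_dists:
  assumes "w \<in> weight_simplex k" "\<theta> \<in> atom_cube L k" "mixing k w \<theta> \<notin> mixing_dists L (k - 1)" "L \<ge> 0"
  shows "inj_on \<theta> {1..k}" "\<And>j. j \<in> {1..k} \<Longrightarrow> 0 < w j"
proof -
  define S where "S = \<theta> ` {j\<in>{1..k}. w j \<noteq> 0}"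
  have "finite S" by (simp add: S_def)
  obtain t where t: "bij_betw t {1..card S} S" by (meson finite_set_strict_enumeration[OF \<open>finite S\<close>])
  obtain u where u: "u \<in> weight_simplex (card S)" "mixing k w \<theta> = mixing (card S) u t"
    by (rule mixing_reindex[OF assms(1) t]) (auto simp: S_def)
  have "t i \<in> S" if "i \<in> {1..card S}" for i using that t by (auto simp: bij_betw_def)
  then have "restrict t {1..card S} \<in> atom_cube L (card S)"
    using assms(2) by (fastforce simp: S_def atom_cube_def PiE_iff)
  \<comment> \<open>Points of \<open>atom_cube\<close> are extensional, whereas
    \<open>mixing\<close> sees only the values on the index set.\<close>
  moreover have "mixing (card S) u t = mixing (card S) u (restrict t {1..card S})"
    unfolding mixing_def by (intro distr_cong) (auto simp: space_point_measure)
  ultimately have "mixing k w \<theta> \<in> mixing_dists L (card S)"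
    using u by (auto simp: mixing_dists_def)
  then have card: "\<not> card S \<le> k - 1" using assms(3,4) mixing_dists_mono by blast
  have le: "card S \<le> card {j\<in>{1..k}. w j \<noteq> 0}" "card {j\<in>{1..k}. w j \<noteq> 0} \<le> card {1..k}"
    unfolding S_def by (auto intro!: card_image_le card_mono simp del: card_atLeastAtMost)
  then have "card {j\<in>{1..k}. w j \<noteq> 0} = card {1..k}" using card by simp
  then have all: "{j\<in>{1..k}. w j \<noteq> 0} = {1..k}" by (intro card_subset_eq) auto
  show "0 < w j" if "j \<in> {1..k}" for j
  proof -
    have "j \<in> {j\<in>{1..k}. w j \<noteq> 0}" unfolding all by (rule that)
    then show ?thesis using weight_simplex_nonneg[OF assms(1) that] by simp
  qed
  have "card (\<theta> ` {1..k}) = card {1..k}" using card le unfolding S_def all by simp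
  then show "inj_on \<theta> {1..k}" by (intro eq_card_imp_inj_on) auto
qed

section \<open>Interpolation of step functions\<close>

text \<open>The bound is on the coefficients rather than on the values, because the second moment in
  \<open>unbiased_exponential\<close> is estimated through the absolute values of the coefficients.
  The radius \<rho> is an upper bound on the nodes.\<close>

definition poly_funs :: "nat \<Rightarrow> real \<Rightarrow> real \<Rightarrow> (real \<Rightarrow> real) set" where
  "poly_funs m \<rho> c = {g. \<exists>b. (\<forall>x. g x = (\<Sum>i\<le>m. b i * x ^ i)) \<and> (\<Sum>i\<le>m. \<bar>b i\<bar> * \<rho> ^ i) \<le> c}"

lemma poly_funs_const:
  assumes "\<bar>a\<bar> \<le> c"
  shows "(\<lambda>_. a) \<in> poly_funs m \<rho> c"
  unfolding poly_funs_def
proof (intro CollectI exI conjI allI)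
  have eq: "(\<Sum>i\<le>m. (if i = 0 then e else 0) * x ^ i) = e" for e x :: real
    by (induction m) auto
  show "a = (\<Sum>i\<le>m. (if i = 0 then a else 0) * x ^ i)" for x :: real by (simp only: eq)
  have "(\<Sum>i\<le>m. \<bar>if i = 0 then a else 0\<bar> * \<rho> ^ i) = (\<Sum>i\<le>m. (if i = 0 then \<bar>a\<bar> else 0) * \<rho> ^ i)"
    by (intro sum.cong) auto
  then show "(\<Sum>i\<le>m. \<bar>if i = 0 then a else 0\<bar> * \<rho> ^ i) \<le> c" using assms by (simp only: eq)
qed

lemma poly_funs_mono: "g \<in> poly_funs m \<rho> c \<Longrightarrow> c \<le> c' \<Longrightarrow> g \<in> poly_funs m \<rho> c'"
  by (force simp: poly_funs_def)

lemma poly_funs_add: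
  assumes "g \<in> poly_funs m \<rho> c" "g' \<in> poly_funs m \<rho> c'" "\<rho> \<ge> 0"
  shows "(\<lambda>x. g x + g' x) \<in> poly_funs m \<rho> (c + c')"
proof -
  obtain b b' where b: "\<forall>x. g x = (\<Sum>i\<le>m. b i * x ^ i)" "(\<Sum>i\<le>m. \<bar>b i\<bar> * \<rho> ^ i) \<le> c"
    and b': "\<forall>x. g' x = (\<Sum>i\<le>m. b' i * x ^ i)" "(\<Sum>i\<le>m. \<bar>b' i\<bar> * \<rho> ^ i) \<le> c'"
    using assms by (auto simp: poly_funs_def)
  have "(\<Sum>i\<le>m. \<bar>b i + b' i\<bar> * \<rho> ^ i) \<le> (\<Sum>i\<le>m. (\<bar>b i\<bar> + \<bar>b' i\<bar>) * \<rho> ^ i)"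
    using assms(3) by (intro sum_mono mult_right_mono) auto
  then have "(\<Sum>i\<le>m. \<bar>b i + b' i\<bar> * \<rho> ^ i) \<le> c + c'"
    using b(2) b'(2) by (simp add: distrib_right sum.distrib)
  then show ?thesis
    using b(1) b'(1) unfolding poly_funs_def
    by (intro CollectI exI[of _ "\<lambda>i. b i + b' i"] conjI allI) (simp add: distrib_right sum.distrib)+
qed

lemma poly_funs_scale:
  assumes "g \<in> poly_funs m \<rho> c"
  shows "(\<lambda>x. a * g x) \<in> poly_funs m \<rho> (\<bar>a\<bar> * c)"
proof -
  obtain b where b: "\<forall>x. g x = (\<Sum>i\<le>m. b i * x ^ i)" "(\<Sum>i\<le>m. \<bar>b i\<bar> * \<rho> ^ i) \<le> c"
    using assms by (auto simp: poly_funs_def)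
  have "(\<Sum>i\<le>m. \<bar>a * b i\<bar> * \<rho> ^ i) = \<bar>a\<bar> * (\<Sum>i\<le>m. \<bar>b i\<bar> * \<rho> ^ i)"
    by (simp add: sum_distrib_left abs_mult mult.assoc)
  then have "(\<Sum>i\<le>m. \<bar>a * b i\<bar> * \<rho> ^ i) \<le> \<bar>a\<bar> * c" using b(2) by (simp add: mult_left_mono)
  then show ?thesis
    using b(1) unfolding poly_funs_def
    by (intro CollectI exI[of _ "\<lambda>i. a * b i"]) (simp add: sum_distrib_left mult.assoc)
qed

lemma poly_funs_mult_X:
  assumes "g \<in> poly_funs m \<rho> c" "\<rho> \<ge> 0"
  shows "(\<lambda>x. x * g x) \<in> poly_funs (Suc m) \<rho> (\<rho> * c)"
proof -
  obtain b where b: "\<forall>x. g x = (\<Sum>i\<le>m. b i * x ^ i)" "(\<Sum>i\<le>m. \<bar>b i\<bar> * \<rho> ^ i) \<le> c"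
    using assms by (auto simp: poly_funs_def)
  define b' where "b' = (\<lambda>i. case i of 0 \<Rightarrow> 0 | Suc i \<Rightarrow> b i)"
  have "(\<Sum>i\<le>Suc m. b' i * x ^ i) = x * g x" for x
    by (simp add: sum.atMost_Suc_shift b'_def b(1) sum_distrib_left mult_ac del: sum.atMost_Suc)
  moreover have "(\<Sum>i\<le>Suc m. \<bar>b' i\<bar> * \<rho> ^ i) = \<rho> * (\<Sum>i\<le>m. \<bar>b i\<bar> * \<rho> ^ i)"
    by (simp add: sum.atMost_Suc_shift b'_def sum_distrib_left mult_ac del: sum.atMost_Suc)
  ultimately show ?thesis
    using mult_left_mono[OF b(2) assms(2)] unfolding poly_funs_def
    by (intro CollectI exI[of _ b']) simp
qed

lemma poly_funs_Suc:
  assumes "g \<in> poly_funs m \<rho> c"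
  shows "g \<in> poly_funs (Suc m) \<rho> c"
proof -
  obtain b where b: "\<forall>x. g x = (\<Sum>i\<le>m. b i * x ^ i)" "(\<Sum>i\<le>m. \<bar>b i\<bar> * \<rho> ^ i) \<le> c"
    using assms by (auto simp: poly_funs_def)
  then show ?thesis
    unfolding poly_funs_def by (intro CollectI exI[of _ "\<lambda>i. if i \<le> m then b i else 0"]) simp
qed

lemma poly_funs_mult_linear:
  assumes "g \<in> poly_funs m \<rho> c" "\<rho> \<ge> 0" "\<bar>a\<bar> \<le> \<rho>"
  shows "(\<lambda>x. (x - a) * g x) \<in> poly_funs (Suc m) \<rho> (2 * \<rho> * c)"
proof -
  \<comment> \<open>The bound on the coefficients forces \<open>c\<close> to be nonnegative.\<close>
  obtain b where "(\<Sum>i\<le>m. \<bar>b i\<bar> * \<rho> ^ i) \<le> c" using assms(1) by (auto simp: poly_funs_def)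
  moreover have "0 \<le> (\<Sum>i\<le>m. \<bar>b i\<bar> * \<rho> ^ i)" using assms(2) by (intro sum_nonneg) auto
  ultimately have "0 \<le> c" by linarith
  have "(\<lambda>x. x * g x + (- a) * g x) \<in> poly_funs (Suc m) \<rho> (\<rho> * c + \<bar>- a\<bar> * c)"
    using assms by (intro poly_funs_add poly_funs_mult_X poly_funs_scale poly_funs_Suc)
  then show ?thesis
    by (rule poly_funs_mono[THEN back_subst[of "\<lambda>g. g \<in> _"]])
       (use mult_right_mono[OF assms(3) \<open>0 \<le> c\<close>] in \<open>auto simp: algebra_simps\<close>)
qed

text \<open>Neville's recursion. On a block of nodes not containing the jump the interpolant is
  constant, so only blocks around the jump contribute a factor.\<close>

lemma step_interpolation:
  fixes y \<kappa> :: "nat \<Rightarrow> real"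
  assumes y: "\<And>j. j \<in> {1..l} \<Longrightarrow> \<bar>y j\<bar> \<le> \<rho>" "strict_mono_on {1..l} y"
    and \<kappa>: "\<And>i. \<kappa> i \<ge> 1"
    and gap: "\<And>a i. 1 \<le> a \<Longrightarrow> a + i \<le> l \<Longrightarrow> a \<le> r \<Longrightarrow> r < a + i \<Longrightarrow> 4 * \<rho> \<le> \<kappa> i * (y (a + i) - y a)"
    and a: "1 \<le> a" "a + i \<le> l"
  shows "\<exists>g \<in> poly_funs i \<rho> (\<Prod>s\<in>{1..i}. \<kappa> s). \<forall>j\<in>{a..a+i}. g (y j) = of_bool (j \<le> r)"
  using a
proof (induction i arbitrary: a)
  case 0
  then show ?case by (intro bexI[of _ "\<lambda>_. of_bool (a \<le> r)"] poly_funs_const) auto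
next
  case (Suc i)
  let ?c = "\<Prod>s\<in>{1..i}. \<kappa> s"
  have c1: "1 \<le> (\<Prod>s\<in>{1..m}. \<kappa> s)" for m using \<kappa> by (intro prod_ge_1) auto
  show ?case
  proof (cases "a \<le> r \<and> r < a + Suc i")
    case False
    then show ?thesis using c1[of "Suc i"]
      by (intro bexI[of _ "\<lambda>_. of_bool (a \<le> r)"] poly_funs_const) auto
  next
    case True
    obtain g1 where g1: "g1 \<in> poly_funs i \<rho> ?c" "\<forall>j\<in>{a..a+i}. g1 (y j) = of_bool (j \<le> r)"
      using Suc.IH[of a] Suc.prems by auto
    obtain g2 where g2: "g2 \<in> poly_funs i \<rho> ?c" "\<forall>j\<in>{Suc a..Suc a+i}. g2 (y j) = of_bool (j \<le> r)"
      using Suc.IH[of "Suc a"] Suc.prems by auto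
    let ?b = "a + Suc i"
    define d where "d = y ?b - y a"
    have d: "d > 0" using y(2) Suc.prems by (auto simp: d_def strict_mono_on_def)
    have \<rho>: "\<rho> \<ge> 0" using y(1)[of a] Suc.prems by auto
    \<comment> \<open>Neville's combination of the interpolants on the two shorter blocks. At an
      inner node both take the same value, and the linear factors differ by \<open>d\<close>; at an
      end node one of the two terms vanishes.\<close>
    define g where "g x = (1/d) * ((x - y a) * g2 x + (- 1) * ((x - y ?b) * g1 x))" for x
    have "g \<in> poly_funs (Suc i) \<rho> (\<bar>1/d\<bar> * (2 * \<rho> * ?c + \<bar>- 1\<bar> * (2 * \<rho> * ?c)))"
      unfolding g_def using y(1) Suc.prems \<rho> g1 g2
      by (intro poly_funs_scale poly_funs_add poly_funs_mult_linear) auto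
    \<comment> \<open>Two linear factors, each costing \<open>2 * \<rho>\<close>: this is the
      \<open>4 * \<rho>\<close> in the hypothesis on the gaps.\<close>
    moreover have "\<bar>1/d\<bar> * (2 * \<rho> * ?c + \<bar>- 1\<bar> * (2 * \<rho> * ?c)) = ?c * (4 * \<rho> / d)" using d by simp
    moreover have "4 * \<rho> / d \<le> \<kappa> (Suc i)"
      using gap[of a "Suc i"] Suc.prems True d by (simp add: d_def field_simps)
    then have "?c * (4 * \<rho> / d) \<le> ?c * \<kappa> (Suc i)" using c1[of i] by (intro mult_left_mono) auto
    ultimately have "g \<in> poly_funs (Suc i) \<rho> (\<Prod>s\<in>{1..Suc i}. \<kappa> s)"
      by (auto intro: poly_funs_mono)
    moreover have "g (y j) = of_bool (j \<le> r)" if "j \<in> {a..?b}" for j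
    proof -
      show ?thesis
      proof (cases "j = a \<or> j = ?b")
        case True
        then show ?thesis using g1(2) g2(2) d by (auto simp: g_def d_def field_simps)
      next
        case False
        then have "j \<in> {a..a+i}" "j \<in> {Suc a..Suc a+i}" using that by auto
        then have "g (y j) = (1/d) * (d * of_bool (j \<le> r))"
          using g1(2) g2(2) by (simp add: g_def d_def algebra_simps)
        then show ?thesis using d by simp
      qed
    qed
    ultimately show ?thesis by blast
  qed
qed

section \<open>Gaussian mixtures\<close>

text \<open>Real-valued and open to weights that do not sum to one: the likelihood comparisons below
  shrink the weights by a factor or raise each of them by a constant.\<close>

definition gmix :: "nat \<Rightarrow> (nat \<Rightarrow> real) \<Rightarrow> (nat \<Rightarrow> real) \<Rightarrow> real \<Rightarrow> real" where
  "gmix k w \<theta> x = (\<Sum>j\<in>{1..k}. w j * normal_density (\<theta> j) 1 x)"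

lemma gmix_measurable [measurable]: "gmix k w \<theta> \<in> borel_measurable borel"
  unfolding gmix_def[abs_def] by measurable

lemma gmix_nonneg: "(\<And>j. j \<in> {1..k} \<Longrightarrow> 0 \<le> w j) \<Longrightarrow> 0 \<le> gmix k w \<theta> x"
  by (auto simp: gmix_def intro!: sum_nonneg)

lemma gmix_pos:
  assumes "w \<in> weight_simplex k"
  shows "0 < gmix k w \<theta> x"
proof -
  obtain j where j: "j \<in> {1..k}" "w j \<noteq> 0"
    using weight_simplex_sum[OF assms] by (metis sum.neutral zero_neq_one)
  then have "0 < w j" using weight_simplex_nonneg[OF assms] by force
  then have "0 < w j * normal_density (\<theta> j) 1 x" by (simp add: normal_density_pos)
  also have "\<dots> \<le> gmix k w \<theta> x"
    unfolding gmix_def using j weight_simplex_nonneg[OF assms] by (intro member_le_sum) auto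
  finally show ?thesis .
qed

lemma mixture_density_mixing:
  assumes "\<And>j. j \<in> {1..k} \<Longrightarrow> 0 \<le> w j"
  shows "mixture_density (mixing k w \<theta>) x = ennreal (gmix k w \<theta> x)"
proof -
  have [measurable]: "(\<lambda>t. normal_density t 1 x) \<in> borel_measurable borel"
    unfolding normal_density_def by measurable
  have "mixture_density (mixing k w \<theta>) x = (\<Sum>j\<in>{1..k}. ennreal (w j) * ennreal (normal_density (\<theta> j) 1 x))"
    unfolding mixture_density_def by (subst nn_integral_mixing) auto
  also have "\<dots> = (\<Sum>j\<in>{1..k}. ennreal (w j * normal_density (\<theta> j) 1 x))"
    using assms by (intro sum.cong refl) (simp add: ennreal_mult)
  finally show ?thesis
    unfolding gmix_def using assms by (subst (asm) sum_ennreal) auto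
qed

abbreviation gauss_mean :: "real \<Rightarrow> (real \<Rightarrow> real) \<Rightarrow> real \<Rightarrow> bool" where
  "gauss_mean \<theta> f \<equiv> has_bochner_integral lborel (\<lambda>x. normal_density \<theta> 1 x * f x)"

lemma has_bochner_integral_gmix:
  assumes "\<And>j. j \<in> {1..k} \<Longrightarrow> gauss_mean (\<theta> j) f (I j)"
  shows "has_bochner_integral lborel (\<lambda>x. gmix k w \<theta> x * f x) (\<Sum>j\<in>{1..k}. w j * I j)"
proof -
  have "(\<lambda>x. gmix k w \<theta> x * f x) = (\<lambda>x. \<Sum>j\<in>{1..k}. w j * (normal_density (\<theta> j) 1 x * f x))"
    by (simp add: gmix_def sum_distrib_right mult.assoc)
  then show ?thesis
    using assms by (simp only:) (intro has_bochner_integral_sum has_bochner_integral_mult_right)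
qed

lemma has_bochner_integral_normal_density:
  "has_bochner_integral lborel (\<lambda>x. normal_density \<mu> 1 x) 1"
  using integral_normal_density[of 1 \<mu>] integrable_normal_density[of 1 \<mu>]
  by (simp add: has_bochner_integral_iff)

lemma has_bochner_integral_gmix_total:
  "has_bochner_integral lborel (gmix k w \<theta>) (\<Sum>j\<in>{1..k}. w j)"
  using has_bochner_integral_gmix[of k \<theta> "\<lambda>_. 1" "\<lambda>_. 1" w] has_bochner_integral_normal_density by simp

section \<open>Exponential tilting and unbiased estimation\<close>

text \<open>Completing the square: tilting by \<open>a\<close> moves the mean by \<open>a\<close>.
  Consequently \<open>exp (a * x - a\<^sup>2 / 2)\<close> is an unbiased estimator of
  \<open>exp (a * \<theta>)\<close>.\<close>

lemma normal_density_exp_tilt: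
  "normal_density \<theta> 1 x * exp (a * x - a\<^sup>2 / 2) = exp (a * \<theta>) * normal_density (\<theta> + a) 1 x"
proof -
  have "exp (- (x - \<theta>)\<^sup>2 / 2) * exp (a * x - a\<^sup>2 / 2) = exp (a * \<theta>) * exp (- (x - (\<theta> + a))\<^sup>2 / 2)"
    unfolding exp_add[symmetric] by (rule arg_cong[of _ _ exp]) (simp add: power2_eq_square field_simps)
  then show ?thesis by (simp add: normal_density_def)
qed

lemma has_bochner_integral_exp_tilt:
  "has_bochner_integral lborel (\<lambda>x. normal_density \<theta> 1 x * exp (a * x - a\<^sup>2 / 2)) (exp (a * \<theta>))"
  unfolding normal_density_exp_tilt
  using has_bochner_integral_mult_right[OF has_bochner_integral_normal_density, of "exp (a * \<theta>)"] by simp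

text \<open>A polynomial in \<open>exp (\<alpha> * \<theta>)\<close> is the mean under \<open>N(\<theta>, 1)\<close> of a combination \<open>h\<close> of
  exponentials. These play the role of Hermite polynomials in the moment method, and their second
  moments are at most exponential in the number of atoms when \<open>\<lambda>\<close> is of order \<open>1/\<surd>k\<close>.\<close>

lemma unbiased_exponential:
  assumes g: "g \<in> poly_funs m \<rho> c" and "0 \<le> \<alpha>"
  obtains h where "h \<in> borel_measurable borel"
    "\<And>\<theta>. gauss_mean \<theta> h (g (exp (\<alpha> * \<theta>)))"
    "\<And>\<theta>. exp (\<alpha> * \<theta>) \<le> \<rho> \<Longrightarrow> \<exists>I\<le>exp ((real m * \<alpha>)\<^sup>2) * c\<^sup>2.
       gauss_mean \<theta> (\<lambda>x. (h x)\<^sup>2) I"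
proof -
  obtain b where b: "\<forall>x. g x = (\<Sum>i\<le>m. b i * x ^ i)" "(\<Sum>i\<le>m. \<bar>b i\<bar> * \<rho> ^ i) \<le> c"
    using g by (auto simp: poly_funs_def)
  define e where "e i x = exp (real i * \<alpha> * x - (real i * \<alpha>)\<^sup>2 / 2)" for i :: nat and x
  define h where "h x = (\<Sum>i\<le>m. b i * e i x)" for x
  show ?thesis
  proof
    show "h \<in> borel_measurable borel" unfolding h_def[abs_def] e_def[abs_def] by measurable
    fix \<theta> :: real
    have pow: "exp (\<alpha> * \<theta>) ^ i = exp (real i * \<alpha> * \<theta>)" for i :: nat
      by (simp add: exp_of_nat_mult[symmetric] mult.assoc)
    have "has_bochner_integral lborel (\<lambda>x. \<Sum>i\<le>m. b i * (normal_density \<theta> 1 x * e i x)) (\<Sum>i\<le>m. b i * exp (real i * \<alpha> * \<theta>))"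
      unfolding e_def by (intro has_bochner_integral_sum has_bochner_integral_mult_right has_bochner_integral_exp_tilt)
    then show "gauss_mean \<theta> h (g (exp (\<alpha> * \<theta>)))"
      by (simp add: h_def b(1) pow sum_distrib_left mult_ac)
    define I where "I = (\<Sum>i\<le>m. \<Sum>j\<le>m. b i * b j * exp (real i * real j * \<alpha>\<^sup>2) * exp (real (i + j) * \<alpha> * \<theta>))"
    \<comment> \<open>The factor \<open>exp (real i * real j * \<alpha>\<^sup>2)\<close> is all that
      distinguishes the second moment from the square of the mean; for degrees up to
      \<open>m\<close> it is at most \<open>exp ((real m * \<alpha>)\<^sup>2)\<close>.\<close>
    have prod: "e i x * e j x = exp (real i * real j * \<alpha>\<^sup>2) * e (i + j) x" for i j x
      unfolding e_def exp_add[symmetric]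
      by (rule arg_cong[of _ _ exp]) (simp add: power2_eq_square field_simps)
    have sq: "normal_density \<theta> 1 x * (h x)\<^sup>2 = (\<Sum>i\<le>m. \<Sum>j\<le>m. b i * b j * exp (real i * real j * \<alpha>\<^sup>2) *
        (normal_density \<theta> 1 x * e (i + j) x))" for x
    proof -
      have "(h x)\<^sup>2 = (\<Sum>i\<le>m. \<Sum>j\<le>m. b i * b j * (e i x * e j x))"
        unfolding h_def power2_eq_square sum_product by (simp add: mult_ac)
      then show ?thesis unfolding prod by (simp add: sum_distrib_left mult_ac)
    qed
    have "gauss_mean \<theta> (\<lambda>x. (h x)\<^sup>2) I"
      unfolding sq I_def e_def
      by (intro has_bochner_integral_sum has_bochner_integral_mult_right has_bochner_integral_exp_tilt)
    moreover assume y: "exp (\<alpha> * \<theta>) \<le> \<rho>"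
    have "I \<le> exp ((real m * \<alpha>)\<^sup>2) * c\<^sup>2"
    proof -
      let ?s = "\<Sum>i\<le>m. \<bar>b i\<bar> * exp (\<alpha> * \<theta>) ^ i"
      have "b i * b j * exp (real i * real j * \<alpha>\<^sup>2) * exp (real (i + j) * \<alpha> * \<theta>)
          \<le> exp ((real m * \<alpha>)\<^sup>2) * ((\<bar>b i\<bar> * exp (\<alpha> * \<theta>) ^ i) * (\<bar>b j\<bar> * exp (\<alpha> * \<theta>) ^ j))"
        if "i \<le> m" "j \<le> m" for i j
      proof -
        have "real i * real j * \<alpha>\<^sup>2 \<le> real m * real m * \<alpha>\<^sup>2"
          using that by (intro mult_right_mono mult_mono) auto
        then have E: "exp (real i * real j * \<alpha>\<^sup>2) \<le> exp ((real m * \<alpha>)\<^sup>2)"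
          by (simp add: power2_eq_square mult_ac)
        have "b i * b j \<le> \<bar>b i\<bar> * \<bar>b j\<bar>" by (metis abs_ge_self abs_mult)
        moreover have "exp (real (i + j) * \<alpha> * \<theta>) = exp (\<alpha> * \<theta>) ^ i * exp (\<alpha> * \<theta>) ^ j"
          unfolding pow exp_add[symmetric] by (simp add: algebra_simps)
        ultimately have "(b i * b j) * (exp (real i * real j * \<alpha>\<^sup>2) * exp (real (i + j) * \<alpha> * \<theta>))
            \<le> (\<bar>b i\<bar> * \<bar>b j\<bar>) * (exp (real i * real j * \<alpha>\<^sup>2) * (exp (\<alpha> * \<theta>) ^ i * exp (\<alpha> * \<theta>) ^ j))"
          by (simp add: mult_right_mono)
        also have "\<dots> \<le> (\<bar>b i\<bar> * \<bar>b j\<bar>) * (exp ((real m * \<alpha>)\<^sup>2) * (exp (\<alpha> * \<theta>) ^ i * exp (\<alpha> * \<theta>) ^ j))"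
          by (intro mult_left_mono mult_right_mono E) auto
        finally have "(b i * b j) * (exp (real i * real j * \<alpha>\<^sup>2) * exp (real (i + j) * \<alpha> * \<theta>))
            \<le> (\<bar>b i\<bar> * \<bar>b j\<bar>) * (exp ((real m * \<alpha>)\<^sup>2) * (exp (\<alpha> * \<theta>) ^ i * exp (\<alpha> * \<theta>) ^ j))" .
        then show ?thesis by (simp add: mult_ac)
      qed
      then have "I \<le> (\<Sum>i\<le>m. \<Sum>j\<le>m. exp ((real m * \<alpha>)\<^sup>2) * ((\<bar>b i\<bar> * exp (\<alpha> * \<theta>) ^ i) * (\<bar>b j\<bar> * exp (\<alpha> * \<theta>) ^ j)))"
        unfolding I_def by (intro sum_mono) auto
      also have "\<dots> = exp ((real m * \<alpha>)\<^sup>2) * ?s\<^sup>2"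
        unfolding power2_eq_square[of "?s"] sum_product by (simp only: sum_distrib_left)
      also have "\<dots> \<le> exp ((real m * \<alpha>)\<^sup>2) * c\<^sup>2"
      proof (intro mult_left_mono power_mono)
        have "?s \<le> (\<Sum>i\<le>m. \<bar>b i\<bar> * \<rho> ^ i)" using y by (intro sum_mono mult_left_mono power_mono) auto
        then show "?s \<le> c" using b(2) by linarith
      qed (auto intro!: sum_nonneg)
      finally show ?thesis .
    qed
    ultimately show "\<exists>I\<le>exp ((real m * \<alpha>)\<^sup>2) * c\<^sup>2.
       gauss_mean \<theta> (\<lambda>x. (h x)\<^sup>2) I" by blast
  qed
qed

section \<open>Affinity and differences of means\<close>

text \<open>The Hellinger affinity, or Bhattacharyya coefficient. It is multiplicative over
  independent observations, which \<open>likelihood_ratio_tail\<close> exploits.\<close>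

definition affinity :: "(real \<Rightarrow> real) \<Rightarrow> (real \<Rightarrow> real) \<Rightarrow> real" where
  "affinity p q = (\<integral>x. sqrt (p x * q x) \<partial>lborel)"

text \<open>In terms of the square roots of \<open>a\<close> and \<open>b\<close>, the difference of
  the two sides is half a sum of two squares. For \<open>s = 0\<close> this is the inequality of the
  two means; with \<open>s * h x\<close> in place of \<open>s\<close> it can be integrated against a
  test function \<open>h\<close>, in place of a Cauchy-Schwarz argument.\<close>

lemma sqrt_mult_le_mean:
  fixes a b :: real
  assumes "0 \<le> a" "0 \<le> b"
  shows "sqrt (a * b) \<le> (a + b) / 2 - s * (a - b) + s\<^sup>2 * (a + b)"
proof -
  define u v where "u = sqrt a" and "v = sqrt b"
  have ab: "a = u\<^sup>2" "b = v\<^sup>2" "u \<ge> 0" "v \<ge> 0" using assms by (auto simp: u_def v_def)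
  have "sqrt (a * b) = u * v" by (simp add: u_def v_def real_sqrt_mult)
  moreover have "(u\<^sup>2 + v\<^sup>2) / 2 - s * (u\<^sup>2 - v\<^sup>2) + s\<^sup>2 * (u\<^sup>2 + v\<^sup>2) - u * v
      = (u - v - s * (u + v))\<^sup>2 / 2 + s\<^sup>2 * (u - v)\<^sup>2 / 2"
    by (simp add: power2_eq_square field_simps)
  moreover have "0 \<le> (u - v - s * (u + v))\<^sup>2 / 2 + s\<^sup>2 * (u - v)\<^sup>2 / 2" by simp
  ultimately show ?thesis unfolding ab by linarith
qed

lemma integrable_sqrt_mult:
  fixes p q :: "real \<Rightarrow> real"
  assumes "integrable lborel p" "integrable lborel q" "\<And>x. 0 \<le> p x" "\<And>x. 0 \<le> q x"
  shows "integrable lborel (\<lambda>x. sqrt (p x * q x))"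
proof (rule Bochner_Integration.integrable_bound)
  show "integrable lborel (\<lambda>x. p x + q x)" using assms by auto
  show "(\<lambda>x. sqrt (p x * q x)) \<in> borel_measurable lborel"
    using assms(1,2)[THEN borel_measurable_integrable] by measurable
  have "norm (sqrt (p x * q x)) \<le> norm (p x + q x)" for x
    using sqrt_mult_le_mean[of "p x" "q x" 0] assms(3,4)[of x] by simp
  then show "AE x in lborel. norm (sqrt (p x * q x)) \<le> norm (p x + q x)" by simp
qed

lemma affinity_le_mean_difference:
  assumes w: "w \<in> weight_simplex k" "w' \<in> weight_simplex k" and [measurable]: "h \<in> borel_measurable borel"
    and "B > 0"
    and mean: "\<And>j. j \<in> {1..k} \<Longrightarrow> gauss_mean (\<theta> j) h (I j)"
      "\<And>j. j \<in> {1..k} \<Longrightarrow> gauss_mean (\<theta>' j) h (I' j)"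
    and second: "\<And>j. j \<in> {1..k} \<Longrightarrow> \<exists>J\<le>B. gauss_mean (\<theta> j) (\<lambda>x. (h x)\<^sup>2) J"
      "\<And>j. j \<in> {1..k} \<Longrightarrow> \<exists>J\<le>B. gauss_mean (\<theta>' j) (\<lambda>x. (h x)\<^sup>2) J"
    and D: "D = (\<Sum>j\<in>{1..k}. w j * I j) - (\<Sum>j\<in>{1..k}. w' j * I' j)"
  shows "affinity (gmix k w \<theta>) (gmix k w' \<theta>') \<le> 1 - D\<^sup>2 / (8 * B)"
proof -
  \<comment> \<open>The minimizer of \<open>- s * D + 2 * s\<^sup>2 * B\<close>.\<close>
  define s where "s = D / (4 * B)"
  have J_le: "(\<Sum>j\<in>{1..k}. v j * J j) \<le> B" if "v \<in> weight_simplex k" "\<forall>j\<in>{1..k}. J j \<le> B" for v J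
  proof -
    have "(\<Sum>j\<in>{1..k}. v j * J j) \<le> (\<Sum>j\<in>{1..k}. v j * B)"
      using that weight_simplex_nonneg by (intro sum_mono mult_left_mono) auto
    then show ?thesis using weight_simplex_sum[OF that(1)] by (simp flip: sum_distrib_right)
  qed
  have "\<exists>J. \<forall>j\<in>{1..k}. J j \<le> B \<and> gauss_mean (\<theta> j) (\<lambda>x. (h x)\<^sup>2) (J j)"
    by (rule bchoice) (use second(1) in blast)
  then obtain J where J: "\<forall>j\<in>{1..k}. J j \<le> B \<and> gauss_mean (\<theta> j) (\<lambda>x. (h x)\<^sup>2) (J j)" ..
  have "\<exists>J. \<forall>j\<in>{1..k}. J j \<le> B \<and> gauss_mean (\<theta>' j) (\<lambda>x. (h x)\<^sup>2) (J j)"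
    by (rule bchoice) (use second(2) in blast)
  then obtain J' where J': "\<forall>j\<in>{1..k}. J' j \<le> B \<and> gauss_mean (\<theta>' j) (\<lambda>x. (h x)\<^sup>2) (J' j)" ..
  let ?p = "gmix k w \<theta>" and ?q = "gmix k w' \<theta>'"
  let ?I = "\<Sum>j\<in>{1..k}. w j * I j" and ?I' = "\<Sum>j\<in>{1..k}. w' j * I' j"
  let ?J = "\<Sum>j\<in>{1..k}. w j * J j" and ?J' = "\<Sum>j\<in>{1..k}. w' j * J' j"
  have tot: "has_bochner_integral lborel ?p 1" "has_bochner_integral lborel ?q 1"
    using has_bochner_integral_gmix_total[of k w \<theta>] has_bochner_integral_gmix_total[of k w' \<theta>']
      weight_simplex_sum[OF w(1)] weight_simplex_sum[OF w(2)] by auto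
  have "has_bochner_integral lborel (\<lambda>x. (?p x + ?q x) / 2 - s * (?p x * h x - ?q x * h x)
        + s\<^sup>2 * (?p x * (h x)\<^sup>2 + ?q x * (h x)\<^sup>2)) ((1 + 1) / 2 - s * (?I - ?I') + s\<^sup>2 * (?J + ?J'))"
    using J J' mean
    by (intro has_bochner_integral_add has_bochner_integral_diff has_bochner_integral_mult_right
        has_bochner_integral_gmix has_bochner_integral_divide tot) auto
  then have rhs: "integrable lborel (\<lambda>x. (?p x + ?q x) / 2 - s * (?p x * h x - ?q x * h x)
        + s\<^sup>2 * (?p x * (h x)\<^sup>2 + ?q x * (h x)\<^sup>2))"
      "(\<integral>x. (?p x + ?q x) / 2 - s * (?p x * h x - ?q x * h x)
        + s\<^sup>2 * (?p x * (h x)\<^sup>2 + ?q x * (h x)\<^sup>2) \<partial>lborel) = 1 - s * D + s\<^sup>2 * (?J + ?J')"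
    by (auto simp: has_bochner_integral_iff D)
  have nonneg: "0 \<le> ?p x" "0 \<le> ?q x" for x
    using gmix_pos[OF w(1)] gmix_pos[OF w(2)] by (auto intro: less_imp_le)
  have "affinity ?p ?q \<le> 1 - s * D + s\<^sup>2 * (?J + ?J')"
    unfolding affinity_def rhs(2)[symmetric]
  proof (rule integral_mono[OF _ rhs(1)])
    show "integrable lborel (\<lambda>x. sqrt (?p x * ?q x))"
      using tot nonneg by (intro integrable_sqrt_mult) (auto simp: has_bochner_integral_iff)
    show "sqrt (?p x * ?q x) \<le> (?p x + ?q x) / 2 - s * (?p x * h x - ?q x * h x)
        + s\<^sup>2 * (?p x * (h x)\<^sup>2 + ?q x * (h x)\<^sup>2)" for x
      using sqrt_mult_le_mean[OF nonneg, of x x "s * h x"] by (simp add: power2_eq_square algebra_simps)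
  qed
  also have "\<dots> \<le> 1 - s * D + s\<^sup>2 * (B + B)"
    using J_le[OF w(1), of J] J_le[OF w(2), of J'] J J' by (intro add_left_mono mult_left_mono add_mono) auto
  also have "\<dots> = 1 - D\<^sup>2 / (8 * B)"
    using \<open>B > 0\<close> by (simp add: s_def power2_eq_square field_simps)
  finally show ?thesis .
qed

section \<open>Separation in affinity\<close>

lemma abs_sum_weight_difference_le_1:
  assumes "u \<in> weight_simplex l" "v \<in> weight_simplex l" "r \<le> l"
  shows "\<bar>\<Sum>i\<in>{1..r}. u i - v i\<bar> \<le> 1"
proof -
  have "0 \<le> (\<Sum>i\<in>{1..r}. u i) \<and> (\<Sum>i\<in>{1..r}. u i) \<le> 1" if u: "u \<in> weight_simplex l" for u
  proof
    show "0 \<le> (\<Sum>i\<in>{1..r}. u i)"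
      using assms(3) weight_simplex_nonneg[OF u] by (intro sum_nonneg) auto
    have "(\<Sum>i\<in>{1..r}. u i) \<le> (\<Sum>i\<in>{1..l}. u i)"
      using assms(3) weight_simplex_nonneg[OF u] by (intro sum_mono2) auto
    then show "(\<Sum>i\<in>{1..r}. u i) \<le> 1" using weight_simplex_sum[OF u] by simp
  qed
  from this[OF assms(1)] this[OF assms(2)] show ?thesis by (simp add: sum_subtractf abs_le_iff)
qed

text \<open>The price of the change of variables: a gap shrinks by a factor of order \<alpha>. Since
  \<alpha> \<le> 1, the derivative is at least \<open>\<alpha> * exp (- L)\<close> on the whole
  interval.\<close>

lemma exp_gap_ge:
  fixes s t L \<alpha> :: real
  assumes "s \<le> t" "-L \<le> s" "0 \<le> \<alpha>" "\<alpha> \<le> 1" "0 \<le> L"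
  shows "\<alpha> * exp (- L) * (t - s) \<le> exp (\<alpha> * t) - exp (\<alpha> * s)"
proof -
  have "- L \<le> \<alpha> * (- L)" using assms mult_right_mono[of \<alpha> 1 L] by simp
  also have "\<dots> \<le> \<alpha> * s" using assms by (intro mult_left_mono) auto
  finally have "exp (- L) \<le> exp (\<alpha> * s)" by simp
  moreover have "\<alpha> * (t - s) \<le> exp (\<alpha> * (t - s)) - 1"
    using exp_ge_add_one_self[of "\<alpha> * (t - s)"] by linarith
  moreover have "0 \<le> \<alpha> * (t - s)" using assms by auto
  ultimately have "exp (- L) * (\<alpha> * (t - s)) \<le> exp (\<alpha> * s) * (exp (\<alpha> * (t - s)) - 1)"
    by (intro mult_mono) auto
  also have "\<dots> = exp (\<alpha> * t) - exp (\<alpha> * s)"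
    by (simp add: right_diff_distrib' exp_add[symmetric])
  finally show ?thesis by (simp add: mult_ac)
qed

abbreviation window_count :: "nat \<Rightarrow> (nat \<Rightarrow> real) \<Rightarrow> (nat \<Rightarrow> real) \<Rightarrow> real \<Rightarrow> real \<Rightarrow> nat" where
  "window_count k \<theta> \<theta>' \<gamma> x \<equiv> card ((\<theta> ` {1..k} \<union> \<theta>' ` {1..k}) \<inter> {x..<x+\<gamma>})"

text \<open>Each of the at most \<open>2 * k - 1\<close> interpolation steps costs a constant times
  sqrt k divided by the length of a block around the jump. A block of at most \<open>q + 1\<close>
  atoms may be as short as the selected gap; a block with more atoms does not fit into a window and
  is longer than \<gamma>.\<close>

lemma affinity_le_W1:
  fixes L \<gamma> :: real
  assumes w: "w \<in> weight_simplex k" "w' \<in> weight_simplex k"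
    and \<theta>: "\<theta> \<in> atom_cube L k" "\<theta>' \<in> atom_cube L k" and "L > 0"
    and \<gamma>: "0 < \<gamma>" "\<gamma> \<le> 2 * L" and q: "1 \<le> q" "q \<le> 2 * k - 1"
    and window: "\<And>x. window_count k \<theta> \<theta>' \<gamma> x \<le> q + 1"
    and pos: "0 < W1 (mixing k w \<theta>) (mixing k w' \<theta>')"
  shows "affinity (gmix k w \<theta>) (gmix k w' \<theta>')
    \<le> 1 - ((W1 (mixing k w \<theta>) (mixing k w' \<theta>') / (2 * real k)) ^ q * \<gamma> ^ (2 * k - 1 - q)
           / (exp (2 * real k) * (4 * exp (2 * L) * sqrt (real k)) ^ (2 * k - 1)))\<^sup>2 / 8"
proof -
  define T where "T = \<theta> ` {1..k} \<union> \<theta>' ` {1..k}"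
  define l where "l = card T"
  define W where "W = W1 (mixing k w \<theta>) (mixing k w' \<theta>')"
  have k: "k \<ge> 1" using weight_simplex_pos[OF w(1)] .
  have "finite T" by (simp add: T_def)
  obtain t where t: "bij_betw t {1..l} T" "strict_mono_on {1..l} t"
    unfolding l_def by (rule finite_set_strict_enumeration[OF \<open>finite T\<close>])
  have tT: "t i \<in> T" if "i \<in> {1..l}" for i using t(1) that by (auto simp: bij_betw_def)
  have tL: "- L \<le> x" "x \<le> L" if "x \<in> T" for x
    using that \<theta> by (auto simp: T_def atom_cube_def PiE_iff)
  have "card T \<le> card (\<theta> ` {1..k}) + card (\<theta>' ` {1..k})" unfolding T_def by (rule card_Un_le)
  also have "\<dots> \<le> k + k" using card_image_le[of "{1..k}" \<theta>] card_image_le[of "{1..k}" \<theta>'] by simp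
  finally have l: "l \<le> 2 * k" by (simp add: l_def)
  obtain u where u: "u \<in> weight_simplex l" "mixing k w \<theta> = mixing l u t"
    "\<And>g :: real \<Rightarrow> real. (\<Sum>i\<in>{1..l}. u i * g (t i)) = (\<Sum>j\<in>{1..k}. w j * g (\<theta> j))"
    by (rule mixing_reindex[OF w(1) t(1), of \<theta>]) (auto simp: T_def)
  obtain v where v: "v \<in> weight_simplex l" "mixing k w' \<theta>' = mixing l v t"
    "\<And>g :: real \<Rightarrow> real. (\<Sum>i\<in>{1..l}. v i * g (t i)) = (\<Sum>j\<in>{1..k}. w' j * g (\<theta>' j))"
    by (rule mixing_reindex[OF w(2) t(1), of \<theta>']) (auto simp: T_def)
  have tmono: "mono_on {1..l} t" using t(2) by (rule strict_mono_on_imp_mono_on)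
  define \<Delta> where "\<Delta> r = (\<Sum>i\<in>{1..r}. u i - v i)" for r
  \<comment> \<open>Pigeonhole: the cost of the monotone coupling is a sum over at most
    \<open>2 * k - 1\<close> gaps.\<close>
  have "\<exists>r\<in>{1..<l}. W / (2 * real k) \<le> \<bar>\<Delta> r\<bar> * (t (Suc r) - t r)"
  proof (rule ccontr)
    assume "\<not> ?thesis"
    then have *: "\<bar>\<Delta> r\<bar> * (t (Suc r) - t r) < W / (2 * real k)" if "r \<in> {1..<l}" for r
      using that by force
    have Wpos: "0 < W" using pos by (simp add: W_def)
    have "W \<le> (\<Sum>r\<in>{1..<l}. \<bar>\<Delta> r\<bar> * (t (Suc r) - t r))"
      unfolding W_def u(2) v(2) \<Delta>_def by (rule W1_le_cdf_distance[OF u(1) v(1) tmono])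
    also have "\<dots> \<le> (\<Sum>r\<in>{1..<l}. W / (2 * real k))"
      using * by (intro sum_mono less_imp_le) auto
    also have "\<dots> = real (l - 1) * (W / (2 * real k))" by simp
    also have "\<dots> < real (2 * k) * (W / (2 * real k))"
      using l k Wpos by (intro mult_strict_right_mono) auto
    finally show False using k by simp
  qed
  then obtain r where r: "r \<in> {1..<l}" "W / (2 * real k) \<le> \<bar>\<Delta> r\<bar> * (t (Suc r) - t r)" by blast
  define g where "g = t (Suc r) - t r"
  have g0: "g > 0" using t(2) r(1) by (auto simp: g_def strict_mono_on_def)
  have g2L: "g \<le> 2 * L" using tL[OF tT[of "Suc r"]] tL[OF tT[of r]] r(1) by (auto simp: g_def)
  define \<alpha> where "\<alpha> = 1 / sqrt (real k)"
  have \<alpha>: "0 < \<alpha>" "\<alpha> \<le> 1" using k by (auto simp: \<alpha>_def)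
  \<comment> \<open>Multiplied by the contraction \<open>\<alpha> * exp (- L)\<close> of the gaps
    this is \<open>4 * exp L\<close>, as \<open>step_interpolation\<close> with radius
    \<open>exp L\<close> demands. It also exceeds the diameter, so that every \<kappa> is at least
    1.\<close>
  define D where "D = 4 * exp (2 * L) * sqrt (real k)"
  have D: "2 * L \<le> D"
  proof -
    have "2 * L \<le> exp (2 * L) * 1" using exp_ge_add_one_self[of "2 * L"] by linarith
    also have "exp (2 * L) * 1 \<le> exp (2 * L) * (4 * sqrt (real k))"
    proof (rule mult_left_mono)
      have "1 \<le> sqrt (real k)" using k by simp
      then show "1 \<le> 4 * sqrt (real k)" by linarith
    qed simp
    finally show ?thesis by (simp add: D_def mult_ac)
  qed
  then have D0: "D > 0" using \<open>L > 0\<close> by linarith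
  \<comment> \<open>A lower bound for the length of every block of \<open>i + 1\<close> consecutive
    atoms around the jump.\<close>
  define e where "e i = (if i \<le> q then g else \<gamma>)" for i
  have e: "0 < e i" "e i \<le> D" for i using g0 g2L \<gamma> D by (auto simp: e_def)
  define \<kappa> where "\<kappa> i = D / e i" for i
  have \<kappa>1: "\<kappa> i \<ge> 1" for i using e[of i] by (simp add: \<kappa>_def)
  define y where "y i = exp (\<alpha> * t i)" for i
  have expL: "exp (\<alpha> * x) \<le> exp L" if "x \<in> T" for x
  proof -
    have "\<alpha> * x \<le> \<alpha> * L" using tL[OF that] \<alpha> by simp
    also have "\<dots> \<le> L" using \<alpha> \<open>L > 0\<close> by (simp add: mult_le_cancel_right1)
    finally show ?thesis by simp
  qed
  have e_gap: "e i \<le> t (a + i) - t a" if "1 \<le> a" "a + i \<le> l" "a \<le> r" "r < a + i" for a i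
  proof (cases "i \<le> q")
    case True
    have "t a \<le> t r" "t (Suc r) \<le> t (a + i)" using tmono that r(1) by (auto simp: mono_on_def)
    then show ?thesis using True by (simp add: e_def g_def)
  next
    case False
    have "\<gamma> \<le> t (a + i) - t a"
    proof (rule ccontr)
      \<comment> \<open>Since \<open>i > q\<close>, the block has at least \<open>q + 2\<close>
        atoms, one more than a window can hold.\<close>
      assume less: "\<not> \<gamma> \<le> t (a + i) - t a"
      have "t ` {a..a+i} \<subseteq> T \<inter> {t a..<t a+\<gamma>}"
      proof
        fix x assume "x \<in> t ` {a..a+i}"
        then obtain s where s: "s \<in> {a..a+i}" "x = t s" by blast
        then have "t a \<le> t s" "t s \<le> t (a + i)" using tmono that by (auto simp: mono_on_def)
        then show "x \<in> T \<inter> {t a..<t a+\<gamma>}" using less s tT[of s] that by auto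
      qed
      then have "card (t ` {a..a+i}) \<le> card (T \<inter> {t a..<t a+\<gamma>})"
        using \<open>finite T\<close> by (intro card_mono) auto
      also have "\<dots> \<le> q + 1" unfolding T_def by (rule window)
      also have "card (t ` {a..a+i}) = card {a..a+i}"
        using strict_mono_on_imp_inj_on[OF t(2)] that by (intro card_image) (auto intro: inj_on_subset)
      finally show False using False by simp
    qed
    then show ?thesis using False by (simp add: e_def)
  qed
  have y_gap: "4 * exp L \<le> \<kappa> i * (y (a + i) - y a)" if "1 \<le> a" "a + i \<le> l" "a \<le> r" "r < a + i" for a i
  proof -
    have "4 * exp L * 1 \<le> 4 * exp L * ((t (a + i) - t a) / e i)"
      using e_gap[OF that] e(1)[of i] by (intro mult_left_mono) auto
    also have "\<dots> = \<kappa> i * (\<alpha> * exp (- L) * (t (a + i) - t a))"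
    proof -
      have "exp (2 * L) * exp (- L) = exp L" by (simp add: exp_add[symmetric])
      moreover have "sqrt (real k) * \<alpha> = 1" using k by (simp add: \<alpha>_def)
      moreover have "\<kappa> i * (\<alpha> * exp (- L) * (t (a + i) - t a))
          = 4 * (exp (2 * L) * exp (- L)) * ((sqrt (real k) * \<alpha>) * ((t (a + i) - t a) / e i))"
        by (simp add: \<kappa>_def D_def)
      ultimately show ?thesis by simp
    qed
    also have "\<dots> \<le> \<kappa> i * (y (a + i) - y a)"
    proof (rule mult_left_mono)
      have "t a \<le> t (a + i)" "- L \<le> t a" using e_gap[OF that] e(1)[of i] tL[OF tT[of a]] that by auto
      then show "\<alpha> * exp (- L) * (t (a + i) - t a) \<le> y (a + i) - y a"
        unfolding y_def using \<alpha> \<open>L > 0\<close> by (intro exp_gap_ge) auto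
      show "0 \<le> \<kappa> i" using \<kappa>1[of i] by simp
    qed
    finally show ?thesis by simp
  qed
  have l1: "1 + (l - 1) \<le> l" "1 \<le> l" using r(1) by auto
  have "\<exists>p \<in> poly_funs (l - 1) (exp L) (\<Prod>s\<in>{1..l-1}. \<kappa> s). \<forall>j\<in>{1..1+(l-1)}. p (y j) = of_bool (j \<le> r)"
  proof (rule step_interpolation[OF _ _ \<kappa>1 y_gap])
    show "\<bar>y j\<bar> \<le> exp L" if "j \<in> {1..l}" for j using expL[OF tT[OF that]] by (simp add: y_def)
    show "strict_mono_on {1..l} y" using t(2) \<alpha> by (auto simp: strict_mono_on_def y_def)
  qed (use l1 in auto)
  then obtain p where p: "p \<in> poly_funs (l - 1) (exp L) (\<Prod>s\<in>{1..l-1}. \<kappa> s)"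
    "\<And>j. j \<in> {1..l} \<Longrightarrow> p (y j) = of_bool (j \<le> r)" using l1 by auto
  define c where "c = D ^ (2 * k - 1) / (g ^ q * \<gamma> ^ (2 * k - 1 - q))"
  \<comment> \<open>The factors are at least 1, so the product may be extended to
    \<open>2 * k - 1\<close> of them; the bound then no longer depends on the number
    \<open>l\<close> of distinct atoms.\<close>
  have "(\<Prod>s\<in>{1..l-1}. \<kappa> s) \<le> (\<Prod>s\<in>{1..2*k-1}. \<kappa> s)"
    using l \<kappa>1 by (intro prod_mono2) (auto intro: order_trans[of 0 1])
  also have "\<dots> = D ^ (2 * k - 1) / (\<Prod>s\<in>{1..2*k-1}. e s)"
    by (simp add: \<kappa>_def prod_dividef)
  also have "(\<Prod>s\<in>{1..2*k-1}. e s) = (\<Prod>s\<in>{1..q}. e s) * (\<Prod>s\<in>{q+1..2*k-1}. e s)"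
    using q prod.ub_add_nat[of 1 q e "2 * k - 1 - q"] by simp
  also have "(\<Prod>s\<in>{1..q}. e s) = g ^ q" by (simp add: e_def)
  also have "(\<Prod>s\<in>{q+1..2*k-1}. e s) = \<gamma> ^ (2 * k - 1 - q)" by (simp add: e_def)
  finally have "p \<in> poly_funs (l - 1) (exp L) c" using p(1) by (auto simp: c_def intro: poly_funs_mono)
  then obtain h where h: "h \<in> borel_measurable borel"
    "\<And>\<theta>. gauss_mean \<theta> h (p (exp (\<alpha> * \<theta>)))"
    "\<And>\<theta>. exp (\<alpha> * \<theta>) \<le> exp L \<Longrightarrow> \<exists>I\<le>exp ((real (l - 1) * \<alpha>)\<^sup>2) * c\<^sup>2.
       gauss_mean \<theta> (\<lambda>x. (h x)\<^sup>2) I"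
    using \<alpha> by (elim unbiased_exponential[where \<alpha> = \<alpha>]) auto
  have c0: "c > 0" using D0 g0 \<gamma> by (simp add: c_def)
  define B where "B = exp (4 * real k) * c\<^sup>2"
  \<comment> \<open>The degree is below \<open>2 * k\<close> and \<alpha>^2 = 1/k. The square root
    of the resulting \<open>exp (4 * real k)\<close> is the \<open>exp (2 * real k)\<close> of the
    statement.\<close>
  have "(real (l - 1) * \<alpha>)\<^sup>2 \<le> (2 * real k * \<alpha>)\<^sup>2" using l \<alpha> by (intro power_mono mult_right_mono) auto
  also have "\<dots> = 4 * real k" using k by (simp add: \<alpha>_def power_mult_distrib power_divide power2_eq_square)
  finally have expB: "exp ((real (l - 1) * \<alpha>)\<^sup>2) * c\<^sup>2 \<le> B" by (simp add: B_def mult_right_mono)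
  have B0: "B > 0" using c0 by (simp add: B_def)
  have mem: "\<theta> j \<in> T" "\<theta>' j \<in> T" if "j \<in> {1..k}" for j using that by (auto simp: T_def)
  \<comment> \<open>The interpolant is 1 at the first \<open>r\<close> atoms and 0 at the others, so
    the two means of \<open>h\<close> differ by exactly \<open>\<Delta> r\<close>.\<close>
  have cut: "(\<Sum>i\<in>{1..l}. f i * p (exp (\<alpha> * t i))) = (\<Sum>i\<in>{1..r}. f i)" for f :: "nat \<Rightarrow> real"
    using r(1) p(2) unfolding y_def by (intro sum.mono_neutral_cong_right) auto
  have "affinity (gmix k w \<theta>) (gmix k w' \<theta>') \<le> 1 - (\<Delta> r)\<^sup>2 / (8 * B)"
  proof (rule affinity_le_mean_difference[OF w h(1) B0 h(2) h(2)])
    show "\<exists>J\<le>B. gauss_mean (\<theta> j) (\<lambda>x. (h x)\<^sup>2) J" if "j \<in> {1..k}" for j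
      using h(3)[OF expL[OF mem(1)[OF that]]] expB order.trans by blast
    show "\<exists>J\<le>B. gauss_mean (\<theta>' j) (\<lambda>x. (h x)\<^sup>2) J" if "j \<in> {1..k}" for j
      using h(3)[OF expL[OF mem(2)[OF that]]] expB order.trans by blast
    show "\<Delta> r = (\<Sum>j\<in>{1..k}. w j * p (exp (\<alpha> * \<theta> j))) - (\<Sum>j\<in>{1..k}. w' j * p (exp (\<alpha> * \<theta>' j)))"
      using cut[of u] cut[of v] u(3)[of "\<lambda>x. p (exp (\<alpha> * x))"] v(3)[of "\<lambda>x. p (exp (\<alpha> * x))"]
      by (simp add: \<Delta>_def sum_subtractf)
  qed
  also have "\<dots> \<le> 1 - ((W / (2 * real k)) ^ q * \<gamma> ^ (2 * k - 1 - q) / (exp (2 * real k) * D ^ (2 * k - 1)))\<^sup>2 / 8"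
  proof -
    \<comment> \<open>Only the product of \<Delta> and the gap \<open>g\<close> is bounded below,
      while the affinity involves \<Delta> and \<open>g ^ q\<close>. Since \<Delta> has modulus at
      most 1, its \<open>q\<close>-th power may be replaced by the modulus itself, and the q-th
      power of the product bounds exactly the needed combination.\<close>
    have "(W / (2 * real k)) ^ q \<le> (\<bar>\<Delta> r\<bar> * g) ^ q"
      using r(2) pos by (intro power_mono) (auto simp: g_def W_def)
    also have "\<dots> = \<bar>\<Delta> r\<bar> ^ q * g ^ q" by (simp add: power_mult_distrib)
    also have "\<dots> \<le> \<bar>\<Delta> r\<bar> * g ^ q"
    proof -
      have "\<bar>\<Delta> r\<bar> \<le> 1"
        unfolding \<Delta>_def using r(1) by (intro abs_sum_weight_difference_le_1[OF u(1) v(1)]) auto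
      then have "\<bar>\<Delta> r\<bar> ^ q \<le> \<bar>\<Delta> r\<bar> ^ 1" using q by (intro power_decreasing) auto
      then show ?thesis using g0 by simp
    qed
    finally have "(W / (2 * real k)) ^ q * \<gamma> ^ (2 * k - 1 - q) / (exp (2 * real k) * D ^ (2 * k - 1))
        \<le> \<bar>\<Delta> r\<bar> * g ^ q * \<gamma> ^ (2 * k - 1 - q) / (exp (2 * real k) * D ^ (2 * k - 1))"
      using \<gamma> D0 by (intro divide_right_mono mult_right_mono) auto
    also have "\<dots> = \<bar>\<Delta> r\<bar> / (exp (2 * real k) * c)" using D0 by (simp add: c_def)
    finally have "((W / (2 * real k)) ^ q * \<gamma> ^ (2 * k - 1 - q) / (exp (2 * real k) * D ^ (2 * k - 1)))\<^sup>2
        \<le> (\<bar>\<Delta> r\<bar> / (exp (2 * real k) * c))\<^sup>2"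
      using pos \<gamma> D0 k by (intro power_mono) (auto simp: W_def)
    also have "\<dots> = (\<Delta> r)\<^sup>2 / B"
      by (simp add: B_def power_divide power_mult_distrib exp_double[symmetric])
    finally show ?thesis by (simp add: field_simps)
  qed
  finally show ?thesis unfolding W_def D_def .
qed

section \<open>Atoms in short windows near \<nu>0\<close>

text \<open>The points of \<open>S\<close> chosen near the different \<open>u i\<close> are more
  than 3\<gamma> - 2\<gamma> = \<gamma> apart, so a window holds at most one of these
  \<open>k0\<close> points, besides at most \<open>k - k0\<close> others.\<close>

lemma card_window_le:
  fixes S :: "real set"
  assumes "finite S" "card S \<le> k" "1 \<le> k0" and "\<gamma> > 0"
    and sep: "\<And>i j. i \<in> {1..k0} \<Longrightarrow> j \<in> {1..k0} \<Longrightarrow> i \<noteq> j \<Longrightarrow> 3 * \<gamma> \<le> \<bar>u i - u j\<bar>"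
    and hit: "\<And>i. i \<in> {1..k0} \<Longrightarrow> \<exists>s\<in>S. \<bar>s - u i\<bar> < \<gamma>"
  shows "card (S \<inter> {x..<x+\<gamma>}) \<le> k - k0 + 1"
proof -
  have "\<exists>s. \<forall>i\<in>{1..k0}. s i \<in> S \<and> \<bar>s i - u i\<bar> < \<gamma>"
    by (rule bchoice) (use hit in blast)
  then obtain s where s: "\<And>i. i \<in> {1..k0} \<Longrightarrow> s i \<in> S \<and> \<bar>s i - u i\<bar> < \<gamma>" by blast
  have far: "\<gamma> < \<bar>s i - s j\<bar>" if "i \<in> {1..k0}" "j \<in> {1..k0}" "i \<noteq> j" for i j
    using sep[OF that] s[OF that(1)] s[OF that(2)] by linarith
  have inj: "inj_on s {1..k0}"
    by (rule inj_onI) (use far \<open>\<gamma> > 0\<close> in fastforce)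
  let ?I = "s ` {1..k0}"
  have "card (?I \<inter> {x..<x+\<gamma>}) \<le> 1"
  proof (rule ccontr)
    assume "\<not> ?thesis"
    moreover have "finite (?I \<inter> {x..<x+\<gamma>})" by simp
    ultimately have "\<not> (\<forall>a\<in>?I \<inter> {x..<x+\<gamma>}. \<forall>b\<in>?I \<inter> {x..<x+\<gamma>}. a = b)"
      unfolding One_nat_def by (subst card_le_Suc0_iff_eq[symmetric])
    then obtain a b where "a \<in> ?I \<inter> {x..<x+\<gamma>}" "b \<in> ?I \<inter> {x..<x+\<gamma>}" "a \<noteq> b" by blast
    then obtain i j where "i \<in> {1..k0}" "j \<in> {1..k0}" "i \<noteq> j" "\<bar>s i - s j\<bar> < \<gamma>" by (fastforce simp: abs_less_iff)
    then show False using far by fastforce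
  qed
  moreover have "card (S - ?I) = card S - k0"
    using s inj \<open>finite S\<close> by (subst card_Diff_subset) (auto simp: card_image)
  moreover have "card (S \<inter> {x..<x+\<gamma>}) \<le> card ((S - ?I) \<union> (?I \<inter> {x..<x+\<gamma>}))"
    using \<open>finite S\<close> by (intro card_mono) auto
  moreover have "card ((S - ?I) \<union> (?I \<inter> {x..<x+\<gamma>})) \<le> card (S - ?I) + card (?I \<inter> {x..<x+\<gamma>})"
    by (rule card_Un_le)
  ultimately show ?thesis using assms(2) by linarith
qed

text \<open>The test function is a tent of height and radius \<gamma> around the atom: its integral
  is zero if no atom is closer than \<gamma>, but at least \<open>w0 i * \<gamma>\<close> under the
  second distribution.\<close>

lemma atom_near:
  assumes "w \<in> weight_simplex k" "w0 \<in> weight_simplex k0" "i \<in> {1..k0}"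
    and close: "\<bar>(\<integral>x. max 0 (\<gamma> - \<bar>x - \<theta>0 i\<bar>) \<partial>mixing k w \<theta>) -
        (\<integral>x. max 0 (\<gamma> - \<bar>x - \<theta>0 i\<bar>) \<partial>mixing k0 w0 \<theta>0)\<bar> < w0 i * \<gamma>"
  shows "\<exists>s\<in>\<theta> ` {1..k}. \<bar>s - \<theta>0 i\<bar> < \<gamma>"
proof (rule ccontr)
  let ?f = "\<lambda>x. max 0 (\<gamma> - \<bar>x - \<theta>0 i\<bar>)"
  assume "\<not> ?thesis"
  then have "(\<integral>x. ?f x \<partial>mixing k w \<theta>) = 0"
    by (subst integral_mixing[OF assms(1)]) (auto intro!: sum.neutral simp: not_less max_def)
  moreover have "w0 i * \<gamma> \<le> (\<Sum>j\<in>{1..k0}. w0 j * ?f (\<theta>0 j))"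
  proof -
    have "w0 i * \<gamma> \<le> w0 i * ?f (\<theta>0 i)"
      using weight_simplex_nonneg[OF assms(2,3)] by (intro mult_left_mono) auto
    also have "\<dots> \<le> (\<Sum>j\<in>{1..k0}. w0 j * ?f (\<theta>0 j))"
      using assms(3) weight_simplex_nonneg[OF assms(2)] by (intro member_le_sum) auto
    finally show ?thesis .
  qed
  then have "w0 i * \<gamma> \<le> (\<integral>x. ?f x \<partial>mixing k0 w0 \<theta>0)"
    by (subst integral_mixing[OF assms(2)]) auto
  ultimately show False using close by linarith
qed

text \<open>Both distributions are close to \<nu>0, so each has at most \<open>k - k0 + 1\<close>
  atoms in a window. The sum of these two counts is \<open>q + 1\<close> for the q = 2(k - k0) + 1
  of the rate.\<close>

lemma local_window:
  assumes \<nu>0: "\<nu>0 \<in> mixing_dists L k0 - mixing_dists L (k0 - 1)" and "L > 0" "k0 \<ge> 1"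
  obtains \<gamma> \<delta> :: real where "0 < \<gamma>" "\<gamma> \<le> 2 * L" "0 < \<delta>"
    "\<And>k w \<theta> w' \<theta>' x. w \<in> weight_simplex k \<Longrightarrow> w' \<in> weight_simplex k \<Longrightarrow>
      \<theta> \<in> atom_cube L k \<Longrightarrow> \<theta>' \<in> atom_cube L k \<Longrightarrow>
      W1 (mixing k w \<theta>) (mixing k w' \<theta>') < \<delta> \<Longrightarrow> W1 (mixing k w' \<theta>') \<nu>0 < \<delta> \<Longrightarrow>
      window_count k \<theta> \<theta>' \<gamma> x \<le> 2 * (k - k0) + 2"
proof -
  obtain w0 \<theta>0 where w0: "w0 \<in> weight_simplex k0" and \<theta>0: "\<theta>0 \<in> atom_cube L k0"
    and \<nu>0_eq: "\<nu>0 = mixing k0 w0 \<theta>0"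
    using \<nu>0 by (auto simp: mixing_dists_def)
  have inj: "inj_on \<theta>0 {1..k0}" and w0pos: "\<And>j. j \<in> {1..k0} \<Longrightarrow> 0 < w0 j"
    using exact_mixing_dists[OF w0 \<theta>0] \<nu>0 \<open>L > 0\<close> by (auto simp: \<nu>0_eq)
  \<comment> \<open>The element \<open>2 * L\<close> keeps the set nonempty when
    \<open>k0 = 1\<close> and bounds \<gamma> by the diameter.\<close>
  define G where "G = insert (2 * L) ((\<lambda>(i, j). \<bar>\<theta>0 i - \<theta>0 j\<bar> / 3) ` {(i, j) \<in> {1..k0} \<times> {1..k0}. i \<noteq> j})"
  define \<gamma> where "\<gamma> = Min G"
  have G: "finite G" "G \<noteq> {}"
  proof -
    have "finite {(i, j) \<in> {1..k0} \<times> {1..k0}. i \<noteq> j}"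
      by (rule finite_subset[of _ "{1..k0} \<times> {1..k0}"]) auto
    then show "finite G" by (simp add: G_def)
  qed (simp add: G_def)
  have \<gamma>0: "\<gamma> > 0"
  proof -
    have "0 < x" if "x \<in> G" for x
      using that \<open>L > 0\<close> by (auto simp: G_def inj_on_eq_iff[OF inj])
    then show ?thesis unfolding \<gamma>_def by (subst Min_gr_iff[OF G]) blast
  qed
  have \<gamma>2L: "\<gamma> \<le> 2 * L" unfolding \<gamma>_def using G by (intro Min_le) (auto simp: G_def)
  have sep: "3 * \<gamma> \<le> \<bar>\<theta>0 i - \<theta>0 j\<bar>" if "i \<in> {1..k0}" "j \<in> {1..k0}" "i \<noteq> j" for i j
  proof -
    have "\<gamma> \<le> \<bar>\<theta>0 i - \<theta>0 j\<bar> / 3"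
      unfolding \<gamma>_def using G that by (intro Min_le) (auto simp: G_def)
    then show ?thesis by simp
  qed
  define m where "m = Min (w0 ` {1..k0})"
  have fin: "finite (w0 ` {1..k0})" "w0 ` {1..k0} \<noteq> {}" using \<open>k0 \<ge> 1\<close> by auto
  have m0: "m > 0" unfolding m_def using w0pos by (subst Min_gr_iff[OF fin]) auto
  have m_le: "m \<le> w0 i" if "i \<in> {1..k0}" for i
    unfolding m_def using fin that by (intro Min_le) auto
  show ?thesis
  proof (rule that[OF \<gamma>0 \<gamma>2L])
    \<comment> \<open>Half of the threshold in \<open>atom_near\<close>: the first distribution is
      compared with \<nu>0 through the second one, by adding the two differences of tent
      integrals.\<close>
    show "0 < m * \<gamma> / 2" using m0 \<gamma>0 by simp
    fix k w \<theta> w' \<theta>' x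
    assume w: "w \<in> weight_simplex k" "w' \<in> weight_simplex k"
      and \<theta>: "\<theta> \<in> atom_cube L k" "\<theta>' \<in> atom_cube L k"
      and near: "W1 (mixing k w \<theta>) (mixing k w' \<theta>') < m * \<gamma> / 2" "W1 (mixing k w' \<theta>') \<nu>0 < m * \<gamma> / 2"
    have mem: "mixing k w \<theta> \<in> mixing_dists L k" "mixing k w' \<theta>' \<in> mixing_dists L k"
      using w \<theta> by (auto simp: mixing_dists_def)
    have lip: "\<bar>max 0 (\<gamma> - \<bar>x - z\<bar>) - max 0 (\<gamma> - \<bar>y - z\<bar>)\<bar> \<le> \<bar>x - y\<bar>" for x y z :: real
      by (auto simp: max_def abs_if)
    let ?J = "\<lambda>i \<nu>. \<integral>x. max 0 (\<gamma> - \<bar>x - \<theta>0 i\<bar>) \<partial>\<nu>"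
    have d: "\<bar>?J i (mixing k w \<theta>) - ?J i (mixing k w' \<theta>')\<bar> < m * \<gamma> / 2"
      "\<bar>?J i (mixing k w' \<theta>') - ?J i \<nu>0\<bar> < m * \<gamma> / 2" for i
    proof -
      have "\<bar>?J i (mixing k w \<theta>) - ?J i (mixing k w' \<theta>')\<bar> \<le> W1 (mixing k w \<theta>) (mixing k w' \<theta>')"
        by (rule W1_Lipschitz[OF mem _ lip]) simp
      then show "\<bar>?J i (mixing k w \<theta>) - ?J i (mixing k w' \<theta>')\<bar> < m * \<gamma> / 2" using near by linarith
      have "\<bar>?J i (mixing k w' \<theta>') - ?J i \<nu>0\<bar> \<le> W1 (mixing k w' \<theta>') \<nu>0"
        by (rule W1_Lipschitz[OF mem(2) _ _ lip]) (use \<nu>0 in auto)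
      then show "\<bar>?J i (mixing k w' \<theta>') - ?J i \<nu>0\<bar> < m * \<gamma> / 2" using near by linarith
    qed
    have m\<gamma>: "m * \<gamma> \<le> w0 i * \<gamma>" if "i \<in> {1..k0}" for i
      using m_le[OF that] \<gamma>0 by (intro mult_right_mono) auto
    have "card (\<theta> ` {1..k} \<inter> {x..<x+\<gamma>}) \<le> k - k0 + 1"
    proof (rule card_window_le[OF _ _ \<open>k0 \<ge> 1\<close> \<gamma>0 sep])
      show "\<exists>s\<in>\<theta> ` {1..k}. \<bar>s - \<theta>0 i\<bar> < \<gamma>" if "i \<in> {1..k0}" for i
        using d[of i] m\<gamma>[OF that] by (intro atom_near[OF w(1) w0 that]) (unfold \<nu>0_eq, linarith)
    qed (auto intro: order.trans[OF card_image_le])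
    moreover have "card (\<theta>' ` {1..k} \<inter> {x..<x+\<gamma>}) \<le> k - k0 + 1"
    proof (rule card_window_le[OF _ _ \<open>k0 \<ge> 1\<close> \<gamma>0 sep])
      show "\<exists>s\<in>\<theta>' ` {1..k}. \<bar>s - \<theta>0 i\<bar> < \<gamma>" if "i \<in> {1..k0}" for i
        using d[of i] m\<gamma>[OF that] by (intro atom_near[OF w(2) w0 that]) (unfold \<nu>0_eq, linarith)
    qed (auto intro: order.trans[OF card_image_le])
    moreover have "window_count k \<theta> \<theta>' \<gamma> x
        \<le> card (\<theta> ` {1..k} \<inter> {x..<x+\<gamma>}) + card (\<theta>' ` {1..k} \<inter> {x..<x+\<gamma>})"
      by (simp only: Int_Un_distrib2 card_Un_le)
    ultimately show "window_count k \<theta> \<theta>' \<gamma> x \<le> 2 * (k - k0) + 2" by linarith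
  qed
qed

section \<open>Calibration of the rate\<close>

text \<open>Accounts for the exponents of the rate. The power \<open>q\<close> of k cancels the
  division of \<open>W1\<close> by \<open>2 * real k\<close> in \<open>affinity_le_W1\<close>, the
  power of sqrt k cancels the contraction of the gaps, and
  \<open>real k * (ln (real n) / sqrt (real n))\<close> is the size of the mean difference that
  remains to be detected.\<close>

lemma rate_power:
  assumes "1 \<le> k0" "k0 \<le> k" "3 \<le> n"
  shows "rate n k k0 ^ (2 * (k - k0) + 1)
    = real k ^ (2 * (k - k0) + 1) * sqrt (real k) ^ (2 * k - 1) * real k * (ln (real n) / sqrt (real n))"
proof -
  define q where "q = 2 * (k - k0) + 1"
  have q: "real q = 2 * (real k - real k0) + 1" "q \<noteq> 0" using assms by (auto simp: q_def)
  have q2: "4 * (real k - real k0) + 2 = 2 * real q" using q by simp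
  have k: "0 < real k" and n: "0 < real n" "0 < ln (real n)" using assms by auto
  have p1: "(real k powr ((6 * real k - 4 * real k0 + 3) / (2 * real q))) ^ q
      = real k powr ((6 * real k - 4 * real k0 + 3) / 2)"
    using q(2) k n by (subst powr_power) auto
  have p2: "(((ln (real n))\<^sup>2 / real n) powr (1 / (2 * real q))) ^ q = ((ln (real n))\<^sup>2 / real n) powr (1 / 2)"
    using q(2) k n by (subst powr_power) auto
  have s1: "((ln (real n))\<^sup>2 / real n) powr (1 / 2) = ln (real n) / sqrt (real n)"
    using n by (simp add: powr_half_sqrt real_sqrt_divide)
  have e: "(6 * real k - 4 * real k0 + 3) / 2 = real q + real (2 * k - 1) / 2 + 1"
    using assms q(1) by (simp add: of_nat_diff field_simps)
  have "real k powr ((6 * real k - 4 * real k0 + 3) / 2)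
      = real k powr real q * real k powr (real (2 * k - 1) / 2) * real k powr 1"
    unfolding e by (simp only: powr_add)
  also have "real k powr (real (2 * k - 1) / 2) = sqrt (real k) powr real (2 * k - 1)"
    using k by (simp add: powr_half_sqrt[symmetric] powr_powr)
  finally have "real k powr ((6 * real k - 4 * real k0 + 3) / 2) = real k ^ q * sqrt (real k) ^ (2 * k - 1) * real k"
    using k by (simp add: powr_realpow del: of_nat_diff)
  then show ?thesis
    unfolding rate_def q2 power_mult_distrib q_def[symmetric] p1 p2 s1 by simp
qed

lemma rate_pos:
  assumes "1 \<le> k" "3 \<le> n"
  shows "0 < rate n k k0"
  using assms by (simp add: rate_def)

lemma power_base_le:
  fixes x :: real
  assumes "0 < x" "x \<le> 1" "m \<le> n"
  shows "x ^ n \<le> x ^ m"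
  using assms by (intro power_decreasing) auto

text \<open>Substituting the rate into \<open>affinity_le_W1\<close> leaves constants to the power
  \<open>k\<close>. They are compensated by a constant to the power \<open>q\<close> because
  \<open>k \<le> k0 * q\<close>; this is the reason for \<open>R ^ k0\<close> in
  \<open>M\<close>.\<close>

lemma affinity_separation:
  fixes L \<Lambda> :: real
  assumes \<nu>0: "\<nu>0 \<in> mixing_dists L k0 - mixing_dists L (k0 - 1)" and "L > 0" "k0 \<ge> 1" "\<Lambda> \<ge> 0"
  obtains \<tau> M :: real where "0 < \<tau>" "0 < M"
    "\<And>n k w \<theta> w' \<theta>'. 3 \<le> n \<Longrightarrow> k0 \<le> k \<Longrightarrow> w \<in> weight_simplex k \<Longrightarrow> w' \<in> weight_simplex k \<Longrightarrow>
      \<theta> \<in> atom_cube L k \<Longrightarrow> \<theta>' \<in> atom_cube L k \<Longrightarrow> W1 (mixing k w' \<theta>') \<nu>0 < \<tau> \<Longrightarrow>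
      M * rate n k k0 \<le> W1 (mixing k w \<theta>) (mixing k w' \<theta>') \<Longrightarrow>
      \<Lambda> * real k * (ln (real n))\<^sup>2 \<le> real n * (1 - affinity (gmix k w \<theta>) (gmix k w' \<theta>'))"
proof -
  obtain \<gamma> \<delta> where \<gamma>: "0 < \<gamma>" "\<gamma> \<le> 2 * L" and \<delta>: "0 < \<delta>" and window:
    "\<And>k w \<theta> w' \<theta>' x. w \<in> weight_simplex k \<Longrightarrow> w' \<in> weight_simplex k \<Longrightarrow>
      \<theta> \<in> atom_cube L k \<Longrightarrow> \<theta>' \<in> atom_cube L k \<Longrightarrow>
      W1 (mixing k w \<theta>) (mixing k w' \<theta>') < \<delta> \<Longrightarrow> W1 (mixing k w' \<theta>') \<nu>0 < \<delta> \<Longrightarrow>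
      window_count k \<theta> \<theta>' \<gamma> x \<le> 2 * (k - k0) + 2"
    using local_window[OF \<nu>0 \<open>L > 0\<close> \<open>k0 \<ge> 1\<close>] by blast
  \<comment> \<open>\<open>Y\<close> provides \<Lambda>, \<open>g\<close> bounds the powers of
    \<gamma> below, \<open>d\<close> serves the case where \<open>W1\<close> is at least \<delta>,
    and \<open>Q ^ k\<close> dominates the exponential factors. \<open>R\<close> collects them, and
    the factor \<open>2 * (1 + L)\<close> makes both \<open>M / 2\<close> and
    \<open>M / (2 * L)\<close> at least \<open>R ^ k0\<close>.\<close>
  define Y where "Y = max 1 (8 * \<Lambda>)"
  define g where "g = min 1 \<gamma> ^ (2 * k0)"
  define d where "d = min 1 (\<delta> / 2)"
  define Q where "Q = (4 * exp (2 * L + 1))\<^sup>2"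
  define R where "R = Y / g * Q * exp (2 * real k0) / d\<^sup>2"
  define M where "M = 2 * (1 + L) * R ^ k0"
  have Y: "1 \<le> Y" "8 * \<Lambda> \<le> Y" by (auto simp: Y_def)
  have g: "0 < g" "g \<le> 1" using \<gamma> by (auto simp: g_def intro!: power_le_one)
  have d: "0 < d" "d \<le> 1" "d \<le> \<delta> / 2" using \<delta> by (auto simp: d_def)
  have Q: "1 \<le> Q"
  proof -
    have "1 \<le> exp (2 * L + 1)" using \<open>L > 0\<close> by simp
    then have "1 \<le> 4 * exp (2 * L + 1)" by linarith
    then show ?thesis unfolding Q_def by (rule one_le_power)
  qed
  have Yg: "1 \<le> Y / g" using Y g by simp
  have d2: "0 < d\<^sup>2" "d\<^sup>2 \<le> 1" using d by (auto intro: power_le_one)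
  have pos: "0 < Y" "0 < Q" using Y Q by auto
  have R1: "1 \<le> R"
  proof -
    have "1 * 1 \<le> Y / g * Q" using Yg Q by (intro mult_mono) auto
    then have "1 * 1 \<le> Y / g * Q * exp (2 * real k0)" by (intro mult_mono) auto
    then show ?thesis unfolding R_def using d2 by (simp only: pos_le_divide_eq)
  qed
  have M0: "0 < M" using \<open>L > 0\<close> R1 by (simp add: M_def)
  show ?thesis
  proof (rule that[OF \<delta> M0])
    fix n k :: nat and w \<theta> w' \<theta>'
    assume n: "3 \<le> n" and kk: "k0 \<le> k" and w: "w \<in> weight_simplex k" "w' \<in> weight_simplex k"
      and \<theta>: "\<theta> \<in> atom_cube L k" "\<theta>' \<in> atom_cube L k" and near: "W1 (mixing k w' \<theta>') \<nu>0 < \<delta>"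
      and big: "M * rate n k k0 \<le> W1 (mixing k w \<theta>) (mixing k w' \<theta>')"
    define W where "W = W1 (mixing k w \<theta>) (mixing k w' \<theta>')"
    define q where "q = 2 * (k - k0) + 1"
    define A where "A = affinity (gmix k w \<theta>) (gmix k w' \<theta>')"
    define s where "s = sqrt (real k) ^ (2 * k - 1)"
    define N where "N = ln (real n) / sqrt (real n)"
    have k: "1 \<le> k" using kk \<open>k0 \<ge> 1\<close> by simp
    let ?R = "real k ^ q * s * real k * N"
    let ?G = "Y * Q ^ k * exp (2 * real k0) ^ k / d ^ (2 * k)"
    let ?F = "exp (2 * real k) * (4 * exp (2 * L) * sqrt (real k)) ^ (2 * k - 1)"
    let ?E = "exp (2 * real k) * (4 * exp (2 * L)) ^ (2 * k - 1)"
    have s0: "s > 0" using k by (simp add: s_def)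
    have N0: "N > 0" using n by (simp add: N_def)
    have mem: "mixing k w \<theta> \<in> mixing_dists L k" "mixing k w' \<theta>' \<in> mixing_dists L k"
      using w \<theta> by (auto simp: mixing_dists_def)
    have W2L: "W \<le> 2 * L" unfolding W_def by (rule W1_le_diameter[OF mem])
    have W0: "0 < W" using M0 rate_pos[OF k n, of k0] big unfolding W_def by (smt (verit) mult_pos_pos)
    have qk: "k \<le> k0 * q"
    proof -
      have "k = k0 + (k - k0)" using kk by simp
      also have "\<dots> \<le> k0 + k0 * (2 * (k - k0))" using \<open>k0 \<ge> 1\<close> by (cases k0) auto
      finally show ?thesis by (simp add: q_def algebra_simps)
    qed
    have Rq: "R ^ k \<le> (R ^ k0) ^ q"
      unfolding power_mult[symmetric] using R1 qk by (intro power_increasing) auto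
    have Ek: "?E \<le> Q ^ k"
    proof -
      have "1 \<le> exp (2 * L)" using \<open>L > 0\<close> by simp
      then have "1 \<le> 4 * exp (2 * L)" by linarith
      then have "(4 * exp (2 * L)) ^ (2 * k - 1) \<le> (4 * exp (2 * L)) ^ (2 * k)"
        by (intro power_increasing) auto
      then have "?E \<le> exp (2 * real k) * (4 * exp (2 * L)) ^ (2 * k)"
        by simp
      also have "\<dots> = exp 1 ^ (2 * k) * (4 * exp (2 * L)) ^ (2 * k)" by (simp add: exp_of_nat_mult[symmetric])
      also have "exp 1 ^ (2 * k) * (4 * exp (2 * L)) ^ (2 * k) = Q ^ k"
      proof -
        have "exp 1 * (4 * exp (2 * L)) = 4 * exp (2 * L + 1)" by (simp add: exp_add)
        then show ?thesis unfolding Q_def power_mult[symmetric] power_mult_distrib[symmetric] by (simp only:)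
      qed
      finally show ?thesis .
    qed
    have E0: "0 < ?E" by simp
    have sD: "(4 * exp (2 * L) * sqrt (real k)) ^ (2 * k - 1) = (4 * exp (2 * L)) ^ (2 * k - 1) * s"
      by (simp add: s_def power_mult_distrib)
    have rq: "rate n k k0 ^ q = ?R"
      unfolding q_def s_def N_def by (rule rate_power[OF \<open>k0 \<ge> 1\<close> kk n])
    have r0: "0 \<le> rate n k k0" using rate_pos[OF k n, of k0] by simp
    text \<open>Far from the truth the exponent \<open>2k - 1\<close> has to be used instead of \<open>2(k - k0) + 1\<close>;
      nonemptiness of the set, that is \<open>M \<cdot> rate \<le> 2 L\<close>, then compensates for the loss.\<close>
    have "\<exists>z\<ge>Y * real k * N. A \<le> 1 - z\<^sup>2 / 8"
    proof (cases "W < \<delta>")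
      case True
      define z where "z = (W / (2 * real k)) ^ q * \<gamma> ^ (2 * k - 1 - q)
           / ?F"
      have e: "2 * k - 1 - q = 2 * k0 - 2" using kk \<open>k0 \<ge> 1\<close> by (simp add: q_def)
      have "A \<le> 1 - z\<^sup>2 / 8"
        unfolding A_def z_def W_def
      proof (rule affinity_le_W1[OF w \<theta> \<open>L > 0\<close> \<gamma>])
        show "1 \<le> q" "q \<le> 2 * k - 1" using kk \<open>k0 \<ge> 1\<close> by (auto simp: q_def)
        show "window_count k \<theta> \<theta>' \<gamma> x \<le> q + 1" for x
          using window[OF w \<theta>, of x] True near by (simp add: q_def W_def)
      qed (use W0 in \<open>simp add: W_def\<close>)
      moreover have "Y * real k * N \<le> z"
      proof -
        have "g \<le> min 1 \<gamma> ^ (2 * k0 - 2)" unfolding g_def using \<gamma> by (intro power_base_le) auto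
        also have "\<dots> \<le> \<gamma> ^ (2 * k0 - 2)" using \<gamma> by (intro power_mono) auto
        finally have g_le: "g \<le> \<gamma> ^ (2 * k0 - 2)" .
        have "Y / g * Q ^ k \<le> R ^ k"
        proof -
          have "Y / g * Q \<le> R"
          proof -
            have "Y / g * Q * 1 \<le> Y / g * Q * (exp (2 * real k0) / d\<^sup>2)"
            proof (rule mult_left_mono)
              have "d\<^sup>2 * 1 \<le> 1 * exp (2 * real k0)" using d2 by (intro mult_mono) auto
              then show "1 \<le> exp (2 * real k0) / d\<^sup>2" using d2 by simp
            qed (use pos g in auto)
            then show ?thesis by (simp add: R_def)
          qed
          then have "(Y / g * Q) ^ k \<le> R ^ k" using pos g by (intro power_mono) auto
          then have "(Y / g) ^ k * Q ^ k \<le> R ^ k" by (simp only: power_mult_distrib)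
          moreover have "Y / g * Q ^ k \<le> (Y / g) ^ k * Q ^ k"
            using Yg pos k by (intro mult_right_mono self_le_power) auto
          ultimately show ?thesis by linarith
        qed
        also have "\<dots> \<le> (R ^ k0) ^ q" by (rule Rq)
        also have "\<dots> \<le> (M / 2) ^ q"
          using \<open>L > 0\<close> R1 by (intro power_mono) (auto simp: M_def)
        finally have M_ge: "Y / g * Q ^ k \<le> (M / 2) ^ q" .
        \<comment> \<open>Arranged so that \<open>M_ge\<close>, \<open>g_le\<close> and
          \<open>Ek\<close> bound one factor each.\<close>
        have "Y * real k * N = (Y / g * Q ^ k) * (real k * N) * g / Q ^ k"
          using g Q by simp
        also have "\<dots> \<le> (M / 2) ^ q * (real k * N) * \<gamma> ^ (2 * k0 - 2) / ?E"
          using M_ge g_le Ek E0 g N0 \<gamma> pos M0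
          by (intro frac_le mult_mono) auto
        also have "\<dots> = (M * rate n k k0 / (2 * real k)) ^ q * \<gamma> ^ (2 * k0 - 2)
           / ?F"
          unfolding sD power_divide power_mult_distrib[of M] power_mult_distrib[of 2] rq using k s0 by simp
        also have "\<dots> \<le> z"
          unfolding z_def e using big M0 r0 \<gamma>
          by (intro divide_right_mono mult_right_mono power_mono) (auto simp: W_def)
        finally show ?thesis .
      qed
      ultimately show ?thesis by blast
    next
      case False
      \<comment> \<open>With this exponent the window condition is trivial, as there are at most
        \<open>2 * k\<close> atoms, and the power of the window length disappears.\<close>
      define p where "p = 2 * k - 1"
      define z where "z = (W / (2 * real k)) ^ p * (2 * L) ^ (2 * k - 1 - p)
           / ?F"
      have "A \<le> 1 - z\<^sup>2 / 8"
        unfolding A_def z_def W_def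
      proof (rule affinity_le_W1[OF w \<theta> \<open>L > 0\<close>])
        show "1 \<le> p" "p \<le> 2 * k - 1" using k by (auto simp: p_def)
        show "window_count k \<theta> \<theta>' (2*L) x \<le> p + 1" for x
        proof -
          have "window_count k \<theta> \<theta>' (2*L) x \<le> card (\<theta> ` {1..k} \<union> \<theta>' ` {1..k})"
            by (intro card_mono) auto
          also have "\<dots> \<le> card (\<theta> ` {1..k}) + card (\<theta>' ` {1..k})" by (rule card_Un_le)
          also have "\<dots> \<le> k + k" using card_image_le[of "{1..k}" \<theta>] card_image_le[of "{1..k}" \<theta>'] by simp
          finally show ?thesis using k by (simp add: p_def)
        qed
      qed (use W0 \<open>L > 0\<close> in \<open>auto simp: W_def\<close>)
      moreover have "Y * real k * N \<le> z"
      proof -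
        have "d ^ (2 * k) \<le> d ^ p" using d by (intro power_base_le) (auto simp: p_def)
        also have "\<dots> \<le> (W / 2) ^ p" using d False by (intro power_mono) auto
        finally have d_le: "d ^ (2 * k) \<le> (W / 2) ^ p" .
        \<comment> \<open>Passing from the exponent \<open>q\<close> to \<open>p\<close> costs
          \<open>2 * k0 - 2\<close> powers of k. These are at most exponential in \<open>k\<close>,
          whence the factor \<open>exp (2 * real k0)\<close> in \<open>R\<close>.\<close>
        have kp: "real k ^ p \<le> exp (2 * real k0) ^ k * (real k ^ q)"
        proof -
          have "p = (2 * k0 - 2) + q" using kk \<open>k0 \<ge> 1\<close> by (simp add: p_def q_def)
          then have "real k ^ p = real k ^ (2 * k0 - 2) * real k ^ q" by (simp add: power_add)
          moreover have "real k ^ (2 * k0 - 2) \<le> exp (2 * real k0) ^ k"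
          proof -
            have "real k ^ (2 * k0 - 2) \<le> real k ^ (2 * k0)" using k by (intro power_increasing) auto
            also have "\<dots> \<le> exp (real k) ^ (2 * k0)"
              using order.trans[OF _ exp_ge_add_one_self, of "real k" "real k"] by (intro power_mono) auto
            also have "\<dots> = exp (2 * real k0) ^ k"
              by (simp add: exp_of_nat_mult[symmetric] mult_ac)
            finally show ?thesis .
          qed
          ultimately show ?thesis by (simp add: mult_right_mono)
        qed
        \<comment> \<open>Read with \<open>rq\<close>, this is an upper bound on \<open>N\<close>,
          small enough for a \<open>W\<close> bounded away from 0 to win.\<close>
        have "(M / (2 * L)) ^ q * ?R = (M * rate n k k0 / (2 * L)) ^ q"
          unfolding rq[symmetric] by (simp add: power_mult_distrib power_divide)
        also have "\<dots> \<le> 1"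
        proof (rule power_le_one)
          show "0 \<le> M * rate n k k0 / (2 * L)" using M0 r0 \<open>L > 0\<close> by simp
          show "M * rate n k k0 / (2 * L) \<le> 1" using big W2L \<open>L > 0\<close> by (simp add: W_def)
        qed
        finally have small: "(M / (2 * L)) ^ q * ?R \<le> 1" .
        have "?G \<le> R ^ k"
        proof -
          have "Y * 1 \<le> Y * (1 / g)" using Y g by (intro mult_left_mono) auto
          then have "Y \<le> (Y / g) ^ k" using Yg k self_le_power[of "Y / g" k] by simp
          then have "Y * (Q ^ k * exp (2 * real k0) ^ k / d ^ (2 * k))
              \<le> (Y / g) ^ k * (Q ^ k * exp (2 * real k0) ^ k / d ^ (2 * k))"
            using pos d by (intro mult_right_mono) auto
          then show ?thesis
            unfolding R_def times_divide_eq_right[symmetric] power_mult_distrib power_divide power_mult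
            by (simp add: mult_ac)
        qed
        also have "\<dots> \<le> (R ^ k0) ^ q" by (rule Rq)
        also have "\<dots> \<le> (M / (2 * L)) ^ q"
          using \<open>L > 0\<close> R1 by (intro power_mono) (auto simp: M_def field_simps)
        finally have M_ge: "?G \<le> (M / (2 * L)) ^ q" .
        then have "?G * ?R
            \<le> (M / (2 * L)) ^ q * ?R"
          using N0 s0 by (intro mult_right_mono) auto
        with small have "?G * ?R \<le> 1"
          by linarith
        then have "Y * real k * N * (exp (2 * real k0) ^ k * real k ^ q) * (Q ^ k * s) \<le> d ^ (2 * k)"
          using d by (simp add: field_simps)
        moreover have "Y * real k * N * real k ^ p * (?E * s)
          \<le> Y * real k * N * (exp (2 * real k0) ^ k * real k ^ q) * (Q ^ k * s)"
          using kp Ek E0 Y N0 s0 pos by (intro mult_mono mult_nonneg_nonneg) auto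
        ultimately have "Y * real k * N * (real k ^ p * (?E * s)) \<le> (W / 2) ^ p"
          using d_le by (simp add: mult.assoc)
        moreover have "0 < real k ^ p * (?E * s)"
          using k s0 by simp
        ultimately have "Y * real k * N \<le> (W / 2) ^ p / (real k ^ p * (?E * s))"
          by (subst pos_le_divide_eq)
        also have "\<dots> = z"
          unfolding z_def sD by (simp add: p_def power_divide power_mult_distrib)
        finally show ?thesis .
      qed
      ultimately show ?thesis by blast
    qed
    then obtain z where z: "Y * real k * N \<le> z" "A \<le> 1 - z\<^sup>2 / 8" by blast
    have "(Y * real k * N)\<^sup>2 \<le> z\<^sup>2" using z(1) Y N0 by (intro power_mono) auto
    then have "(Y * real k * N)\<^sup>2 / 8 \<le> 1 - A" using z(2) by linarith
    then have "real n * ((Y * real k * N)\<^sup>2 / 8) \<le> real n * (1 - A)" by (intro mult_left_mono) auto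
    moreover have "real n * ((Y * real k * N)\<^sup>2 / 8) = Y\<^sup>2 / 8 * (real k)\<^sup>2 * (ln (real n))\<^sup>2"
      using n by (simp add: N_def power_mult_distrib power_divide)
    moreover have "\<Lambda> * real k * (ln (real n))\<^sup>2 \<le> Y\<^sup>2 / 8 * (real k)\<^sup>2 * (ln (real n))\<^sup>2"
    proof (intro mult_right_mono mult_mono)
      have "8 * \<Lambda> \<le> Y * 1" using Y by simp
      also have "\<dots> \<le> Y * Y" using Y by (intro mult_left_mono) auto
      finally show "\<Lambda> \<le> Y\<^sup>2 / 8" by (simp add: power2_eq_square)
      show "real k \<le> (real k)\<^sup>2" using k by (simp add: self_le_power)
    qed auto
    ultimately show "\<Lambda> * real k * (ln (real n))\<^sup>2 \<le> real n * (1 - affinity (gmix k w \<theta>) (gmix k w' \<theta>'))"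
      by (simp add: A_def)
  qed
qed

section \<open>Likelihood ratios\<close>

text \<open>The logarithm of the ratio is
  \<open>(\<theta> - \<theta>') * (x - (\<theta> + \<theta>') / 2)\<close>, linear in
  \<open>x\<close>. For a whole sample it is therefore controlled by the sum of the absolute
  values.\<close>

lemma normal_density_shift_le:
  assumes "\<bar>\<theta> - \<theta>'\<bar> \<le> \<eta>" "\<bar>\<theta>\<bar> \<le> L" "\<bar>\<theta>'\<bar> \<le> L"
  shows "normal_density \<theta> 1 x \<le> exp (\<eta> * (\<bar>x\<bar> + L)) * normal_density \<theta>' 1 x"
proof -
  have "(\<theta> - \<theta>') * (x - (\<theta> + \<theta>') / 2) \<le> \<bar>\<theta> - \<theta>'\<bar> * \<bar>x - (\<theta> + \<theta>') / 2\<bar>"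
    by (metis abs_ge_self abs_mult)
  also have "\<dots> \<le> \<eta> * (\<bar>x\<bar> + L)"
  proof (rule mult_mono)
    have "\<bar>(\<theta> + \<theta>') / 2\<bar> \<le> L" using assms(2,3) by (auto simp: abs_le_iff)
    then show "\<bar>x - (\<theta> + \<theta>') / 2\<bar> \<le> \<bar>x\<bar> + L" by linarith
  qed (use assms in auto)
  finally have "- (x - \<theta>)\<^sup>2 / 2 \<le> \<eta> * (\<bar>x\<bar> + L) + (- (x - \<theta>')\<^sup>2 / 2)"
    by (simp add: power2_eq_square field_simps)
  then have "exp (- (x - \<theta>)\<^sup>2 / 2) \<le> exp (\<eta> * (\<bar>x\<bar> + L)) * exp (- (x - \<theta>')\<^sup>2 / 2)"
    unfolding exp_add[symmetric] by simp
  then have "exp (- (x - \<theta>)\<^sup>2 / 2) / sqrt (2 * pi) \<le> exp (\<eta> * (\<bar>x\<bar> + L)) * exp (- (x - \<theta>')\<^sup>2 / 2) / sqrt (2 * pi)"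
    by (intro divide_right_mono) auto
  then show ?thesis by (simp add: normal_density_def)
qed

lemma atom_cube_abs_le: "\<theta> \<in> atom_cube L k \<Longrightarrow> j \<in> {1..k} \<Longrightarrow> \<bar>\<theta> j\<bar> \<le> L"
  by (auto simp: atom_cube_def PiE_iff abs_le_iff minus_le_iff)

text \<open>Weights are compared by domination: closeness alone gives no control over the ratio of
  weights near zero.\<close>

lemma gmix_shift_le:
  assumes "\<And>j. j \<in> {1..k} \<Longrightarrow> 0 \<le> w j \<and> w j \<le> w' j"
    and "\<theta> \<in> atom_cube L k" "\<theta>' \<in> atom_cube L k" "\<And>j. j \<in> {1..k} \<Longrightarrow> \<bar>\<theta> j - \<theta>' j\<bar> \<le> \<eta>"
  shows "gmix k w \<theta> x \<le> exp (\<eta> * (\<bar>x\<bar> + L)) * gmix k w' \<theta>' x"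
proof -
  have "w j * normal_density (\<theta> j) 1 x \<le> w' j * (exp (\<eta> * (\<bar>x\<bar> + L)) * normal_density (\<theta>' j) 1 x)"
    if "j \<in> {1..k}" for j
    using assms(1)[OF that]
      normal_density_shift_le[OF assms(4)[OF that] atom_cube_abs_le[OF assms(2) that] atom_cube_abs_le[OF assms(3) that]]
    by (intro mult_mono) auto
  then have "gmix k w \<theta> x \<le> (\<Sum>j\<in>{1..k}. w' j * (exp (\<eta> * (\<bar>x\<bar> + L)) * normal_density (\<theta>' j) 1 x))"
    unfolding gmix_def by (rule sum_mono)
  then show ?thesis by (simp add: gmix_def sum_distrib_left mult_ac)
qed

abbreviation lik :: "nat \<Rightarrow> nat \<Rightarrow> (nat \<Rightarrow> real) \<Rightarrow> (nat \<Rightarrow> real) \<Rightarrow> (nat \<Rightarrow> real) \<Rightarrow> real" where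
  "lik n k w \<theta> x \<equiv> \<Prod>i\<in>{1..n}. gmix k w \<theta> (x i)"

text \<open>The radius n^-3 is matched to the event on the sample: n^-3 (n^2 + n L) \<le> 1 +
  L.\<close>

lemma prod_gmix_shift_le:
  fixes x :: "nat \<Rightarrow> real"
  assumes w: "\<And>j. j \<in> {1..k} \<Longrightarrow> 0 \<le> w j \<and> w j \<le> w' j"
    and \<theta>: "\<theta> \<in> atom_cube L k" "\<theta>' \<in> atom_cube L k"
      "\<And>j. j \<in> {1..k} \<Longrightarrow> \<bar>\<theta> j - \<theta>' j\<bar> \<le> 1 / real n ^ 3"
    and "n \<ge> 1" "L > 0" and x: "(\<Sum>i\<in>{1..n}. \<bar>x i\<bar>) \<le> (real n)\<^sup>2"
  shows "lik n k w \<theta> x \<le> exp (1 + L) * lik n k w' \<theta>' x"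
proof -
  let ?e = "1 / real n ^ 3"
  have "(\<Sum>i\<in>{1..n}. ?e * (\<bar>x i\<bar> + L)) = ?e * ((\<Sum>i\<in>{1..n}. \<bar>x i\<bar>) + real n * L)"
    unfolding sum_distrib_left[symmetric] by (simp add: sum.distrib)
  also have "\<dots> \<le> ?e * ((real n)\<^sup>2 + real n * L)" using x by (intro mult_left_mono) auto
  also have "\<dots> = 1 / real n + L / (real n)\<^sup>2"
    using \<open>n \<ge> 1\<close> by (simp add: power2_eq_square power3_eq_cube field_simps)
  also have "\<dots> \<le> 1 / 1 + L / 1"
    using \<open>n \<ge> 1\<close> \<open>L > 0\<close> by (intro add_mono divide_left_mono) (auto simp: one_le_power)
  finally have e: "(\<Sum>i\<in>{1..n}. ?e * (\<bar>x i\<bar> + L)) \<le> 1 + L" by simp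
  have w': "0 \<le> w' j" if "j \<in> {1..k}" for j using w[OF that] by linarith
  have "lik n k w \<theta> x \<le> (\<Prod>i\<in>{1..n}. exp (?e * (\<bar>x i\<bar> + L)) * gmix k w' \<theta>' (x i))"
    using w \<theta> by (intro prod_mono conjI gmix_nonneg gmix_shift_le) auto
  also have "\<dots> = exp (\<Sum>i\<in>{1..n}. ?e * (\<bar>x i\<bar> + L)) * lik n k w' \<theta>' x"
    by (simp add: prod.distrib exp_sum)
  also have "\<dots> \<le> exp (1 + L) * lik n k w' \<theta>' x"
    using e w' by (intro mult_right_mono prod_nonneg gmix_nonneg ballI) auto
  finally show ?thesis .
qed

text \<open>The price, over all \<open>n\<close> observations, of the factor by which
  \<open>interior_weights\<close> shrinks the given weights.\<close>

lemma half_le_power: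
  assumes "n \<ge> 2"
  shows "1 / 2 \<le> (1 - 1 / (real n)\<^sup>2) ^ n"
proof -
  have n: "1 \<le> (real n)\<^sup>2" using assms by (intro one_le_power) auto
  have "1 / 2 \<le> 1 - 1 / real n" using assms by (simp add: field_simps)
  also have "\<dots> = 1 + real n * (- (1 / (real n)\<^sup>2))"
    using assms by (simp add: power2_eq_square field_simps)
  also have "\<dots> \<le> (1 + - (1 / (real n)\<^sup>2)) ^ n" proof (rule Bernoulli_inequality)
    have "1 / (real n)\<^sup>2 \<le> 1"
      using n by (simp only: divide_le_eq_1_pos[OF less_le_trans[OF zero_less_one n]])
    then show "- 1 \<le> - (1 / (real n)\<^sup>2)" by simp
  qed
  finally show ?thesis by simp
qed

text \<open>The centre of the prior ball. Mixing in uniform weights of total mass n^-2 lifts every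
  weight by n^-2 / k, which is at least the radius n^-3 when k \<le> n. So every point of the ball
  still dominates (1 - n^-2) times the original weights.\<close>

abbreviation interior_weights :: "nat \<Rightarrow> nat \<Rightarrow> (nat \<Rightarrow> real) \<Rightarrow> nat \<Rightarrow> real" where
  "interior_weights n k w \<equiv> \<lambda>j. (1 - 1 / (real n)\<^sup>2) * w j + 1 / ((real n)\<^sup>2 * real k)"

lemma prod_gmix_ge:
  fixes x :: "nat \<Rightarrow> real"
  assumes w: "w \<in> weight_simplex k" "w' \<in> weight_simplex k"
    and close: "(\<Sum>j\<in>{1..k}. \<bar>w j - interior_weights n k w' j\<bar>) \<le> 1 / real n ^ 3"
    and \<theta>: "\<theta> \<in> atom_cube L k" "\<theta>' \<in> atom_cube L k"
      "\<And>j. j \<in> {1..k} \<Longrightarrow> \<bar>\<theta> j - \<theta>' j\<bar> \<le> 1 / real n ^ 3"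
    and "n \<ge> 2" "k \<le> n" "L > 0" and x: "(\<Sum>i\<in>{1..n}. \<bar>x i\<bar>) \<le> (real n)\<^sup>2"
  shows "exp (- (1 + L)) / 2 * lik n k w' \<theta>' x \<le> lik n k w \<theta> x"
proof -
  define c where "c = 1 - 1 / (real n)\<^sup>2"
  have k: "1 \<le> k" using weight_simplex_pos[OF w(1)] .
  have n2: "1 \<le> (real n)\<^sup>2" using \<open>n \<ge> 2\<close> by (intro one_le_power) auto
  have c0: "0 \<le> c"
    using n2 unfolding c_def by (simp only: divide_le_eq_1_pos[OF less_le_trans[OF zero_less_one n2]] diff_ge_0_iff_ge)
  have dom: "0 \<le> c * w' j \<and> c * w' j \<le> w j" if "j \<in> {1..k}" for j
  proof
    show "0 \<le> c * w' j" using c0 weight_simplex_nonneg[OF w(2) that] by simp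
    have "\<bar>w j - (c * w' j + 1 / ((real n)\<^sup>2 * real k))\<bar>
        \<le> (\<Sum>j\<in>{1..k}. \<bar>w j - (c * w' j + 1 / ((real n)\<^sup>2 * real k))\<bar>)"
      by (rule member_le_sum[OF that]) auto
    also have "\<dots> \<le> 1 / ((real n)\<^sup>2 * real n)" using close by (simp add: c_def power2_eq_square power3_eq_cube)
    also have "\<dots> \<le> 1 / ((real n)\<^sup>2 * real k)"
      using k \<open>k \<le> n\<close> n2 by (intro divide_left_mono mult_left_mono mult_pos_pos) auto
    finally show "c * w' j \<le> w j" by linarith
  qed
  have J: "0 \<le> lik n k w' \<theta>' x"
    using gmix_pos[OF w(2)] by (intro prod_nonneg) (auto intro: less_imp_le)
  have "1 / 2 * lik n k w' \<theta>' x \<le> c ^ n * lik n k w' \<theta>' x"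
    using half_le_power[OF \<open>n \<ge> 2\<close>] J unfolding c_def by (rule mult_right_mono)
  also have "\<dots> = lik n k (\<lambda>j. c * w' j) \<theta>' x"
    by (simp add: gmix_def mult.assoc flip: sum_distrib_left) (simp add: prod.distrib)
  also have "\<dots> \<le> exp (1 + L) * lik n k w \<theta> x"
    using dom \<theta> \<open>n \<ge> 2\<close> \<open>L > 0\<close> x by (intro prod_gmix_shift_le) (auto simp: abs_minus_commute)
  finally have "exp (- (1 + L)) * (1 / 2 * lik n k w' \<theta>' x)
      \<le> exp (- (1 + L)) * (exp (1 + L) * lik n k w \<theta> x)"
    by (rule mult_left_mono) simp
  then show ?thesis by (simp add: mult.assoc[symmetric] exp_add[symmetric])
qed

section \<open>Sample laws and likelihood ratios\<close>

lemma gauss_mixture_mixing: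
  assumes "w \<in> weight_simplex k"
  shows "gauss_mixture (mixing k w \<theta>) = density lborel (\<lambda>y. ennreal (gmix k w \<theta> y))"
  unfolding gauss_mixture_eq_density[OF mixing_in_prob_algebra[OF assms]]
  by (intro arg_cong[of _ _ "density lborel"] ext mixture_density_mixing weight_simplex_nonneg[OF assms])

lemma nn_integral_gmix:
  assumes "w \<in> weight_simplex k"
  shows "(\<integral>\<^sup>+y. ennreal (gmix k w \<theta> y) \<partial>lborel) = 1"
  using has_bochner_integral_gmix_total[of k w \<theta>] weight_simplex_sum[OF assms] gmix_pos[OF assms]
  by (subst nn_integral_eq_integral) (auto simp: has_bochner_integral_iff less_imp_le)

lemma prob_space_gauss_mixture:
  assumes "w \<in> weight_simplex k"
  shows "prob_space (gauss_mixture (mixing k w \<theta>))"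
  unfolding gauss_mixture_mixing[OF assms]
  by (rule prob_spaceI) (simp add: emeasure_density nn_integral_gmix[OF assms])

lemma sets_sample_law [measurable_cong]: "sets (sample_law n \<nu>) = sets (\<Pi>\<^sub>M i\<in>{1..n}. borel)"
  unfolding sample_law_def by (intro sets_PiM_cong) (auto simp: gauss_mixture_def)

lemma prob_space_sample_law:
  assumes "w \<in> weight_simplex k"
  shows "prob_space (sample_law n (mixing k w \<theta>))"
  unfolding sample_law_def by (intro prob_space_PiM prob_space_gauss_mixture[OF assms])

lemma nn_integral_sample_law_prod:
  assumes "w \<in> weight_simplex k" and [measurable]: "f \<in> borel_measurable borel"
  shows "(\<integral>\<^sup>+x. (\<Prod>i\<in>{1..n}. f (x i)) \<partial>sample_law n (mixing k w \<theta>))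
    = (\<integral>\<^sup>+y. ennreal (gmix k w \<theta> y) * f y \<partial>lborel) ^ n"
proof -
  interpret product_sigma_finite "\<lambda>_::nat. gauss_mixture (mixing k w \<theta>)"
    using prob_space_gauss_mixture[OF assms(1), of \<theta>]
    by (simp add: product_sigma_finite_def prob_space_imp_sigma_finite)
  have "f \<in> borel_measurable (gauss_mixture (mixing k w \<theta>))"
    by (simp add: gauss_mixture_mixing[OF assms(1)])
  then have "(\<integral>\<^sup>+x. (\<Prod>i\<in>{1..n}. f (x i)) \<partial>sample_law n (mixing k w \<theta>))
      = (\<Prod>i\<in>{1..n}. integral\<^sup>N (gauss_mixture (mixing k w \<theta>)) f)"
    unfolding sample_law_def by (intro product_nn_integral_prod) auto
  then show ?thesis by (simp add: gauss_mixture_mixing[OF assms(1)] nn_integral_density)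
qed

lemma nn_integral_likelihood_ratio:
  assumes w: "w \<in> weight_simplex k" and v: "v \<in> weight_simplex l"
  shows "(\<integral>\<^sup>+x. (\<Prod>i\<in>{1..n}. ennreal (gmix l v \<phi> (x i) / gmix k w \<theta> (x i))) \<partial>sample_law n (mixing k w \<theta>)) = 1"
proof -
  have "ennreal (gmix k w \<theta> y) * ennreal (gmix l v \<phi> y / gmix k w \<theta> y) = ennreal (gmix l v \<phi> y)" for y
    using gmix_pos[OF w, of \<theta> y] gmix_pos[OF v, of \<phi> y] by (simp add: ennreal_mult[symmetric])
  then show ?thesis
    by (subst nn_integral_sample_law_prod[OF w]) (simp_all add: nn_integral_gmix[OF v])
qed

lemma affinity_nonneg: "(\<And>x. 0 \<le> p x) \<Longrightarrow> (\<And>x. 0 \<le> q x) \<Longrightarrow> 0 \<le> affinity p q"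
  unfolding affinity_def by (intro integral_nonneg_AE) auto

lemma integrable_gmix: "integrable lborel (gmix k w \<theta>)"
  using has_bochner_integral_gmix_total by (auto simp: has_bochner_integral_iff)

text \<open>The added mass is \<open>real k * \<eta>\<close> times a mixture with uniform weights.
  The square root is subadditive, and the affinity of two probability densities is at most
  1.\<close>

lemma affinity_add_weights_le:
  assumes w: "w \<in> weight_simplex k" and v: "v \<in> weight_simplex l" and "\<eta> \<ge> 0"
  shows "affinity (gmix k (\<lambda>j. w j + \<eta>) \<theta>) (gmix l v \<phi>) \<le> affinity (gmix k w \<theta>) (gmix l v \<phi>) + sqrt (real k * \<eta>)"
proof -
  have k: "k \<ge> 1" using weight_simplex_pos[OF w] .
  define u where "u = (\<lambda>j\<in>{1..k}. 1 / real k)"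
  have u: "u \<in> weight_simplex k" using k by (intro weight_simplexI) (auto simp: u_def)
  let ?p = "gmix k w \<theta>" and ?q = "gmix l v \<phi>" and ?u = "gmix k u \<theta>"
  have nonneg: "0 \<le> ?p x" "0 \<le> ?q x" "0 \<le> ?u x" for x
    using gmix_pos[OF w] gmix_pos[OF v] gmix_pos[OF u] by (auto intro: less_imp_le)
  have split: "gmix k (\<lambda>j. w j + \<eta>) \<theta> x = ?p x + real k * \<eta> * ?u x" for x
    using k by (simp add: gmix_def u_def sum_distrib_left sum.distrib[symmetric] distrib_right)
  have int: "integrable lborel (\<lambda>x. sqrt (?p x * ?q x))"
    by (intro integrable_sqrt_mult integrable_gmix nonneg)
  have "affinity (gmix k (\<lambda>j. w j + \<eta>) \<theta>) ?q
      \<le> (\<integral>x. sqrt (?p x * ?q x) + sqrt (real k * \<eta>) * ((?u x + ?q x) / 2) \<partial>lborel)"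
    unfolding affinity_def
  proof (rule integral_mono)
    show "integrable lborel (\<lambda>x. sqrt (gmix k (\<lambda>j. w j + \<eta>) \<theta> x * ?q x))"
      using nonneg weight_simplex_nonneg[OF w] weight_simplex_nonneg[OF v] \<open>\<eta> \<ge> 0\<close>
      by (intro integrable_sqrt_mult integrable_gmix gmix_nonneg) auto
    show "integrable lborel (\<lambda>x. sqrt (?p x * ?q x) + sqrt (real k * \<eta>) * ((?u x + ?q x) / 2))"
      using int integrable_gmix by (intro Bochner_Integration.integrable_add integrable_mult_right integrable_divide) auto
    fix x
    have "sqrt (gmix k (\<lambda>j. w j + \<eta>) \<theta> x * ?q x) = sqrt (?p x * ?q x + (real k * \<eta>) * (?u x * ?q x))"
      unfolding split by (simp add: algebra_simps)
    also have "\<dots> \<le> sqrt (?p x * ?q x) + sqrt ((real k * \<eta>) * (?u x * ?q x))"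
      using nonneg \<open>\<eta> \<ge> 0\<close> by (intro sqrt_add_le_add_sqrt) auto
    also have "sqrt ((real k * \<eta>) * (?u x * ?q x)) = sqrt (real k * \<eta>) * sqrt (?u x * ?q x)"
      by (rule real_sqrt_mult)
    also have "\<dots> \<le> sqrt (real k * \<eta>) * ((?u x + ?q x) / 2)"
      using sqrt_mult_le_mean[of "?u x" "?q x" 0] nonneg \<open>\<eta> \<ge> 0\<close> by (intro mult_left_mono) auto
    finally show "sqrt (gmix k (\<lambda>j. w j + \<eta>) \<theta> x * ?q x)
        \<le> sqrt (?p x * ?q x) + sqrt (real k * \<eta>) * ((?u x + ?q x) / 2)" by simp
  qed
  also have "\<dots> = affinity ?p ?q + sqrt (real k * \<eta>) * (((\<integral>x. ?u x \<partial>lborel) + (\<integral>x. ?q x \<partial>lborel)) / 2)"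
    unfolding affinity_def using int integrable_gmix by simp
  also have "\<dots> = affinity ?p ?q + sqrt (real k * \<eta>)"
    using has_bochner_integral_gmix_total[of k u \<theta>] has_bochner_integral_gmix_total[of l v \<phi>]
      weight_simplex_sum[OF u] weight_simplex_sum[OF v] by (simp add: has_bochner_integral_iff)
  finally show ?thesis .
qed

lemma sqrt_prod: "sqrt (\<Prod>i\<in>A. f i) = (\<Prod>i\<in>A. sqrt (f i))"
  by (induction A rule: infinite_finite_induct) (auto simp: real_sqrt_mult)

text \<open>The weights \<open>v\<close> are merely nonnegative because they will describe the upper
  envelope of a cell of the net, whose mass exceeds one.\<close>

lemma likelihood_ratio_tail:
  assumes w: "w \<in> weight_simplex k" and q: "\<And>j. j \<in> {1..l} \<Longrightarrow> 0 \<le> v j"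
  shows "emeasure (sample_law n (mixing k w \<theta>)) {x \<in> space (sample_law n (mixing k w \<theta>)).
      exp (- t) * lik n k w \<theta> x \<le> lik n l v \<phi> x}
    \<le> ennreal (exp (t / 2) * affinity (gmix l v \<phi>) (gmix k w \<theta>) ^ n)"
proof -
  let ?S = "sample_law n (mixing k w \<theta>)" and ?p = "gmix k w \<theta>" and ?q = "gmix l v \<phi>"
  have p0: "0 < ?p y" and q0: "0 \<le> ?q y" for y using gmix_pos[OF w] gmix_nonneg[of l v] q by auto
  define u where "u x = (\<Prod>i\<in>{1..n}. ennreal (sqrt (?q (x i) / ?p (x i))))" for x
  have [measurable]: "u \<in> borel_measurable ?S" unfolding u_def[abs_def] by measurable
  have "ennreal (?p y) * ennreal (sqrt (?q y / ?p y)) = ennreal (sqrt (?q y * ?p y))" for y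
  proof -
    have "?p y * sqrt (?q y / ?p y) = sqrt (?q y * ?p y)"
      using p0[of y] by (simp add: real_sqrt_divide real_sqrt_mult field_simps)
    then show ?thesis using p0[of y] q0[of y] by (simp add: ennreal_mult[symmetric])
  qed
  then have "(\<integral>\<^sup>+x. u x \<partial>?S) = (\<integral>\<^sup>+y. ennreal (sqrt (?q y * ?p y)) \<partial>lborel) ^ n"
    unfolding u_def by (subst nn_integral_sample_law_prod[OF w]) simp_all
  also have "(\<integral>\<^sup>+y. ennreal (sqrt (?q y * ?p y)) \<partial>lborel) = ennreal (affinity ?q ?p)"
    unfolding affinity_def using p0[THEN less_imp_le] q0
    by (intro nn_integral_eq_integral integrable_sqrt_mult integrable_gmix) simp_all
  finally have int: "(\<integral>\<^sup>+x. u x \<partial>?S) = ennreal (affinity ?q ?p ^ n)"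
    using affinity_nonneg[of ?q ?p] p0 q0 by (simp add: ennreal_power less_imp_le)
  have "{x \<in> space ?S. exp (- t) * (\<Prod>i\<in>{1..n}. ?p (x i)) \<le> (\<Prod>i\<in>{1..n}. ?q (x i))}
      \<subseteq> {x \<in> space ?S. 1 \<le> ennreal (exp (t / 2)) * u x}"
  proof safe
    fix x assume *: "exp (- t) * (\<Prod>i\<in>{1..n}. ?p (x i)) \<le> (\<Prod>i\<in>{1..n}. ?q (x i))"
    have "0 < (\<Prod>i\<in>{1..n}. ?p (x i))" using p0 by (intro prod_pos) auto
    then have "exp (- t) \<le> (\<Prod>i\<in>{1..n}. ?q (x i)) / (\<Prod>i\<in>{1..n}. ?p (x i))"
      using * by (simp add: pos_le_divide_eq)
    then have "sqrt (exp (- t)) \<le> sqrt ((\<Prod>i\<in>{1..n}. ?q (x i)) / (\<Prod>i\<in>{1..n}. ?p (x i)))"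
      by (rule real_sqrt_le_mono)
    also have "sqrt ((\<Prod>i\<in>{1..n}. ?q (x i)) / (\<Prod>i\<in>{1..n}. ?p (x i))) = (\<Prod>i\<in>{1..n}. sqrt (?q (x i) / ?p (x i)))"
      by (simp add: sqrt_prod[symmetric] prod_dividef)
    also have "sqrt (exp (- t)) = exp (- (t / 2))"
      by (rule real_sqrt_unique) (simp_all add: exp_double[symmetric])
    finally have "exp (t / 2) * exp (- (t / 2)) \<le> exp (t / 2) * (\<Prod>i\<in>{1..n}. sqrt (?q (x i) / ?p (x i)))"
      by (rule mult_left_mono) simp
    then have "ennreal 1 \<le> ennreal (exp (t / 2) * (\<Prod>i\<in>{1..n}. sqrt (?q (x i) / ?p (x i))))"
      by (intro ennreal_leI) (simp add: exp_add[symmetric])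
    also have "\<dots> = ennreal (exp (t / 2)) * u x"
      unfolding u_def using p0 q0 by (simp add: ennreal_mult prod_nonneg prod_ennreal less_imp_le)
    finally show "1 \<le> ennreal (exp (t / 2)) * u x" by simp
  qed
  then have "emeasure ?S {x \<in> space ?S. exp (- t) * (\<Prod>i\<in>{1..n}. ?p (x i)) \<le> (\<Prod>i\<in>{1..n}. ?q (x i))}
      \<le> emeasure ?S {x \<in> space ?S. 1 \<le> ennreal (exp (t / 2)) * u x}"
    by (intro emeasure_mono) measurable
  also have "\<dots> \<le> ennreal (exp (t / 2)) * (\<integral>\<^sup>+x. u x * indicator (space ?S) x \<partial>?S)"
    by (rule nn_integral_Markov_inequality) measurable
  also have "(\<integral>\<^sup>+x. u x * indicator (space ?S) x \<partial>?S) = (\<integral>\<^sup>+x. u x \<partial>?S)"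
    by (intro nn_integral_cong) simp
  also have "ennreal (exp (t / 2)) * \<dots> = ennreal (exp (t / 2) * affinity ?q ?p ^ n)"
    unfolding int using affinity_nonneg[of ?q ?p] p0 q0 by (simp add: ennreal_mult less_imp_le)
  finally show ?thesis .
qed

section \<open>The size of the sample\<close>

text \<open>The modulus of \<open>y\<close> is at most \<open>exp y + exp (- y)\<close>, whose mean
  is known from tilting by 1 and by -1; the factor \<open>exp (1 / 2)\<close> undoes the
  normalization of the tilts.\<close>

lemma nn_integral_abs_gauss_mixture:
  assumes w: "w \<in> weight_simplex k" and \<theta>: "\<theta> \<in> atom_cube L k"
  shows "(\<integral>\<^sup>+y. ennreal \<bar>y\<bar> \<partial>gauss_mixture (mixing k w \<theta>)) \<le> ennreal (2 * exp (L + 1 / 2))"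
proof -
  let ?e = "\<lambda>y. exp (1 / 2) * (exp (1 * y - 1\<^sup>2 / 2) + exp ((- 1) * y - (- 1)\<^sup>2 / 2))"
  let ?I = "\<Sum>j\<in>{1..k}. w j * (exp (1 / 2) * (exp (1 * \<theta> j) + exp ((- 1) * \<theta> j)))"
  have "has_bochner_integral lborel (\<lambda>y. exp (1 / 2) * (normal_density \<mu> 1 y * exp (1 * y - 1\<^sup>2 / 2)
      + normal_density \<mu> 1 y * exp ((- 1) * y - (- 1)\<^sup>2 / 2))) (exp (1 / 2) * (exp (1 * \<mu>) + exp ((- 1) * \<mu>)))" for \<mu> :: real
    by (intro has_bochner_integral_mult_right has_bochner_integral_add has_bochner_integral_exp_tilt)
  then have "has_bochner_integral lborel (\<lambda>y. normal_density \<mu> 1 y * ?e y) (exp (1 / 2) * (exp (1 * \<mu>) + exp ((- 1) * \<mu>)))" for \<mu> :: real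
    by (simp add: distrib_left mult.left_commute)
  then have hb: "has_bochner_integral lborel (\<lambda>y. gmix k w \<theta> y * ?e y) ?I"
    by (intro has_bochner_integral_gmix)
  have abs: "\<bar>y\<bar> \<le> ?e y" for y :: real
  proof -
    have "?e y = exp y + exp (- y)" by (simp add: distrib_left exp_add[symmetric])
    moreover have "\<bar>y\<bar> \<le> exp \<bar>y\<bar>" using exp_ge_add_one_self[of "\<bar>y\<bar>"] by linarith
    moreover have "exp \<bar>y\<bar> \<le> exp y + exp (- y)" by (cases "y \<ge> 0") auto
    ultimately show ?thesis by linarith
  qed
  have p0: "0 \<le> gmix k w \<theta> y" for y using gmix_pos[OF w] by (rule less_imp_le)
  have "(\<integral>\<^sup>+y. ennreal \<bar>y\<bar> \<partial>gauss_mixture (mixing k w \<theta>)) = (\<integral>\<^sup>+y. ennreal (gmix k w \<theta> y * \<bar>y\<bar>) \<partial>lborel)"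
    unfolding gauss_mixture_mixing[OF w] by (subst nn_integral_density) (auto simp: ennreal_mult p0)
  also have "\<dots> \<le> (\<integral>\<^sup>+y. ennreal (gmix k w \<theta> y * ?e y) \<partial>lborel)"
    using abs p0 by (intro nn_integral_mono ennreal_leI mult_left_mono) auto
  also have "\<dots> = ennreal ?I"
    using hb p0 by (subst nn_integral_eq_integral) (auto simp: has_bochner_integral_iff)
  also have "?I \<le> (\<Sum>j\<in>{1..k}. w j * (exp (1 / 2) * (exp L + exp L)))"
    using atom_cube_abs_le[OF \<theta>] weight_simplex_nonneg[OF w]
    by (intro sum_mono mult_left_mono add_mono) (auto simp: abs_le_iff)
  then have "ennreal ?I \<le> ennreal (2 * exp (L + 1 / 2))"
    unfolding sum_distrib_right[symmetric] weight_simplex_sum[OF w]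
    by (intro ennreal_leI) (simp add: exp_add mult_ac)
  finally show ?thesis .
qed

text \<open>The mean of the sum is of order n, so Markov's inequality at the level n^2 gains a
  factor 1/n.\<close>

lemma sample_abs_sum_tail:
  assumes w: "w \<in> weight_simplex k" and \<theta>: "\<theta> \<in> atom_cube L k" and "n \<ge> 1"
  shows "emeasure (sample_law n (mixing k w \<theta>)) {x \<in> space (sample_law n (mixing k w \<theta>)).
      (real n)\<^sup>2 \<le> (\<Sum>i\<in>{1..n}. \<bar>x i\<bar>)} \<le> ennreal (2 * exp (L + 1 / 2) / real n)"
proof -
  let ?S = "sample_law n (mixing k w \<theta>)"
  let ?c = "ennreal (2 * exp (L + 1 / 2))"
  have comp: "(\<integral>\<^sup>+x. ennreal \<bar>x i\<bar> \<partial>?S) \<le> ?c" if i: "i \<in> {1..n}" for i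
  proof -
    have d: "distr ?S (gauss_mixture (mixing k w \<theta>)) (\<lambda>x. x i) = gauss_mixture (mixing k w \<theta>)"
      unfolding sample_law_def using i by (intro distr_PiM_component prob_space_gauss_mixture[OF w])
    have "(\<integral>\<^sup>+x. ennreal \<bar>x i\<bar> \<partial>?S) = (\<integral>\<^sup>+y. ennreal \<bar>y\<bar> \<partial>distr ?S (gauss_mixture (mixing k w \<theta>)) (\<lambda>x. x i))"
      using i by (subst nn_integral_distr) (auto simp: sample_law_def gauss_mixture_mixing[OF w])
    then show ?thesis unfolding d using nn_integral_abs_gauss_mixture[OF w \<theta>] by simp
  qed
  define u where "u x = (\<Sum>i\<in>{1..n}. ennreal \<bar>x i\<bar>)" for x :: "nat \<Rightarrow> real"
  have [measurable]: "u \<in> borel_measurable ?S" unfolding u_def[abs_def] by measurable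
  have "{x \<in> space ?S. (real n)\<^sup>2 \<le> (\<Sum>i\<in>{1..n}. \<bar>x i\<bar>)} \<subseteq> {x \<in> space ?S. 1 \<le> ennreal (1 / (real n)\<^sup>2) * u x}"
  proof safe
    fix x :: "nat \<Rightarrow> real" assume "(real n)\<^sup>2 \<le> (\<Sum>i\<in>{1..n}. \<bar>x i\<bar>)"
    then have "1 \<le> 1 / (real n)\<^sup>2 * (\<Sum>i\<in>{1..n}. \<bar>x i\<bar>)" using \<open>n \<ge> 1\<close> by simp
    then have "ennreal 1 \<le> ennreal (1 / (real n)\<^sup>2 * (\<Sum>i\<in>{1..n}. \<bar>x i\<bar>))" by (rule ennreal_leI)
    also have "\<dots> = ennreal (1 / (real n)\<^sup>2) * ennreal (\<Sum>i\<in>{1..n}. \<bar>x i\<bar>)"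
      by (rule ennreal_mult) (auto intro: sum_nonneg)
    also have "ennreal (\<Sum>i\<in>{1..n}. \<bar>x i\<bar>) = u x" unfolding u_def by (rule sum_ennreal[symmetric]) auto
    finally show "1 \<le> ennreal (1 / (real n)\<^sup>2) * u x" by simp
  qed
  then have "emeasure ?S {x \<in> space ?S. (real n)\<^sup>2 \<le> (\<Sum>i\<in>{1..n}. \<bar>x i\<bar>)}
      \<le> emeasure ?S {x \<in> space ?S. 1 \<le> ennreal (1 / (real n)\<^sup>2) * u x}"
    by (intro emeasure_mono) measurable
  also have "\<dots> \<le> ennreal (1 / (real n)\<^sup>2) * (\<integral>\<^sup>+x. u x * indicator (space ?S) x \<partial>?S)"
    by (rule nn_integral_Markov_inequality) measurable
  also have "(\<integral>\<^sup>+x. u x * indicator (space ?S) x \<partial>?S) = (\<integral>\<^sup>+x. u x \<partial>?S)"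
    by (intro nn_integral_cong) simp
  also have "\<dots> = (\<Sum>i\<in>{1..n}. \<integral>\<^sup>+x. ennreal \<bar>x i\<bar> \<partial>?S)"
    unfolding u_def by (intro nn_integral_sum) measurable
  also have "\<dots> \<le> (\<Sum>i\<in>{1..n}. ?c)" using comp by (rule sum_mono)
  also have "\<dots> = ennreal (real n * (2 * exp (L + 1 / 2)))" by (simp add: ennreal_mult ennreal_of_nat_eq_real_of_nat)
  also have "ennreal (1 / (real n)\<^sup>2) * \<dots> = ennreal (1 / (real n)\<^sup>2 * (real n * (2 * exp (L + 1 / 2))))"
    by (rule ennreal_mult[symmetric]) auto
  also have "1 / (real n)\<^sup>2 * (real n * (2 * exp (L + 1 / 2))) = 2 * exp (L + 1 / 2) / real n"
    using \<open>n \<ge> 1\<close> by (simp add: power2_eq_square)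
  finally show ?thesis by (simp add: mult_left_mono)
qed

section \<open>Finite nets\<close>

lemma finite_image_representatives:
  assumes "finite (f ` Z)"
  obtains C where "C \<subseteq> Z" "finite C" "card C \<le> card (f ` Z)" "\<And>z. z \<in> Z \<Longrightarrow> \<exists>c\<in>C. f c = f z"
proof (rule that[of "inv_into Z f ` (f ` Z)"])
  show "inv_into Z f ` (f ` Z) \<subseteq> Z" by (auto intro: inv_into_into)
  show "finite (inv_into Z f ` (f ` Z))" using assms by (rule finite_imageI)
  show "card (inv_into Z f ` (f ` Z)) \<le> card (f ` Z)" using assms by (rule card_image_le)
  show "\<exists>c\<in>inv_into Z f ` (f ` Z). f c = f z" if "z \<in> Z" for z
    using that by (intro bexI[of _ "inv_into Z f (f z)"]) (auto intro: f_inv_into_f)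
qed

lemma abs_diff_le_if_floor_eq:
  assumes "\<lfloor>a / \<eta>\<rfloor> = \<lfloor>b / \<eta>\<rfloor>" "(\<eta>::real) > 0"
  shows "\<bar>a - b\<bar> \<le> \<eta>"
proof -
  have "\<bar>a / \<eta> - b / \<eta>\<bar> \<le> 1" using assms(1) by linarith
  then show ?thesis using assms(2) by (simp add: diff_divide_distrib[symmetric] abs_divide)
qed

text \<open>One representative is taken from each nonempty cell of a grid of mesh \<eta>. Points of
  the grid itself would not do: the net has to stay inside \<open>Z\<close>, the far set, where the
  affinity is controlled.\<close>

lemma finite_net:
  assumes Z: "Z \<subseteq> weight_simplex k \<times> atom_cube L k" and "\<eta> > 0" "L > 0"
  obtains C where "C \<subseteq> Z" "finite C" "real (card C) \<le> ((2 * L / \<eta> + 2) * (1 / \<eta> + 1)) ^ k"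
    "\<And>w \<theta>. (w, \<theta>) \<in> Z \<Longrightarrow> \<exists>(v, \<phi>)\<in>C. \<forall>j\<in>{1..k}. \<bar>w j - v j\<bar> \<le> \<eta> \<and> \<bar>\<theta> j - \<phi> j\<bar> \<le> \<eta>"
proof -
  define code where "code = (\<lambda>(w :: nat \<Rightarrow> real, \<theta> :: nat \<Rightarrow> real). \<lambda>j\<in>{1..k}. (\<lfloor>\<theta> j / \<eta>\<rfloor>, \<lfloor>w j / \<eta>\<rfloor>))"
  define box where "box = {\<lfloor>- L / \<eta>\<rfloor>..\<lfloor>L / \<eta>\<rfloor>} \<times> {0..\<lfloor>1 / \<eta>\<rfloor>}"
  have sub: "code ` Z \<subseteq> ({1..k} \<rightarrow>\<^sub>E box)"
  proof
    fix c assume "c \<in> code ` Z"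
    then obtain w \<theta> where w: "w \<in> weight_simplex k" and \<theta>: "\<theta> \<in> atom_cube L k" and c: "c = code (w, \<theta>)"
      using Z by auto
    have "(\<lfloor>\<theta> j / \<eta>\<rfloor>, \<lfloor>w j / \<eta>\<rfloor>) \<in> box" if j: "j \<in> {1..k}" for j
    proof -
      have "- L \<le> \<theta> j" "\<theta> j \<le> L" using atom_cube_abs_le[OF \<theta> j] by linarith+
      then have "- L / \<eta> \<le> \<theta> j / \<eta>" "\<theta> j / \<eta> \<le> L / \<eta>" "0 \<le> w j / \<eta>" "w j / \<eta> \<le> 1 / \<eta>"
        using weight_simplex_nonneg[OF w j] weight_simplex_le_1[OF w j] \<open>\<eta> > 0\<close>
        by (simp_all only: divide_right_mono less_imp_le divide_nonneg_pos)
      then show ?thesis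
        unfolding box_def by (simp only: floor_mono atLeastAtMost_iff zero_le_floor mem_Times_iff fst_conv snd_conv)
    qed
    then show "c \<in> ({1..k} \<rightarrow>\<^sub>E box)" by (auto simp: c code_def)
  qed
  have fin: "finite ({1..k} \<rightarrow>\<^sub>E box)" by (intro finite_PiE) (auto simp: box_def)
  obtain C where C: "C \<subseteq> Z" "finite C" "card C \<le> card (code ` Z)" "\<And>z. z \<in> Z \<Longrightarrow> \<exists>c\<in>C. code c = code z"
    using finite_image_representatives[OF finite_subset[OF sub fin]] by blast
  have "card (code ` Z) \<le> card ({1..k} \<rightarrow>\<^sub>E box)" by (rule card_mono[OF fin sub])
  also have "\<dots> = card box ^ k" by (simp add: card_PiE)
  finally have "real (card C) \<le> real (card box) ^ k" using C(3) by (simp flip: of_nat_power)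
  also have "\<dots> \<le> ((2 * L / \<eta> + 2) * (1 / \<eta> + 1)) ^ k"
  proof (rule power_mono)
    have "real (nat (\<lfloor>L / \<eta>\<rfloor> - \<lfloor>- L / \<eta>\<rfloor> + 1)) \<le> 2 * L / \<eta> + 2"
    proof -
      have "\<lfloor>- L / \<eta>\<rfloor> \<le> \<lfloor>L / \<eta>\<rfloor>" using \<open>L > 0\<close> \<open>\<eta> > 0\<close> by (intro floor_mono divide_right_mono) auto
      then have "real (nat (\<lfloor>L / \<eta>\<rfloor> - \<lfloor>- L / \<eta>\<rfloor> + 1)) = real_of_int (\<lfloor>L / \<eta>\<rfloor> - \<lfloor>- L / \<eta>\<rfloor> + 1)" by simp
      also have "\<dots> \<le> L / \<eta> - (- L / \<eta> - 1) + 1" by linarith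
      finally show ?thesis by simp
    qed
    moreover have "real (nat (\<lfloor>1 / \<eta>\<rfloor> - 0 + 1)) \<le> 1 / \<eta> + 1"
    proof -
      have "0 \<le> 1 / \<eta>" using \<open>\<eta> > 0\<close> by simp
      then have "0 \<le> \<lfloor>1 / \<eta>\<rfloor>" by simp
      then have "real (nat (\<lfloor>1 / \<eta>\<rfloor> - 0 + 1)) = real_of_int \<lfloor>1 / \<eta>\<rfloor> + 1" by simp
      then show ?thesis by linarith
    qed
    ultimately show "real (card box) \<le> (2 * L / \<eta> + 2) * (1 / \<eta> + 1)"
      unfolding box_def card_cartesian_product card_atLeastAtMost_int of_nat_mult
      using \<open>\<eta> > 0\<close> \<open>L > 0\<close> by (intro mult_mono) auto
  qed simp
  finally have card: "real (card C) \<le> ((2 * L / \<eta> + 2) * (1 / \<eta> + 1)) ^ k" .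
  show ?thesis
  proof (rule that[OF C(1,2) card])
    fix w \<theta> assume "(w, \<theta>) \<in> Z"
    then obtain v \<phi> where v: "(v, \<phi>) \<in> C" "code (v, \<phi>) = code (w, \<theta>)" using C(4) by fast
    have "\<bar>w j - v j\<bar> \<le> \<eta> \<and> \<bar>\<theta> j - \<phi> j\<bar> \<le> \<eta>" if "j \<in> {1..k}" for j
    proof -
      have "code (v, \<phi>) j = code (w, \<theta>) j" using v(2) by simp
      then have "\<lfloor>\<theta> j / \<eta>\<rfloor> = \<lfloor>\<phi> j / \<eta>\<rfloor>" "\<lfloor>w j / \<eta>\<rfloor> = \<lfloor>v j / \<eta>\<rfloor>" using that by (auto simp: code_def)
      then show ?thesis using abs_diff_le_if_floor_eq[OF _ \<open>\<eta> > 0\<close>] by blast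
    qed
    then show "\<exists>(v, \<phi>)\<in>C. \<forall>j\<in>{1..k}. \<bar>w j - v j\<bar> \<le> \<eta> \<and> \<bar>\<theta> j - \<phi> j\<bar> \<le> \<eta>" using v(1) by fast
  qed
qed

section \<open>The posterior\<close>

lemma measurable_mixing_space_subprob: "(\<lambda>\<nu>. \<nu>) \<in> mixing_space L \<rightarrow>\<^sub>M subprob_algebra borel"
  unfolding mixing_space_def by (intro measurable_restrict_space1 measurable_prob_algebraD) simp

text \<open>Measurability in both arguments together is what permits the exchange of sample and
  prior in \<open>expected_overfitted_ratio\<close>.\<close>

lemma measurable_joint_density:
  "(\<lambda>(\<nu>, x). joint_density n \<nu> x) \<in> borel_measurable (mixing_space L \<Otimes>\<^sub>M (\<Pi>\<^sub>M i\<in>{1..n}. borel))"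
proof -
  have [measurable]: "(\<lambda>(p, t). ennreal (normal_density t 1 (snd p))) \<in> borel_measurable ((mixing_space L \<Otimes>\<^sub>M borel) \<Otimes>\<^sub>M borel)"
    unfolding normal_density_def by measurable
  have "(\<lambda>p. integral\<^sup>N (fst p) (\<lambda>t. ennreal (normal_density t 1 (snd p)))) \<in> borel_measurable (mixing_space L \<Otimes>\<^sub>M borel)"
    using measurable_compose[OF measurable_fst measurable_mixing_space_subprob]
    by (intro nn_integral_measurable_subprob_algebra2[where N = borel]) auto
  then have mix: "(\<lambda>p. mixture_density (fst p) (snd p)) \<in> borel_measurable (mixing_space L \<Otimes>\<^sub>M borel)"
    by (simp add: mixture_density_def)
  have "(\<lambda>p. mixture_density (fst p) (snd p i)) \<in> borel_measurable (mixing_space L \<Otimes>\<^sub>M (\<Pi>\<^sub>M i\<in>{1..n}. borel))"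
    if "i \<in> {1..n}" for i
  proof -
    have "(\<lambda>p. (fst p, snd p i)) \<in> (mixing_space L \<Otimes>\<^sub>M (\<Pi>\<^sub>M i\<in>{1..n}. borel)) \<rightarrow>\<^sub>M (mixing_space L \<Otimes>\<^sub>M (borel :: real measure))"
      using that by measurable
    from measurable_compose[OF this mix] show ?thesis by simp
  qed
  then show ?thesis unfolding joint_density_def case_prod_beta by (intro borel_measurable_prod_ennreal) auto
qed

lemma measurable_joint_density1:
  assumes "x \<in> space (\<Pi>\<^sub>M i\<in>{1..n}. borel)"
  shows "(\<lambda>\<nu>. joint_density n \<nu> x) \<in> borel_measurable (mixing_space L)"
  using measurable_compose[OF measurable_Pair2'[OF assms] measurable_joint_density[of n L]] by simp

lemma prod_gmix_pos: "w \<in> weight_simplex k \<Longrightarrow> 0 < (\<Prod>i\<in>A. gmix k w \<theta> (x i))"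
  by (intro prod_pos) (simp add: gmix_pos)

lemma joint_density_mixing:
  assumes "w \<in> weight_simplex k"
  shows "joint_density n (mixing k w \<theta>) x = ennreal (lik n k w \<theta> x)"
proof -
  have "joint_density n (mixing k w \<theta>) x = (\<Prod>i\<in>{1..n}. ennreal (gmix k w \<theta> (x i)))"
    unfolding joint_density_def using weight_simplex_nonneg[OF assms]
    by (intro prod.cong refl mixture_density_mixing)
  also have "\<dots> = ennreal (lik n k w \<theta> x)"
    using weight_simplex_nonneg[OF assms] by (intro prod_ennreal gmix_nonneg)
  finally show ?thesis .
qed

section \<open>The prior given the number of components\<close>

definition component_prior ::
    "real \<Rightarrow> (nat \<Rightarrow> (nat \<Rightarrow> real) measure) \<Rightarrow> (nat \<Rightarrow> (nat \<Rightarrow> real) measure) \<Rightarrow> nat \<Rightarrow> real measure measure" where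
  "component_prior L T V k = distr (T k \<Otimes>\<^sub>M V k) (mixing_space L) (\<lambda>(\<theta>, w). mixing k w \<theta>)"

lemma prior_family_atoms:
  assumes "prior_family L K T V" "k \<ge> 1"
  shows "prob_space (T k)" "sets (T k) = sets (atom_space L k)" "space (T k) = atom_cube L k"
proof -
  show "prob_space (T k)" and s: "sets (T k) = sets (atom_space L k)"
    using assms by (auto simp: prior_family_def space_prob_algebra)
  show "space (T k) = atom_cube L k"
    unfolding sets_eq_imp_space_eq[OF s]
    by (auto simp: atom_space_def space_restrict_space space_PiM atom_cube_def PiE_iff)
qed

lemma prior_family_weights:
  assumes "prior_family L K T V" "k \<ge> 1"
  shows "prob_space (V k)" "sets (V k) = sets (weight_space k)" "space (V k) = weight_simplex k"
proof -
  show "prob_space (V k)" and s: "sets (V k) = sets (weight_space k)"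
    using assms by (auto simp: prior_family_def space_prob_algebra)
  show "space (V k) = weight_simplex k"
    unfolding sets_eq_imp_space_eq[OF s]
    by (auto simp: weight_space_def space_restrict_space space_PiM weight_simplex_def PiE_iff extensional_def)
qed

lemma prior_family_components:
  assumes "prior_family L K T V" "n \<ge> 1"
  shows "prob_space (K n)" "sets (K n) = Pow {1..}" "space (K n) = {1..}"
proof -
  show "prob_space (K n)" and s: "sets (K n) = Pow {1..}"
    using assms by (auto simp: prior_family_def space_prob_algebra)
  show "space (K n) = {1..}" using sets_eq_imp_space_eq[of "K n" "count_space {1..}"] s by simp
qed

lemma measurable_mixing_prior:
  assumes "prior_family L K T V" "k \<ge> 1"
  shows "(\<lambda>(\<theta>, w). mixing k w \<theta>) \<in> (T k \<Otimes>\<^sub>M V k) \<rightarrow>\<^sub>M mixing_space L"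
proof -
  have "sets (T k \<Otimes>\<^sub>M V k) = sets (atom_space L k \<Otimes>\<^sub>M weight_space k)"
    using prior_family_atoms[OF assms] prior_family_weights[OF assms] by (intro sets_pair_measure_cong)
  then show ?thesis
    using measurable_mixing[OF assms(2), of L] measurable_cong_sets[OF _ refl] by blast
qed

lemma prob_space_component_prior:
  assumes "prior_family L K T V" "k \<ge> 1"
  shows "prob_space (component_prior L T V k)"
  unfolding component_prior_def
  by (intro prob_space.prob_space_distr prob_space_pair measurable_mixing_prior[OF assms]
      prior_family_atoms[OF assms] prior_family_weights[OF assms])

lemma sets_component_prior [measurable_cong]: "sets (component_prior L T V k) = sets (mixing_space L)"
  by (simp add: component_prior_def)

lemma nn_integral_component_prior:
  assumes "prior_family L K T V" "k \<ge> 1" "f \<in> borel_measurable (mixing_space L)"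
  shows "(\<integral>\<^sup>+\<nu>. f \<nu> \<partial>component_prior L T V k) = (\<integral>\<^sup>+p. f (mixing k (snd p) (fst p)) \<partial>(T k \<Otimes>\<^sub>M V k))"
  unfolding component_prior_def
  using measurable_mixing_prior[OF assms(1,2)] assms(3) by (subst nn_integral_distr) (auto simp: case_prod_beta)

lemma nn_integral_component_prior_le:
  assumes "prior_family L K T V" "k \<ge> 1" "f \<in> borel_measurable (mixing_space L)"
    and "\<And>w \<theta>. w \<in> weight_simplex k \<Longrightarrow> \<theta> \<in> atom_cube L k \<Longrightarrow> f (mixing k w \<theta>) \<le> c"
  shows "(\<integral>\<^sup>+\<nu>. f \<nu> \<partial>component_prior L T V k) \<le> c"
proof -
  interpret T: prob_space "T k" by (rule prior_family_atoms[OF assms(1,2)])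
  interpret V: prob_space "V k" by (rule prior_family_weights[OF assms(1,2)])
  interpret TV: pair_prob_space "T k" "V k" ..
  have "(\<integral>\<^sup>+p. f (mixing k (snd p) (fst p)) \<partial>(T k \<Otimes>\<^sub>M V k)) \<le> (\<integral>\<^sup>+p. c \<partial>(T k \<Otimes>\<^sub>M V k))"
    using prior_family_atoms(3)[OF assms(1,2)] prior_family_weights(3)[OF assms(1,2)]
    by (intro nn_integral_mono assms(4)) (auto simp: space_pair_measure)
  then show ?thesis
    unfolding nn_integral_component_prior[OF assms(1-3)] by (simp add: TV.emeasure_space_1)
qed

lemma measurable_component_prior:
  assumes "prior_family L K T V" "n \<ge> 1"
  shows "component_prior L T V \<in> K n \<rightarrow>\<^sub>M subprob_algebra (mixing_space L)"
proof -
  have "component_prior L T V k \<in> space (subprob_algebra (mixing_space L))" if "k \<ge> 1" for k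
    using prob_space_component_prior[OF assms(1) that]
    by (auto simp: space_subprob_algebra prob_space_imp_subprob_space sets_component_prior)
  then have "component_prior L T V \<in> count_space {1..} \<rightarrow>\<^sub>M subprob_algebra (mixing_space L)"
    by (subst measurable_count_space_eq1) auto
  moreover have "sets (K n) = sets (count_space {1..})"
    using prior_family_components(2)[OF assms] by simp
  ultimately show ?thesis by (subst measurable_cong_sets[OF _ refl])
qed

lemma nn_integral_mixing_prior:
  assumes "prior_family L K T V" "n \<ge> 1" "f \<in> borel_measurable (mixing_space L)"
  shows "(\<integral>\<^sup>+\<nu>. f \<nu> \<partial>mixing_prior L (K n) T V) = (\<integral>\<^sup>+k. (\<integral>\<^sup>+\<nu>. f \<nu> \<partial>component_prior L T V k) \<partial>K n)"
  unfolding mixing_prior_def component_prior_def[symmetric]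
  by (rule nn_integral_bind[OF assms(3) measurable_component_prior[OF assms(1,2)]])

lemma sets_mixing_prior:
  assumes "prior_family L K T V" "n \<ge> 1"
  shows "sets (mixing_prior L (K n) T V) = sets (mixing_space L)"
  using mixing_prior_in_prob_algebra[OF assms] by (simp add: space_prob_algebra)

section \<open>Numerator and evidence of the posterior\<close>

text \<open>The inequality covers arbitrary sets \<open>U\<close>: off the \<sigma>-algebra
  \<open>emeasure\<close> is 0 by convention.\<close>

lemma emeasure_posterior:
  assumes "prior_family L K T V" "n \<ge> 1" and x: "x \<in> space (\<Pi>\<^sub>M i\<in>{1..n}. borel)"
  shows "emeasure (posterior (mixing_prior L (K n) T V) n x) U
    \<le> (\<integral>\<^sup>+k. (\<integral>\<^sup>+\<nu>. joint_density n \<nu> x * indicator U \<nu> \<partial>component_prior L T V k) \<partial>K n)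
       / (\<integral>\<^sup>+\<nu>. joint_density n \<nu> x \<partial>mixing_prior L (K n) T V)"
proof (cases "U \<in> sets (mixing_space L)")
  case True
  let ?P = "mixing_prior L (K n) T V" and ?D = "\<integral>\<^sup>+\<nu>. joint_density n \<nu> x \<partial>mixing_prior L (K n) T V"
  note sets = sets_mixing_prior[OF assms(1,2)]
  have jd: "(\<lambda>\<nu>. joint_density n \<nu> x) \<in> borel_measurable (mixing_space L)"
    by (rule measurable_joint_density1[OF x])
  then have jdU: "(\<lambda>\<nu>. joint_density n \<nu> x * indicator U \<nu>) \<in> borel_measurable (mixing_space L)"
    using True by (intro borel_measurable_times_ennreal borel_measurable_indicator)
  have [measurable]: "(\<lambda>\<nu>. joint_density n \<nu> x) \<in> borel_measurable ?P" "U \<in> sets ?P"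
    using True jd by (simp_all add: sets cong: measurable_cong_sets)
  have "emeasure (posterior ?P n x) U = (\<integral>\<^sup>+\<nu>. joint_density n \<nu> x / ?D * indicator U \<nu> \<partial>?P)"
    unfolding posterior_def by (rule emeasure_density) measurable
  also have "\<dots> = (\<integral>\<^sup>+\<nu>. joint_density n \<nu> x * indicator U \<nu> / ?D \<partial>?P)"
    by (simp add: divide_ennreal_def mult_ac)
  also have "\<dots> = (\<integral>\<^sup>+\<nu>. joint_density n \<nu> x * indicator U \<nu> \<partial>?P) / ?D"
    by (rule nn_integral_divide) measurable
  also have "(\<integral>\<^sup>+\<nu>. joint_density n \<nu> x * indicator U \<nu> \<partial>?P)
      = (\<integral>\<^sup>+k. (\<integral>\<^sup>+\<nu>. joint_density n \<nu> x * indicator U \<nu> \<partial>component_prior L T V k) \<partial>K n)"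
    by (rule nn_integral_mixing_prior[OF assms(1,2) jdU])
  finally show ?thesis by simp
next
  case False
  then have "U \<notin> sets (posterior (mixing_prior L (K n) T V) n x)"
    by (simp add: posterior_def sets_mixing_prior[OF assms(1,2)])
  then show ?thesis by (simp add: emeasure_notin_sets)
qed

text \<open>Covers the degenerate quotients \<open>0 / 0\<close> and \<open>top / top\<close>, both
  of which are 0.\<close>

lemma ennreal_divide_self_le_1: "(a::ennreal) / a \<le> 1"
proof (cases "a = 0 \<or> a = top")
  case True
  then show ?thesis by (auto simp: divide_ennreal_def)
next
  case False
  then show ?thesis by (simp add: ennreal_divide_self less_top)
qed

lemma emeasure_posterior_le_1:
  assumes "prior_family L K T V" "n \<ge> 1" and x: "x \<in> space (\<Pi>\<^sub>M i\<in>{1..n}. borel)"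
  shows "emeasure (posterior (mixing_prior L (K n) T V) n x) U \<le> 1"
proof -
  have "(\<integral>\<^sup>+k. (\<integral>\<^sup>+\<nu>. joint_density n \<nu> x * indicator U \<nu> \<partial>component_prior L T V k) \<partial>K n)
      \<le> (\<integral>\<^sup>+k. (\<integral>\<^sup>+\<nu>. joint_density n \<nu> x \<partial>component_prior L T V k) \<partial>K n)"
    by (intro nn_integral_mono) (auto simp: indicator_def)
  also have "\<dots> = (\<integral>\<^sup>+\<nu>. joint_density n \<nu> x \<partial>mixing_prior L (K n) T V)"
    by (rule nn_integral_mixing_prior[OF assms(1,2) measurable_joint_density1[OF x], symmetric])
  finally show ?thesis
    by (intro order.trans[OF emeasure_posterior[OF assms]] order.trans[OF divide_right_mono_ennreal ennreal_divide_self_le_1])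
qed

abbreviation atom_ball where
  "atom_ball n k T \<theta>0 \<equiv> {\<theta> \<in> space (T k). (MAX j\<in>{1..k}. \<bar>\<theta> j - \<theta>0 j\<bar>) \<le> 1 / real n ^ 3}"

abbreviation weight_ball where
  "weight_ball n k V w0 \<equiv> {w \<in> space (V k). (\<Sum>j\<in>{1..k}. \<bar>w j - w0 j\<bar>) \<le> 1 / real n ^ 3}"

text \<open>The prior is restricted to \<open>k\<close> components and to a product of two balls, on
  which \<open>prod_gmix_ge\<close> applies. Atoms and weights are independent given
  \<open>k\<close>, so the prior mass of the product is at least \<open>u * v\<close>.\<close>

lemma evidence_ge:
  assumes prior: "prior_family L K T V" and n: "n \<ge> 2" "k \<le> n" and "L > 0"
    and w0: "w0 \<in> weight_simplex k" and \<theta>0: "\<theta>0 \<in> atom_cube L k"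
    and u: "0 < u" "u \<le> measure (T k) (atom_ball n k T \<theta>0)"
    and v: "0 < v" "v \<le> measure (V k) (weight_ball n k V (interior_weights n k w0))"
    and x: "x \<in> space (\<Pi>\<^sub>M i\<in>{1..n}. borel)" "(\<Sum>i\<in>{1..n}. \<bar>x i\<bar>) \<le> (real n)\<^sup>2"
  shows "ennreal (exp (- (1 + L)) / 2 * measure (K n) {k} * u * v * lik n k w0 \<theta>0 x)
    \<le> (\<integral>\<^sup>+\<nu>. joint_density n \<nu> x \<partial>mixing_prior L (K n) T V)"
proof -
  have k: "k \<ge> 1" using weight_simplex_pos[OF w0] .
  have n1: "n \<ge> 1" using n by simp
  interpret K: prob_space "K n" by (rule prior_family_components[OF prior n1])
  interpret T: prob_space "T k" by (rule prior_family_atoms[OF prior k])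
  interpret V: prob_space "V k" by (rule prior_family_weights[OF prior k])
  define BT where "BT = (atom_ball n k T \<theta>0)"
  define BV where "BV = (weight_ball n k V (interior_weights n k w0))"
  \<comment> \<open>A set of positive measure is measurable, because \<open>measure\<close> vanishes
    off the \<sigma>-algebra.\<close>
  have BT: "BT \<in> sets (T k)" using u measure_notin_sets[of BT "T k"] by (force simp: BT_def)
  have BV: "BV \<in> sets (V k)" using v measure_notin_sets[of BV "V k"] by (force simp: BV_def)
  let ?c = "exp (- (1 + L)) / 2 * lik n k w0 \<theta>0 x"
  have c0: "0 \<le> ?c" by (intro mult_nonneg_nonneg less_imp_le[OF prod_gmix_pos[OF w0]]) simp
  have pt: "ennreal ?c \<le> joint_density n (mixing k w \<theta>) x" if "\<theta> \<in> BT" "w \<in> BV" for \<theta> w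
  proof -
    have w: "w \<in> weight_simplex k" and \<theta>: "\<theta> \<in> atom_cube L k"
      using that prior_family_atoms(3)[OF prior k] prior_family_weights(3)[OF prior k]
      by (auto simp: BT_def BV_def)
    have "\<bar>\<theta> j - \<theta>0 j\<bar> \<le> 1 / real n ^ 3" if j: "j \<in> {1..k}" for j
    proof -
      have "\<bar>\<theta> j - \<theta>0 j\<bar> \<le> (MAX j\<in>{1..k}. \<bar>\<theta> j - \<theta>0 j\<bar>)" using j by (intro Max_ge) auto
      then show ?thesis using \<open>\<theta> \<in> BT\<close> by (simp add: BT_def)
    qed
    then have "?c \<le> lik n k w \<theta> x"
      using \<open>w \<in> BV\<close> n \<open>L > 0\<close> x(2) by (intro prod_gmix_ge[OF w w0 _ \<theta> \<theta>0]) (auto simp: BV_def)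
    then show ?thesis
      unfolding joint_density_mixing[OF w] by (rule ennreal_leI)
  qed
  have "ennreal (?c * (u * v)) \<le> ennreal ?c * (emeasure (T k) BT * emeasure (V k) BV)"
    unfolding T.emeasure_eq_measure V.emeasure_eq_measure
    using c0 u v by (simp add: ennreal_mult[symmetric] BT_def[symmetric] BV_def[symmetric] mult_mono mult_left_mono ennreal_leI)
  also have "\<dots> = (\<integral>\<^sup>+p. ennreal ?c * indicator (BT \<times> BV) p \<partial>(T k \<Otimes>\<^sub>M V k))"
    using BT BV by (simp add: nn_integral_cmult_indicator V.emeasure_pair_measure_Times)
  also have "\<dots> \<le> (\<integral>\<^sup>+p. joint_density n (mixing k (snd p) (fst p)) x \<partial>(T k \<Otimes>\<^sub>M V k))"
    using pt by (intro nn_integral_mono) (auto simp: indicator_def)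
  also have "\<dots> = (\<integral>\<^sup>+\<nu>. joint_density n \<nu> x \<partial>component_prior L T V k)"
    by (rule nn_integral_component_prior[OF prior k measurable_joint_density1[OF x(1)], symmetric])
  finally have I: "ennreal (?c * (u * v)) \<le> (\<integral>\<^sup>+\<nu>. joint_density n \<nu> x \<partial>component_prior L T V k)" .
  have "ennreal (?c * (u * v)) * ennreal (measure (K n) {k})
      \<le> (\<integral>\<^sup>+\<nu>. joint_density n \<nu> x \<partial>component_prior L T V k) * emeasure (K n) {k}"
    unfolding K.emeasure_eq_measure by (rule mult_right_mono[OF I]) simp
  also have "\<dots> = (\<integral>\<^sup>+l. (\<integral>\<^sup>+\<nu>. joint_density n \<nu> x \<partial>component_prior L T V k) * indicator {k} l \<partial>K n)"
    using k prior_family_components(2)[OF prior n1] by (subst nn_integral_cmult_indicator) auto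
  also have "\<dots> \<le> (\<integral>\<^sup>+l. (\<integral>\<^sup>+\<nu>. joint_density n \<nu> x \<partial>component_prior L T V l) \<partial>K n)"
    by (intro nn_integral_mono) (auto simp: indicator_def)
  also have "\<dots> = (\<integral>\<^sup>+\<nu>. joint_density n \<nu> x \<partial>mixing_prior L (K n) T V)"
    by (rule nn_integral_mixing_prior[OF prior n1 measurable_joint_density1[OF x(1)], symmetric])
  finally show ?thesis
    using c0 u v by (simp add: ennreal_mult[symmetric] mult_ac)
qed

text \<open>The true density is positive everywhere, so dividing by it loses no mass and each ratio
  has mean exactly one; Tonelli's theorem then averages over the prior. No test is involved.\<close>

lemma expected_overfitted_ratio:
  fixes \<theta>0 :: "nat \<Rightarrow> real"
  assumes prior: "prior_family L K T V" and n: "n \<ge> 1"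
    and w0: "w0 \<in> weight_simplex k" and A: "A \<subseteq> {1..}"
  defines "S \<equiv> sample_law n (mixing k w0 \<theta>0)"
  defines "N \<equiv> \<lambda>x. \<integral>\<^sup>+l. indicator A l * (\<integral>\<^sup>+\<nu>. joint_density n \<nu> x \<partial>component_prior L T V l) \<partial>K n"
  shows "N \<in> borel_measurable S"
    and "(\<integral>\<^sup>+x. N x * ennreal (1 / lik n k w0 \<theta>0 x) \<partial>S) = emeasure (K n) A"
proof -
  let ?I = "\<lambda>x l. \<integral>\<^sup>+\<nu>. joint_density n \<nu> x \<partial>component_prior L T V l"
  interpret K: prob_space "K n" by (rule prior_family_components[OF prior n])
  interpret S: prob_space S unfolding S_def by (rule prob_space_sample_law[OF w0])
  interpret SK: pair_sigma_finite S "K n" ..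
  have [measurable_cong]: "sets S = sets (\<Pi>\<^sub>M i\<in>{1..n}. borel)" unfolding S_def by (rule sets_sample_law)
  have spS: "space S = space (\<Pi>\<^sub>M i\<in>{1..n}. (borel :: real measure))" by (rule sets_eq_imp_space_eq) fact
  have AK: "A \<in> sets (K n)" using A prior_family_components(2)[OF prior n] by simp
  define J where "J x = ennreal (1 / lik n k w0 \<theta>0 x)" for x
  have J[measurable]: "J \<in> borel_measurable S" unfolding J_def[abs_def] by measurable
  have jd[measurable]: "(\<lambda>(\<nu>, x). joint_density n \<nu> x) \<in> borel_measurable (mixing_space L \<Otimes>\<^sub>M S)"
  proof -
    have eq: "sets (mixing_space L \<Otimes>\<^sub>M S) = sets (mixing_space L \<Otimes>\<^sub>M (\<Pi>\<^sub>M i\<in>{1..n}. (borel :: real measure)))"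
      by (rule sets_pair_measure_cong) (simp_all add: S_def sets_sample_law)
    show ?thesis unfolding measurable_cong_sets[OF eq refl] by (rule measurable_joint_density)
  qed
  have jdJ: "(\<lambda>p. joint_density n (fst p) (snd p) * J (snd p)) \<in> borel_measurable (mixing_space L \<Otimes>\<^sub>M S)"
    using jd unfolding case_prod_beta by measurable
  note measurable_component_prior[OF prior n, measurable]
  have I[measurable]: "(\<lambda>p. \<integral>\<^sup>+\<nu>. joint_density n \<nu> (fst p) \<partial>component_prior L T V (snd p)) \<in> borel_measurable (S \<Otimes>\<^sub>M K n)"
  proof (rule nn_integral_measurable_subprob_algebra2[where N = "mixing_space L"])
    show "(\<lambda>(p, \<nu>). joint_density n \<nu> (fst p)) \<in> borel_measurable ((S \<Otimes>\<^sub>M K n) \<Otimes>\<^sub>M mixing_space L)"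
      using measurable_compose[OF _ jd, of "\<lambda>q. (snd q, fst (fst q))" "(S \<Otimes>\<^sub>M K n) \<Otimes>\<^sub>M mixing_space L"]
      by (simp add: case_prod_beta)
  qed measurable
  have F: "(\<lambda>p. indicator A (snd p) * (\<integral>\<^sup>+\<nu>. joint_density n \<nu> (fst p) \<partial>component_prior L T V (snd p)) * J (fst p)) \<in> borel_measurable (S \<Otimes>\<^sub>M K n)"
    using AK by measurable
  have G: "(\<lambda>p. indicator A (snd p) * (\<integral>\<^sup>+\<nu>. joint_density n \<nu> (fst p) \<partial>component_prior L T V (snd p))) \<in> borel_measurable (S \<Otimes>\<^sub>M K n)"
    using AK by measurable
  show "N \<in> borel_measurable S"
    unfolding N_def using K.borel_measurable_nn_integral_fst[OF G] by simp
  have one: "(\<integral>\<^sup>+x. ?I x l * J x \<partial>S) = 1" if l: "l \<ge> 1" for l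
  proof -
    interpret R: prob_space "component_prior L T V l" by (rule prob_space_component_prior[OF prior l])
    interpret RS: pair_sigma_finite "component_prior L T V l" S ..
    have "(\<integral>\<^sup>+x. ?I x l * J x \<partial>S)
        = (\<integral>\<^sup>+x. (\<integral>\<^sup>+\<nu>. joint_density n \<nu> x * J x \<partial>component_prior L T V l) \<partial>S)"
    proof (rule nn_integral_cong)
      fix x assume "x \<in> space S"
      then have "(\<lambda>\<nu>. joint_density n \<nu> x) \<in> borel_measurable (component_prior L T V l)"
        unfolding measurable_cong_sets[OF sets_component_prior refl] spS by (rule measurable_joint_density1)
      then show "?I x l * J x
          = (\<integral>\<^sup>+\<nu>. joint_density n \<nu> x * J x \<partial>component_prior L T V l)"
        by (simp add: nn_integral_multc)
    qed
    also have "\<dots> = (\<integral>\<^sup>+\<nu>. (\<integral>\<^sup>+x. joint_density n \<nu> x * J x \<partial>S) \<partial>component_prior L T V l)"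
    proof (rule RS.Fubini')
      have eq: "sets (component_prior L T V l \<Otimes>\<^sub>M S) = sets (mixing_space L \<Otimes>\<^sub>M S)"
        by (rule sets_pair_measure_cong) (simp_all add: sets_component_prior)
      show "(\<lambda>(\<nu>, x). joint_density n \<nu> x * J x) \<in> borel_measurable (component_prior L T V l \<Otimes>\<^sub>M S)"
        unfolding measurable_cong_sets[OF eq refl] using jdJ by (simp add: case_prod_beta)
    qed
    also have "\<dots> = (\<integral>\<^sup>+p. (\<integral>\<^sup>+x. joint_density n (mixing l (snd p) (fst p)) x * J x \<partial>S) \<partial>(T l \<Otimes>\<^sub>M V l))"
    proof (rule nn_integral_component_prior[OF prior l])
      from S.borel_measurable_nn_integral_fst[OF jdJ]
      show "(\<lambda>\<nu>. \<integral>\<^sup>+x. joint_density n \<nu> x * J x \<partial>S) \<in> borel_measurable (mixing_space L)" by simp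
    qed
    also have "\<dots> = (\<integral>\<^sup>+p. 1 \<partial>(T l \<Otimes>\<^sub>M V l))"
    proof (rule nn_integral_cong)
      fix p assume "p \<in> space (T l \<Otimes>\<^sub>M V l)"
      then have "snd p \<in> space (V l)" by (simp add: space_pair_measure mem_Times_iff)
      then have w: "snd p \<in> weight_simplex l" by (simp only: prior_family_weights(3)[OF prior l])
      have "joint_density n (mixing l (snd p) (fst p)) x * J x
          = (\<Prod>i\<in>{1..n}. ennreal (gmix l (snd p) (fst p) (x i) / gmix k w0 \<theta>0 (x i)))" for x
      proof -
        have "(\<Prod>i\<in>{1..n}. ennreal (gmix l (snd p) (fst p) (x i) / gmix k w0 \<theta>0 (x i)))
            = ennreal (\<Prod>i\<in>{1..n}. gmix l (snd p) (fst p) (x i) / gmix k w0 \<theta>0 (x i))"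
          using gmix_pos[OF w] gmix_pos[OF w0] by (intro prod_ennreal) (simp add: less_imp_le)
        also have "\<dots> = ennreal (lik n l (snd p) (fst p) x * (1 / lik n k w0 \<theta>0 x))"
          by (simp add: prod_dividef)
        also have "\<dots> = joint_density n (mixing l (snd p) (fst p)) x * J x"
          unfolding J_def joint_density_mixing[OF w]
          by (intro ennreal_mult less_imp_le[OF prod_gmix_pos[OF w]])
             (use less_imp_le[OF prod_gmix_pos[OF w0]] in simp)
        finally show ?thesis ..
      qed
      then show "(\<integral>\<^sup>+x. joint_density n (mixing l (snd p) (fst p)) x * J x \<partial>S) = 1"
        unfolding S_def by (simp add: nn_integral_likelihood_ratio[OF w0 w])
    qed
    also have "\<dots> = 1"
    proof -
      interpret T: prob_space "T l" by (rule prior_family_atoms[OF prior l])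
      interpret V: prob_space "V l" by (rule prior_family_weights[OF prior l])
      interpret TV: pair_prob_space "T l" "V l" ..
      show ?thesis by (simp add: TV.emeasure_space_1)
    qed
    finally show ?thesis .
  qed
  have "(\<integral>\<^sup>+x. N x * J x \<partial>S)
      = (\<integral>\<^sup>+x. (\<integral>\<^sup>+l. indicator A l * ?I x l * J x \<partial>K n) \<partial>S)"
    unfolding N_def
  proof (intro nn_integral_cong nn_integral_multc[symmetric])
    have s: "sets (K n) = sets (count_space {1..})" using prior_family_components(2)[OF prior n] by simp
    show "(\<lambda>l. indicator A l * ?I x l) \<in> borel_measurable (K n)" for x
      by (subst measurable_cong_sets[OF s refl]) simp
  qed
  also have "\<dots> = (\<integral>\<^sup>+l. (\<integral>\<^sup>+x. indicator A l * ?I x l * J x \<partial>S) \<partial>K n)"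
    using F by (intro SK.Fubini'[symmetric]) (simp add: case_prod_beta)
  also have "\<dots> = (\<integral>\<^sup>+l. indicator A l \<partial>K n)"
  proof (rule nn_integral_cong)
    fix l assume "l \<in> space (K n)"
    then have "l \<ge> 1" using prior_family_components(3)[OF prior n] by simp
    then show "(\<integral>\<^sup>+x. indicator A l * ?I x l * J x \<partial>S) = indicator A l"
      using one by (auto simp: indicator_def)
  qed
  also have "\<dots> = emeasure (K n) A" using AK by simp
  finally show "(\<integral>\<^sup>+x. N x * ennreal (1 / lik n k w0 \<theta>0 x) \<partial>S) = emeasure (K n) A"
    by (simp add: J_def)
qed

text \<open>The four terms stand for: a sample with large absolute sum; an envelope of some cell of
  the net exceeding exp (-t) times the true likelihood; distributions with at most \<open>k\<close>
  components, off these events; distributions with more components. The threshold \<open>t\<close>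
  trades the second term against the third.\<close>

lemma posterior_expectation_le:
  assumes prior: "prior_family L K T V" and n: "n \<ge> 2" "k \<le> n" and "L > 0"
    and w0: "w0 \<in> weight_simplex k" and \<theta>0: "\<theta>0 \<in> atom_cube L k"
    and \<kappa>: "0 < \<kappa>" "\<kappa> \<le> measure (K n) {k}"
    and \<rho>: "0 \<le> \<rho>" "measure (K n) {k<..} \<le> \<rho> * measure (K n) {k}"
    and u: "0 < u" "u \<le> measure (T k) (atom_ball n k T \<theta>0)"
    and v: "0 < v" "v \<le> measure (V k) (weight_ball n k V (interior_weights n k w0))"
    and sep: "\<And>w \<theta>. w \<in> weight_simplex k \<Longrightarrow> \<theta> \<in> atom_cube L k \<Longrightarrow>
        r \<le> W1 (mixing k w \<theta>) (mixing k w0 \<theta>0) \<Longrightarrow>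
        \<Lambda> \<le> real n * (1 - affinity (gmix k w \<theta>) (gmix k w0 \<theta>0))"
  shows "(\<integral>\<^sup>+x. emeasure (posterior (mixing_prior L (K n) T V) n x)
        {\<nu> \<in> all_mixing_dists L. r \<le> W1 \<nu> (mixing k w0 \<theta>0)} \<partial>sample_law n (mixing k w0 \<theta>0))
    \<le> ennreal (2 * exp (L + 1 / 2) / real n
        + ((2 * L * real n ^ 3 + 2) * (real n ^ 3 + 1)) ^ k * exp (t / 2 + 1 - \<Lambda>)
        + 2 * exp (2 * (1 + L) - t) / (\<kappa> * u * v) + 2 * exp (1 + L) * \<rho> / (u * v))"
proof -
  let ?I = "\<lambda>x l. \<integral>\<^sup>+\<nu>. joint_density n \<nu> x \<partial>component_prior L T V l"
  let ?tail = "2 * exp (L + 1 / 2) / real n" and ?net = "((2 * L * real n ^ 3 + 2) * (real n ^ 3 + 1)) ^ k * exp (t / 2 + 1 - \<Lambda>)"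
  have k: "k \<ge> 1" using weight_simplex_pos[OF w0] .
  have n1: "n \<ge> 1" using n by simp
  define S where "S = sample_law n (mixing k w0 \<theta>0)"
  define U where "U = {\<nu> \<in> all_mixing_dists L. r \<le> W1 \<nu> (mixing k w0 \<theta>0)}"
  let ?IU = "\<lambda>x l. \<integral>\<^sup>+\<nu>. joint_density n \<nu> x * indicator U \<nu> \<partial>component_prior L T V l"
  let ?post = "\<lambda>x. emeasure (posterior (mixing_prior L (K n) T V) n x) U"
  define J where "J x = lik n k w0 \<theta>0 x" for x
  define N where "N x = (\<integral>\<^sup>+l. indicator {k<..} l * ?I x l \<partial>K n)" for x
  define \<eta> where "\<eta> = 1 / real n ^ 3"
  define D where "D = exp (- (1 + L)) / 2 * measure (K n) {k} * u * v"
  define b where "b = exp (1 + L - t)"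
  interpret K: prob_space "K n" by (rule prior_family_components[OF prior n1])
  interpret S: prob_space S unfolding S_def by (rule prob_space_sample_law[OF w0])
  have setsS [measurable_cong]: "sets S = sets (\<Pi>\<^sub>M i\<in>{1..n}. borel)" unfolding S_def by (rule sets_sample_law)
  have spS: "space S = space (\<Pi>\<^sub>M i\<in>{1..n}. (borel :: real measure))" by (rule sets_eq_imp_space_eq) fact
  have setsK: "sets (K n) = sets (count_space {1..})" using prior_family_components(2)[OF prior n1] by simp
  have \<eta>0: "0 < \<eta>" using n1 by (simp add: \<eta>_def)
  have J0: "0 < J x" for x unfolding J_def by (rule prod_gmix_pos[OF w0])
  have D0: "0 < D" using \<kappa> u v by (simp add: D_def)
  define Z where "Z = {(w, \<theta>). w \<in> weight_simplex k \<and> \<theta> \<in> atom_cube L k \<and> r \<le> W1 (mixing k w \<theta>) (mixing k w0 \<theta>0)}"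
  have "Z \<subseteq> weight_simplex k \<times> atom_cube L k" by (auto simp: Z_def)
  then obtain C where C: "C \<subseteq> Z" "finite C" "real (card C) \<le> ((2 * L / \<eta> + 2) * (1 / \<eta> + 1)) ^ k"
    "\<And>w \<theta>. (w, \<theta>) \<in> Z \<Longrightarrow> \<exists>(v, \<phi>)\<in>C. \<forall>j\<in>{1..k}. \<bar>w j - v j\<bar> \<le> \<eta> \<and> \<bar>\<theta> j - \<phi> j\<bar> \<le> \<eta>"
    using finite_net[OF _ \<eta>0 \<open>L > 0\<close>] by blast
  \<comment> \<open>The upper envelope, up to the factor \<open>exp (1 + L)\<close>, of the
    likelihoods in the cell of \<open>c\<close>: raising all weights by \<eta> yields the domination
    required by \<open>prod_gmix_shift_le\<close>.\<close>
  define Q where "Q c x = lik n k (\<lambda>j. fst c j + \<eta>) (snd c) x" for c :: "(nat \<Rightarrow> real) \<times> (nat \<Rightarrow> real)" and x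
  define B0 where "B0 = {x \<in> space S. (real n)\<^sup>2 \<le> (\<Sum>i\<in>{1..n}. \<bar>x i\<bar>)}"
  define B where "B c = {x \<in> space S. exp (- t) * J x \<le> Q c x}" for c
  have B_sets: "B0 \<in> sets S" "B c \<in> sets S" for c
    unfolding B0_def B_def J_def Q_def by measurable
  have B0_le: "emeasure S B0 \<le> ennreal (?tail)"
    unfolding B0_def S_def by (rule sample_abs_sum_tail[OF w0 \<theta>0 n1])
  have B_le: "emeasure S (B c) \<le> ennreal (exp (t / 2 + 1 - \<Lambda>))" if cC: "c \<in> C" for c
  proof -
    obtain w \<theta> where c: "c = (w, \<theta>)" and w: "w \<in> weight_simplex k" and \<theta>: "\<theta> \<in> atom_cube L k"
      and "r \<le> W1 (mixing k w \<theta>) (mixing k w0 \<theta>0)"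
      using subsetD[OF C(1) cC] by (auto simp: Z_def)
    let ?A = "affinity (gmix k (\<lambda>j. w j + \<eta>) \<theta>) (gmix k w0 \<theta>0)"
    have w': "0 \<le> w j + \<eta>" if "j \<in> {1..k}" for j using weight_simplex_nonneg[OF w that] \<eta>0 by simp
    have A0: "0 \<le> ?A"
      using w' weight_simplex_nonneg[OF w0] by (intro affinity_nonneg gmix_nonneg) auto
    have "\<Lambda> / real n \<le> 1 - affinity (gmix k w \<theta>) (gmix k w0 \<theta>0)"
      using sep[OF w \<theta>] \<open>r \<le> _\<close> n1 by (simp add: field_simps)
    \<comment> \<open>The increase of the affinity due to the raised weights is at most 1/n, hence a
      factor \<open>exp 1\<close> over \<open>n\<close> observations: the \<open>1\<close> in the
      exponent of the second term.\<close>
    moreover have "sqrt (real k * \<eta>) \<le> 1 / real n"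
    proof (rule real_le_lsqrt)
      have "real k * \<eta> \<le> real n * \<eta>" using n \<eta>0 by simp
      also have "\<dots> = (1 / real n)\<^sup>2" using n1 by (simp add: \<eta>_def power2_eq_square power3_eq_cube)
      finally show "real k * \<eta> \<le> (1 / real n)\<^sup>2" .
    qed simp
    ultimately have "?A \<le> 1 + (- \<Lambda> / real n + 1 / real n)"
      using affinity_add_weights_le[OF w w0 less_imp_le[OF \<eta>0], of \<theta> \<theta>0] by simp
    also have "\<dots> \<le> exp (- \<Lambda> / real n + 1 / real n)" by (rule exp_ge_add_one_self)
    finally have "?A ^ n \<le> exp (- \<Lambda> / real n + 1 / real n) ^ n" using A0 by (rule power_mono)
    also have "\<dots> = exp (1 - \<Lambda>)"
      using n1 by (simp add: exp_of_nat_mult[symmetric] right_diff_distrib)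
    finally have "exp (t / 2) * ?A ^ n \<le> exp (t / 2) * exp (1 - \<Lambda>)" by simp
    also have "\<dots> = exp (t / 2 + 1 - \<Lambda>)" unfolding exp_add[symmetric] by (simp add: algebra_simps)
    finally have "ennreal (exp (t / 2) * ?A ^ n) \<le> ennreal (exp (t / 2 + 1 - \<Lambda>))" by (rule ennreal_leI)
    moreover have "emeasure S (B c) \<le> ennreal (exp (t / 2) * ?A ^ n)"
      unfolding B_def S_def J_def Q_def c fst_conv snd_conv by (rule likelihood_ratio_tail[OF w0 w'])
    ultimately show ?thesis by (rule order.trans[rotated])
  qed
  define Bad where "Bad = B0 \<union> (\<Union>c\<in>C. B c)"
  have UC: "(\<Union>c\<in>C. B c) \<in> sets S" using C(2) B_sets(2) by (intro sets.finite_UN)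
  have Bad_sets [measurable]: "Bad \<in> sets S" unfolding Bad_def using B_sets(1) UC by (rule sets.Un)
  have Bad_le: "emeasure S Bad \<le> ennreal (?tail
      + ?net)"
  proof -
    have "emeasure S Bad \<le> emeasure S B0 + emeasure S (\<Union>c\<in>C. B c)"
      unfolding Bad_def using B_sets(1) UC by (rule emeasure_subadditive)
    also have "emeasure S (\<Union>c\<in>C. B c) \<le> (\<Sum>c\<in>C. emeasure S (B c))"
      using C(2) B_sets(2) by (intro emeasure_subadditive_finite) blast+
    also have "\<dots> \<le> (\<Sum>c\<in>C. ennreal (exp (t / 2 + 1 - \<Lambda>)))" by (rule sum_mono[OF B_le])
    also have "\<dots> = ennreal (real (card C) * exp (t / 2 + 1 - \<Lambda>))"
      by (simp add: ennreal_mult ennreal_of_nat_eq_real_of_nat)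
    also have "\<dots> \<le> ennreal (?net)"
      using C(3) by (intro ennreal_leI mult_right_mono) (simp_all add: \<eta>_def)
    also have "emeasure S B0 + ennreal (?net)
        \<le> ennreal (?tail) + ennreal (?net)"
      using B0_le by (rule add_right_mono)
    also have "\<dots> = ennreal (?tail
      + ?net)"
      using \<open>L > 0\<close> by (intro ennreal_plus[symmetric]) auto
    finally show ?thesis by (simp only: add_left_mono)+
  qed
  have likelihood_le: "joint_density n (mixing l w \<theta>) x \<le> ennreal (b * J x)"
    if l: "1 \<le> l" "l \<le> k" and w: "w \<in> weight_simplex l" and \<theta>: "\<theta> \<in> atom_cube L l"
      and U: "mixing l w \<theta> \<in> U" and x: "x \<in> space S" "x \<notin> Bad" for l w \<theta> x
  proof -
    \<comment> \<open>Fewer components are padded to \<open>k\<close>, so that one net serves all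
      \<open>l \<le> k\<close>.\<close>
    have "mixing l w \<theta> \<in> mixing_dists L l" using w \<theta> by (auto simp: mixing_dists_def)
    then have "mixing l w \<theta> \<in> mixing_dists L k" using mixing_dists_mono[of l k L] l \<open>L > 0\<close> by auto
    then obtain w2 \<theta>2 where eq: "mixing l w \<theta> = mixing k w2 \<theta>2"
      and w2: "w2 \<in> weight_simplex k" and \<theta>2: "\<theta>2 \<in> atom_cube L k" by (auto simp: mixing_dists_def)
    have "(w2, \<theta>2) \<in> Z" using U w2 \<theta>2 unfolding eq by (simp add: U_def Z_def)
    then obtain w3 \<theta>3 where c: "(w3, \<theta>3) \<in> C"
      and close: "\<forall>j\<in>{1..k}. \<bar>w2 j - w3 j\<bar> \<le> \<eta> \<and> \<bar>\<theta>2 j - \<theta>3 j\<bar> \<le> \<eta>"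
      using C(4) by blast
    have "(w3, \<theta>3) \<in> Z" using c C(1) by blast
    then have \<theta>3: "\<theta>3 \<in> atom_cube L k" by (simp add: Z_def)
    have dom: "0 \<le> w2 j \<and> w2 j \<le> w3 j + \<eta>" if "j \<in> {1..k}" for j
      using close that weight_simplex_nonneg[OF w2 that] by (smt (verit))
    have "x \<notin> B0" "x \<notin> B (w3, \<theta>3)" using x c by (auto simp: Bad_def)
    then have xs: "(\<Sum>i\<in>{1..n}. \<bar>x i\<bar>) \<le> (real n)\<^sup>2" and Q: "Q (w3, \<theta>3) x \<le> exp (- t) * J x"
      using x(1) by (auto simp: B0_def B_def)
    have "lik n k w2 \<theta>2 x \<le> exp (1 + L) * lik n k (\<lambda>j. w3 j + \<eta>) \<theta>3 x"
      using close unfolding \<eta>_def[symmetric]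
      by (intro prod_gmix_shift_le[OF dom \<theta>2 \<theta>3 _ n1 \<open>L > 0\<close> xs]) (auto simp: \<eta>_def)
    also have "\<dots> \<le> exp (1 + L) * (exp (- t) * J x)"
      using Q by (intro mult_left_mono) (simp_all add: Q_def)
    also have "\<dots> = b * J x" by (simp add: b_def exp_add[symmetric] exp_diff exp_minus field_simps)
    finally show ?thesis unfolding eq joint_density_mixing[OF w2] by (rule ennreal_leI)
  qed
  define a where "a = b / D"
  \<comment> \<open>Off \<open>Bad\<close> the numerator is at most \<open>b * J x + N x\<close> and
    the evidence at least \<open>D * J x\<close>. The right-hand side is measurable in
    \<open>x\<close>, so it can be integrated term by term after a monotonicity step.\<close>
  have pointwise: "?post x
      \<le> indicator Bad x + (ennreal a + N x * ennreal (1 / J x) * ennreal (1 / D))" if x: "x \<in> space S" for x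
  proof (cases "x \<in> Bad")
    case True
    have "?post x \<le> 1"
      using x unfolding spS by (rule emeasure_posterior_le_1[OF prior n1])
    then show ?thesis using True by (simp add: add_increasing2)
  next
    case False
    let ?E = "\<integral>\<^sup>+\<nu>. joint_density n \<nu> x \<partial>mixing_prior L (K n) T V"
    have jd: "(\<lambda>\<nu>. joint_density n \<nu> x) \<in> borel_measurable (mixing_space L)"
      using x unfolding spS by (rule measurable_joint_density1)
    show ?thesis
    proof (cases "U \<in> sets (mixing_space L)")
      case U: False
      then have "U \<notin> sets (posterior (mixing_prior L (K n) T V) n x)"
        by (simp add: posterior_def sets_mixing_prior[OF prior n1])
      then show ?thesis by (simp add: emeasure_notin_sets)
    next
      case U: True
      have jdU: "(\<lambda>\<nu>. joint_density n \<nu> x * indicator U \<nu>) \<in> borel_measurable (mixing_space L)"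
        using jd U by (intro borel_measurable_times_ennreal borel_measurable_indicator)
      have "(\<integral>\<^sup>+l. ?IU x l \<partial>K n)
          \<le> (\<integral>\<^sup>+l. ennreal (b * J x) + indicator {k<..} l * ?I x l \<partial>K n)"
      proof (rule nn_integral_mono)
        fix l assume "l \<in> space (K n)"
        then have l: "1 \<le> l" using prior_family_components(3)[OF prior n1] by simp
        show "?IU x l
            \<le> ennreal (b * J x) + indicator {k<..} l * ?I x l"
        proof (cases "l \<le> k")
          case True
          have "?IU x l \<le> ennreal (b * J x)"
          proof (rule nn_integral_component_prior_le[OF prior l jdU])
            fix w \<theta> assume "w \<in> weight_simplex l" "\<theta> \<in> atom_cube L l"
            then show "joint_density n (mixing l w \<theta>) x * indicator U (mixing l w \<theta>) \<le> ennreal (b * J x)"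
              using likelihood_le[OF l True _ _ _ x False] by (cases "mixing l w \<theta> \<in> U") auto
          qed
          then show ?thesis by (rule add_increasing2[rotated]) simp
        next
          case False
          have "?IU x l
              \<le> ?I x l"
            by (intro nn_integral_mono) (auto simp: indicator_def)
          then show ?thesis using False by (simp add: add_increasing)
        qed
      qed
      also have "\<dots> = ennreal (b * J x) + N x"
        unfolding N_def
        by (subst nn_integral_add) (simp_all add: K.emeasure_space_1 measurable_cong_sets[OF setsK refl])
      finally have num: "(\<integral>\<^sup>+l. ?IU x l \<partial>K n)
          \<le> ennreal (b * J x) + N x" .
      have "(\<Sum>i\<in>{1..n}. \<bar>x i\<bar>) \<le> (real n)\<^sup>2" using False x by (auto simp: Bad_def B0_def)
      then have E: "ennreal (D * J x) \<le> ?E"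
        unfolding D_def J_def using x unfolding spS
        by (intro evidence_ge[OF prior n \<open>L > 0\<close> w0 \<theta>0 u v])
      have "?post x
          \<le> (\<integral>\<^sup>+l. ?IU x l \<partial>K n) / ?E"
        using x unfolding spS by (rule emeasure_posterior[OF prior n1])
      also have "\<dots> \<le> ennreal a + N x * ennreal (1 / J x) * ennreal (1 / D)"
      proof (rule divide_le_posI_ennreal)
        show "0 < ?E" using E D0 J0[of x] by (intro less_le_trans[OF _ E]) simp
        have one: "ennreal (D * J x) * ennreal a = ennreal (b * J x)"
          using D0 J0[of x] by (simp add: a_def b_def ennreal_mult[symmetric])
        have "ennreal (D * J x) * (ennreal (1 / J x) * ennreal (1 / D)) = 1"
          using D0 J0[of x] by (simp add: ennreal_mult[symmetric])
        then have two: "ennreal (D * J x) * (N x * ennreal (1 / J x) * ennreal (1 / D)) = N x"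
          by (metis mult.assoc mult.commute mult.right_neutral)
        note num
        also have "ennreal (b * J x) + N x = ennreal (D * J x) * (ennreal a + N x * ennreal (1 / J x) * ennreal (1 / D))"
          unfolding distrib_left one two ..
        also have "\<dots> \<le> ?E * (ennreal a + N x * ennreal (1 / J x) * ennreal (1 / D))"
          by (rule mult_right_mono[OF E]) simp
        finally show "(\<integral>\<^sup>+l. ?IU x l \<partial>K n)
            \<le> ?E * (ennreal a + N x * ennreal (1 / J x) * ennreal (1 / D))" .
      qed
      finally show ?thesis using False by simp
    qed
  qed
  have N_meas [measurable]: "N \<in> borel_measurable S"
    unfolding N_def[abs_def] S_def by (rule expected_overfitted_ratio(1)[OF prior n1 w0]) auto
  have [measurable]: "(\<lambda>x. ennreal (1 / J x)) \<in> borel_measurable S" unfolding J_def by measurable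
  have N_int: "(\<integral>\<^sup>+x. N x * ennreal (1 / J x) \<partial>S) = emeasure (K n) {k<..}"
    unfolding N_def J_def S_def by (rule expected_overfitted_ratio(2)[OF prior n1 w0]) auto
  have "(\<integral>\<^sup>+x. ?post x \<partial>S)
      \<le> (\<integral>\<^sup>+x. indicator Bad x + (ennreal a + N x * ennreal (1 / J x) * ennreal (1 / D)) \<partial>S)"
    by (rule nn_integral_mono[OF pointwise])
  also have "\<dots> = emeasure S Bad + (ennreal a + emeasure (K n) {k<..} * ennreal (1 / D))"
    by (simp add: nn_integral_add nn_integral_multc S.emeasure_space_1 N_int)
  also have "\<dots> \<le> ennreal (?tail
      + ?net)
      + (ennreal (2 * exp (2 * (1 + L) - t) / (\<kappa> * u * v)) + ennreal (2 * exp (1 + L) * \<rho> / (u * v)))"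
  proof (intro add_mono Bad_le)
    have e: "exp (1 + L) * exp (- (1 + L)) = 1" by (simp add: exp_add[symmetric])
    \<comment> \<open>One factor \<open>exp (1 + L)\<close> stems from rounding to the net, the
      other from the lower bound on the evidence.\<close>
    have "b / D = 2 * (exp (1 + L - t) * exp (1 + L)) / (measure (K n) {k} * u * v * (exp (1 + L) * exp (- (1 + L))))"
      unfolding b_def D_def by (simp add: mult_ac)
    also have "\<dots> = 2 * exp (2 * (1 + L) - t) / (measure (K n) {k} * u * v)"
      unfolding e exp_add[symmetric] by (simp add: algebra_simps)
    also have "\<dots> \<le> 2 * exp (2 * (1 + L) - t) / (\<kappa> * u * v)"
      using \<kappa> u v by (intro divide_left_mono mult_right_mono mult_pos_pos) auto
    finally show "ennreal a \<le> ennreal (2 * exp (2 * (1 + L) - t) / (\<kappa> * u * v))"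
      unfolding a_def by (rule ennreal_leI)
    \<comment> \<open>The prior mass of \<open>k\<close> inside \<open>D\<close> cancels:
      overfitting is controlled by the ratio \<rho> alone, whereas the third term has to pay for the
      mass itself.\<close>
    have "measure (K n) {k<..} * (1 / D) \<le> \<rho> * measure (K n) {k} * (1 / D)"
      using \<rho> D0 by (intro mult_right_mono) auto
    also have "\<dots> = \<rho> * 2 * exp (1 + L) * measure (K n) {k} / (measure (K n) {k} * u * v * (exp (1 + L) * exp (- (1 + L))))"
      unfolding D_def by (simp add: mult_ac)
    also have "\<dots> = 2 * exp (1 + L) * \<rho> / (u * v)"
      unfolding e using \<kappa> by simp
    finally have "ennreal (measure (K n) {k<..} * (1 / D)) \<le> ennreal (2 * exp (1 + L) * \<rho> / (u * v))"
      by (rule ennreal_leI)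
    then show "emeasure (K n) {k<..} * ennreal (1 / D) \<le> ennreal (2 * exp (1 + L) * \<rho> / (u * v))"
      using D0 by (simp add: K.emeasure_eq_measure ennreal_mult[symmetric])
  qed
  also have "\<dots> = ennreal (?tail
        + ?net
        + 2 * exp (2 * (1 + L) - t) / (\<kappa> * u * v) + 2 * exp (1 + L) * \<rho> / (u * v))"
    using \<kappa> u v \<rho> \<open>L > 0\<close> by (simp add: ennreal_plus[symmetric] add.assoc del: ennreal_plus)
  finally show ?thesis by (simp add: S_def U_def)
qed

text \<open>Iterating the ratio gives a geometric series with sum x / (1 - x), and x \<le> 1/2
  bounds 1 / (1 - x) by 2.\<close>

lemma geometric_tail_le:
  assumes "prob_space M" "sets M = Pow {1..}" "k \<ge> 1" "0 \<le> x" "x \<le> 1 / 2"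
    and ratio: "\<And>j. j \<ge> 1 \<Longrightarrow> measure M {j + 1} \<le> x * measure M {j}"
  shows "measure M {k<..} \<le> 2 * x * measure M {k :: nat}"
proof -
  interpret prob_space M by fact
  have le: "measure M {k + m} \<le> x ^ m * measure M {k}" for m
  proof (induction m)
    case (Suc m)
    have "measure M {Suc (k + m)} \<le> x * measure M {k + m}"
      using ratio[of "k + m", unfolded Suc_eq_plus1[symmetric]] \<open>k \<ge> 1\<close> by simp
    also have "\<dots> \<le> x * (x ^ m * measure M {k})" using Suc \<open>0 \<le> x\<close> by (intro mult_left_mono)
    finally show ?case by (simp add: mult_ac)
  qed simp
  have "(\<lambda>m. measure M {k + Suc m}) sums measure M (\<Union>m. {k + Suc m})"
    using assms(2) \<open>k \<ge> 1\<close> by (intro finite_measure_UNION) (auto simp: disjoint_family_on_def)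
  also have "(\<Union>m. {k + Suc m}) = {k<..}"
    by (auto simp: image_iff intro: less_imp_Suc_add[THEN exE])
  finally have s: "(\<lambda>m. measure M {k + Suc m}) sums measure M {k<..}" .
  have "(\<lambda>m. x * measure M {k} * x ^ m) sums (x * measure M {k} * (1 / (1 - x)))"
    using assms(4,5) by (intro sums_mult geometric_sums) auto
  then have "measure M {k<..} \<le> x * measure M {k} * (1 / (1 - x))"
    using le[of "Suc _"] by (intro sums_le[OF _ s]) (simp_all add: mult_ac)
  also have "\<dots> \<le> x * measure M {k} * 2"
    using assms(4,5) by (intro mult_left_mono) (auto simp: field_simps)
  finally show ?thesis by simp
qed

section \<open>Contraction\<close>

lemma prior_ball_atoms:
  assumes "prior_P3 L c6 c7 T" "\<theta>0 \<in> atom_cube L k" "1 \<le> k" "k \<le> n" "2 \<le> n"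
  shows "c6 * exp (- (3 * c7 * real k * ln (real n)))
    \<le> measure (T k) (atom_ball n k T \<theta>0)"
  and prior_ball_weights: "\<lbrakk>prior_P2 c4 c5 V; w0 \<in> weight_simplex k\<rbrakk> \<Longrightarrow> c4 * exp (- (3 * c5 * real k * ln (real n)))
    \<le> measure (V k) (weight_ball n k V w0)"
proof -
  \<comment> \<open>The radius n^-3 has to be smaller than 1/k, the range in which (P2) and (P3)
    speak.\<close>
  have "real n < real n ^ 3" using power_strict_increasing[of 1 3 "real n"] assms by simp
  moreover have "real k \<le> real n" using assms by simp
  ultimately have "real k < real n ^ 3" by linarith
  then have \<eta>: "1 / real n ^ 3 \<in> {0<..<1 / real k}"
    using assms by (auto intro!: divide_strict_left_mono)
  have pow: "(1 / real n ^ 3) powr (c * real k) = exp (- (3 * c * real k * ln (real n)))" for c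
    using assms by (simp add: powr_def ln_div ln_realpow algebra_simps)
  show "c6 * exp (- (3 * c7 * real k * ln (real n)))
    \<le> measure (T k) (atom_ball n k T \<theta>0)"
    using assms \<eta> unfolding prior_P3_def pow[symmetric] by blast
  show "c4 * exp (- (3 * c5 * real k * ln (real n)))
    \<le> measure (V k) (weight_ball n k V w0)"
    if "prior_P2 c4 c5 V" "w0 \<in> weight_simplex k"
    using that assms \<eta> unfolding prior_P2_def pow[symmetric] by blast
qed

text \<open>With a threshold of order k log^2 n every term of
  \<open>posterior_expectation_le\<close> becomes a constant over n. Balls of radius n^-3 make 1/(u
  v) of order exp (3 (c5 + c7) k log n), whence the lower bound on \<open>A\<close>; its summand 1
  leaves the factor 1/n.\<close>

lemma posterior_expectation_le_inverse:
  fixes L c1 c2 c3 c4 c5 c6 c7 A C :: real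
  assumes pos: "L > 0" "c1 > 0" "c2 > 0" "c3 > 0" "c4 > 0" "c5 > 0" "c6 > 0" "c7 > 0"
    and A: "3 * (c5 + c7) + 1 \<le> A"
    and prior: "prior_family L K T V" "prior_P1 kbar A c1 c2 c3 K" "prior_P2 c4 c5 V" "prior_P3 L c6 c7 T"
    and n: "27 \<le> n" "4 * L + 4 \<le> real n" "2 * c1 \<le> real n" "C * ln (real n) \<le> real n"
    and kbar: "k \<le> kbar n" "real (kbar n) \<le> C * (ln (real n) / ln (ln (real n)))"
    and w0: "w0 \<in> weight_simplex k" and \<theta>0: "\<theta>0 \<in> atom_cube L k"
    and sep: "\<And>w \<theta>. w \<in> weight_simplex k \<Longrightarrow> \<theta> \<in> atom_cube L k \<Longrightarrow>
        r \<le> W1 (mixing k w \<theta>) (mixing k w0 \<theta>0) \<Longrightarrow>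
        ((3 * (c5 + c7) + c3 * C + 1) / 2 + 8) * real k * (ln (real n))\<^sup>2
          \<le> real n * (1 - affinity (gmix k w \<theta>) (gmix k w0 \<theta>0))"
  shows "(\<integral>\<^sup>+x. emeasure (posterior (mixing_prior L (K n) T V) n x)
        {\<nu> \<in> all_mixing_dists L. r \<le> W1 \<nu> (mixing k w0 \<theta>0)} \<partial>sample_law n (mixing k w0 \<theta>0))
    \<le> ennreal ((2 * exp (L + 1 / 2) + exp 1 + 2 * exp (2 * (1 + L)) / (c2 * c6 * c4)
        + 4 * c1 * exp (1 + L) / (c6 * c4)) / real n)"
proof -
  define l where "l = ln (real n)"
  \<comment> \<open>The three summands pay for the prior balls, for the prior mass of
    \<open>k\<close> (with kbar \<le> C log n) and for the final 1/n. In the separation constant,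
    half of \<open>T0\<close> is the cost exp (t/2) of Markov's inequality, and 8 = 7 + 1 pays for
    the net and for 1/n.\<close>
  define T0 where "T0 = 3 * (c5 + c7) + c3 * C + 1"
  have k: "1 \<le> k" using weight_simplex_pos[OF w0] .
  have n1: "1 \<le> n" "2 \<le> n" using n by auto
  \<comment> \<open>Origin of the number 27: log n \<ge> 3 \<ge> e, so that log log n \<ge>
    1.\<close>
  have l3: "3 \<le> l"
  proof -
    have "exp (3::real) = exp 1 ^ 3" by (simp add: exp_of_nat_mult[symmetric])
    also have "\<dots> \<le> 3 ^ 3" using exp_le by (intro power_mono) auto
    also have "\<dots> \<le> real n" using n by simp
    finally show ?thesis using n by (simp add: l_def ln_ge_iff)
  qed
  have lnl: "1 \<le> ln l" using l3 exp_le by (simp add: ln_ge_iff)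
  have expl: "exp (- l) = 1 / real n" using n by (simp add: l_def exp_minus inverse_eq_divide)
  have C0: "0 \<le> C"
  proof (rule ccontr)
    assume "\<not> 0 \<le> C"
    then have "C * (l / ln l) < 0" using l3 lnl by (intro mult_neg_pos) auto
    then show False using kbar(2) by (simp add: l_def)
  qed
  have kb: "real (kbar n) \<le> C * l"
  proof -
    have "l / ln l \<le> l / 1" using lnl l3 by (intro divide_left_mono) auto
    then have "C * (l / ln l) \<le> C * l" using C0 by (intro mult_left_mono) auto
    then show ?thesis using kbar(2) by (simp add: l_def)
  qed
  have kbk: "real k \<le> real (kbar n)" "1 \<le> real (kbar n)" using kbar(1) k by auto
  have "real k \<le> real n" using kbk(1) kb n(4) unfolding l_def by linarith
  then have kn: "k \<le> n" by simp
  have l2: "l \<le> l\<^sup>2" using l3 by (simp add: self_le_power)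
  have kl2: "real k * l \<le> real k * l\<^sup>2" "l \<le> real k * l\<^sup>2"
  proof -
    show "real k * l \<le> real k * l\<^sup>2" using l2 by (rule mult_left_mono) simp
    have "1 * l \<le> real k * l\<^sup>2" using l2 l3 k by (intro mult_mono) auto
    then show "l \<le> real k * l\<^sup>2" by simp
  qed
  define \<kappa> where "\<kappa> = c2 * exp (- (c3 * real (kbar n) * l) * real k)"
  define u where "u = c6 * exp (- (3 * c7 * real k * l))"
  define v where "v = c4 * exp (- (3 * c5 * real k * l))"
  define x where "x = c1 * exp (- A * real (kbar n) * l)"
  define t where "t = T0 * real k * l\<^sup>2"
  let ?z = "exp (- (c3 * real (kbar n) * l) * real k)"
  let ?uv = "exp (- (3 * c7 * real k * l)) * exp (- (3 * c5 * real k * l))"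
  let ?net = "((2 * L * real n ^ 3 + 2) * (real n ^ 3 + 1)) ^ k * exp (t / 2 + 1 - (T0 / 2 + 8) * real k * l\<^sup>2)"
  have uv: "0 < u" "0 < v" "0 < \<kappa>" using pos by (auto simp: u_def v_def \<kappa>_def)
  have Ak: "3 * (c5 + c7) * real k * l + l \<le> A * real (kbar n) * l"
  proof -
    have "3 * (c5 + c7) * real k + 1 * 1 \<le> 3 * (c5 + c7) * real (kbar n) + 1 * real (kbar n)"
      using kbk pos by (intro add_mono mult_left_mono) auto
    also have "\<dots> = (3 * (c5 + c7) + 1) * real (kbar n)" by (simp add: algebra_simps)
    also have "\<dots> \<le> A * real (kbar n)" using A by (intro mult_right_mono) auto
    finally have "(3 * (c5 + c7) * real k + 1) * l \<le> A * real (kbar n) * l"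
      using l3 by (intro mult_right_mono) auto
    then show ?thesis by (simp add: algebra_simps)
  qed
  have x: "0 \<le> x" "x \<le> 1 / 2"
  proof -
    show "0 \<le> x" using pos by (simp add: x_def)
    have "0 \<le> 3 * (c5 + c7) * real k * l" using pos l3 by simp
    then have "exp (- A * real (kbar n) * l) \<le> exp (- l)" using Ak by simp
    then have "x \<le> c1 * (1 / real n)" unfolding x_def expl using pos by (intro mult_left_mono) auto
    also have "\<dots> \<le> 1 / 2" using n by (simp add: field_simps)
    finally show "x \<le> 1 / 2" .
  qed
  \<comment> \<open>The \<open>interior_weights\<close>, made extensional so as to be a point of
    \<open>weight_simplex\<close>.\<close>
  define w1 where "w1 = (\<lambda>j\<in>{1..k}. (1 - 1 / (real n)\<^sup>2) * w0 j + 1 / ((real n)\<^sup>2 * real k))"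
  have w1: "w1 \<in> weight_simplex k"
  proof (rule weight_simplexI)
    have "1 \<le> (real n)\<^sup>2" using n1 by (intro one_le_power) auto
    then have d: "1 / (real n)\<^sup>2 \<le> 1" by (simp only: divide_le_eq_1_pos[OF less_le_trans[OF zero_less_one]])
    then show "0 \<le> w1 j" if "j \<in> {1..k}" for j
      using that weight_simplex_nonneg[OF w0 that] unfolding w1_def
      by (simp only: restrict_apply if_True) (intro add_nonneg_nonneg mult_nonneg_nonneg, auto)
    have "(\<Sum>j\<in>{1..k}. w1 j) = (1 - 1 / (real n)\<^sup>2) * (\<Sum>j\<in>{1..k}. w0 j) + real k * (1 / ((real n)\<^sup>2 * real k))"
      by (simp add: w1_def sum.distrib sum_distrib_left)
    then show "(\<Sum>j\<in>{1..k}. w1 j) = 1" using k n1 weight_simplex_sum[OF w0] by simp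
  qed (simp add: w1_def)
  have "(\<integral>\<^sup>+x. emeasure (posterior (mixing_prior L (K n) T V) n x)
        {\<nu> \<in> all_mixing_dists L. r \<le> W1 \<nu> (mixing k w0 \<theta>0)} \<partial>sample_law n (mixing k w0 \<theta>0))
    \<le> ennreal (2 * exp (L + 1 / 2) / real n
        + ?net
        + 2 * exp (2 * (1 + L) - t) / (\<kappa> * u * v) + 2 * exp (1 + L) * (2 * x) / (u * v))"
  proof (rule posterior_expectation_le[OF prior(1) n1(2) kn \<open>L > 0\<close> w0 \<theta>0 uv(3) _ _ _ uv(1) _ uv(2)])
    show "\<kappa> \<le> measure (K n) {k}"
      using prior(2) n1 k kbar(1) unfolding prior_P1_def \<kappa>_def l_def by auto
    show "measure (K n) {k<..} \<le> 2 * x * measure (K n) {k}"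
      using prior(2) n1 unfolding prior_P1_def x_def l_def
      by (intro geometric_tail_le[OF prior_family_components(1,2)[OF prior(1) n1(1)] k x[unfolded x_def l_def]]) auto
    show "u \<le> measure (T k) (atom_ball n k T \<theta>0)"
      unfolding u_def l_def by (rule prior_ball_atoms[OF prior(4) \<theta>0 k kn n1(2)])
    have "v \<le> measure (V k) (weight_ball n k V w1)"
      unfolding v_def l_def by (rule prior_ball_weights[OF prior(4) \<theta>0 k kn n1(2) prior(3) w1])
    then show "v \<le> measure (V k) (weight_ball n k V (interior_weights n k w0))"
      by (simp add: w1_def)
    show "(T0 / 2 + 8) * real k * l\<^sup>2 \<le> real n * (1 - affinity (gmix k w \<theta>) (gmix k w0 \<theta>0))"
      if "w \<in> weight_simplex k" "\<theta> \<in> atom_cube L k" "r \<le> W1 (mixing k w \<theta>) (mixing k w0 \<theta>0)" for w \<theta>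
      using sep[OF that] by (simp add: T0_def l_def)
  qed (use x in simp)
  also have "\<dots> \<le> ennreal (2 * exp (L + 1 / 2) / real n + exp 1 / real n
      + 2 * exp (2 * (1 + L)) / (c2 * c6 * c4) / real n + 4 * c1 * exp (1 + L) / (c6 * c4) / real n)"
  proof (intro ennreal_leI add_mono order.refl)
    \<comment> \<open>The number of cells per component is at most n^7; the hypothesis
      \<open>4 * L + 4 \<le> real n\<close> absorbs the leading constant.\<close>
    have "(2 * L * real n ^ 3 + 2) * (real n ^ 3 + 1) \<le> real n ^ 7"
    proof -
      have n3: "1 \<le> real n ^ 3" using n1 by (intro one_le_power) auto
      then have "(2 * L * real n ^ 3 + 2) * (real n ^ 3 + 1) \<le> (2 * L * real n ^ 3 + 2 * real n ^ 3) * (real n ^ 3 + real n ^ 3)"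
        using pos by (intro mult_mono) auto
      also have "\<dots> = (4 * L + 4) * real n ^ 6" by (simp add: algebra_simps power_add[symmetric])
      also have "\<dots> \<le> real n * real n ^ 6" using n by (intro mult_right_mono) auto
      finally show ?thesis by (simp add: power_Suc[symmetric] del: power_Suc)
    qed
    then have "((2 * L * real n ^ 3 + 2) * (real n ^ 3 + 1)) ^ k \<le> (real n ^ 7) ^ k"
      using pos by (intro power_mono) auto
    also have "\<dots> = exp (7 * (real k * l))"
    proof -
      have "exp (7 * (real k * l)) = exp l ^ (7 * k)" by (simp add: exp_of_nat_mult[symmetric] mult_ac)
      then show ?thesis using n by (simp add: l_def power_mult)
    qed
    also have "\<dots> \<le> exp (7 * (real k * l\<^sup>2))" using kl2 by simp
    finally have "?net
        \<le> exp (7 * (real k * l\<^sup>2)) * exp (t / 2 + 1 - (T0 / 2 + 8) * real k * l\<^sup>2)"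
      by (rule mult_right_mono) simp
    also have "\<dots> = exp (1 - real k * l\<^sup>2)"
      unfolding exp_add[symmetric] t_def by (simp add: algebra_simps)
    also have "\<dots> \<le> exp (1 + - l)" using kl2 by simp
    also have "\<dots> = exp 1 / real n" unfolding exp_add expl by simp
    finally show "?net
        \<le> exp 1 / real n" .
  next
    \<comment> \<open>Here the two factors kbar and log n become log^2 n, the order of
      \<open>t\<close> per component.\<close>
    have "c3 * real (kbar n) * l * real k \<le> c3 * (C * l) * l * real k"
      using kb pos l3 by (intro mult_right_mono mult_left_mono) auto
    moreover have "3 * (c5 + c7) * (real k * l) \<le> 3 * (c5 + c7) * (real k * l\<^sup>2)"
      using kl2(1) by (rule mult_left_mono) (use pos in simp)
    ultimately have ex: "- t + c3 * real (kbar n) * l * real k + 3 * (c5 + c7) * (real k * l) \<le> - l"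
      using kl2 unfolding t_def T0_def by (simp add: algebra_simps power2_eq_square)
    have "2 * exp (2 * (1 + L) - t) / (\<kappa> * u * v)
        = 2 * exp (2 * (1 + L)) / (c2 * c6 * c4) * (exp (- t) /
            (?z * ?uv))"
      unfolding \<kappa>_def u_def v_def diff_conv_add_uminus exp_add by (simp add: mult_ac)
    also have "exp (- t) / (?z * ?uv)
        = exp (- t + c3 * real (kbar n) * l * real k + 3 * (c5 + c7) * (real k * l))"
      unfolding exp_add[symmetric] exp_diff[symmetric] by (simp add: algebra_simps)
    also have "2 * exp (2 * (1 + L)) / (c2 * c6 * c4) * \<dots> \<le> 2 * exp (2 * (1 + L)) / (c2 * c6 * c4) * exp (- l)"
      using ex pos by (intro mult_left_mono) auto
    finally show "2 * exp (2 * (1 + L) - t) / (\<kappa> * u * v) \<le> 2 * exp (2 * (1 + L)) / (c2 * c6 * c4) / real n"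
      unfolding expl by simp
  next
    have "2 * exp (1 + L) * (2 * x) / (u * v) = 4 * c1 * exp (1 + L) / (c6 * c4) *
        (exp (- A * real (kbar n) * l) / ?uv)"
      unfolding x_def u_def v_def by (simp add: mult_ac)
    also have "exp (- A * real (kbar n) * l) / ?uv
        = exp (- A * real (kbar n) * l + 3 * (c5 + c7) * real k * l)"
      unfolding exp_add[symmetric] exp_diff[symmetric] by (simp add: algebra_simps)
    also have "4 * c1 * exp (1 + L) / (c6 * c4) * \<dots> \<le> 4 * c1 * exp (1 + L) / (c6 * c4) * exp (- l)"
      using Ak pos by (intro mult_left_mono) auto
    finally show "2 * exp (1 + L) * (2 * x) / (u * v) \<le> 4 * c1 * exp (1 + L) / (c6 * c4) / real n"
      unfolding expl by simp
  qed
  finally show ?thesis by (simp only: add_divide_distrib)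
qed

theorem corollary2p5:
  fixes L c4 c5 c6 c7 :: real
  assumes "L > 0" and "c4 > 0" and "c5 > 0" and "c6 > 0" and "c7 > 0"
  shows "\<exists>A0>0. \<forall>A\<ge>A0. \<forall>c1>0. \<forall>c2>0. \<forall>c3>0. \<forall>C>0.
    \<forall>k0::nat\<ge>1. \<forall>\<nu>0 \<in> mixing_dists L k0 - mixing_dists L (k0 - 1).
    \<exists>\<tau>>0. \<exists>M>0.
    \<forall>(kstar :: nat \<Rightarrow> nat) (kbar :: nat \<Rightarrow> nat)
      (K :: nat \<Rightarrow> nat measure)
      (T :: nat \<Rightarrow> (nat \<Rightarrow> real) measure)
      (V :: nat \<Rightarrow> (nat \<Rightarrow> real) measure).
      (\<forall>n\<ge>1. k0 \<le> kstar n \<and> kstar n \<le> kbar n) \<longrightarrow>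
      (\<forall>n\<ge>3. real (kbar n) \<le> C * (ln (real n) / ln (ln (real n)))) \<longrightarrow>
      prior_family L K T V \<longrightarrow>
      prior_P1 kbar A c1 c2 c3 K \<longrightarrow> prior_P2 c4 c5 V \<longrightarrow> prior_P3 L c6 c7 T \<longrightarrow>
      (\<lambda>n. SUP \<nu>star \<in> {\<nu> \<in> mixing_dists L (kstar n). W1 \<nu> \<nu>0 < \<tau>}.
             \<integral>\<^sup>+x. emeasure (posterior (mixing_prior L (K n) T V) n x)
                    {\<nu> \<in> all_mixing_dists L. W1 \<nu> \<nu>star \<ge> M * rate n (kstar n) k0}
               \<partial>sample_law n \<nu>star)
        \<longlonglongrightarrow> 0"
proof (rule exI[of _ "3 * (c5 + c7) + 1"], intro conjI allI ballI impI, goal_cases)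
  case 1
  show ?case using assms by simp
next
  case (2 A c1 c2 c3 C k0 \<nu>0)
  then have A: "3 * (c5 + c7) + 1 \<le> A" and c: "0 < c1" "0 < c2" "0 < c3" "0 < C" and k0: "1 \<le> k0"
    and \<nu>0: "\<nu>0 \<in> mixing_dists L k0 - mixing_dists L (k0 - 1)" by simp_all
  \<comment> \<open>Depends on the constants only, so \<tau> and \<open>M\<close> can be chosen
    before the sequences and the prior.\<close>
  define \<Lambda> where "\<Lambda> = (3 * (c5 + c7) + c3 * C + 1) / 2 + 8"
  have "\<Lambda> \<ge> 0" using assms c by (simp add: \<Lambda>_def)
  obtain \<tau> M where "0 < \<tau>" "0 < M" and sep:
    "\<And>n k w \<theta> w' \<theta>'. 3 \<le> n \<Longrightarrow> k0 \<le> k \<Longrightarrow> w \<in> weight_simplex k \<Longrightarrow> w' \<in> weight_simplex k \<Longrightarrow>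
      \<theta> \<in> atom_cube L k \<Longrightarrow> \<theta>' \<in> atom_cube L k \<Longrightarrow> W1 (mixing k w' \<theta>') \<nu>0 < \<tau> \<Longrightarrow>
      M * rate n k k0 \<le> W1 (mixing k w \<theta>) (mixing k w' \<theta>') \<Longrightarrow>
      \<Lambda> * real k * (ln (real n))\<^sup>2 \<le> real n * (1 - affinity (gmix k w \<theta>) (gmix k w' \<theta>'))"
    using affinity_separation[OF \<nu>0 \<open>L > 0\<close> k0 \<open>\<Lambda> \<ge> 0\<close>] by blast
  define H where "H = 2 * exp (L + 1 / 2) + exp 1 + 2 * exp (2 * (1 + L)) / (c2 * c6 * c4)
        + 4 * c1 * exp (1 + L) / (c6 * c4)"
  show ?case
  proof (rule exI[of _ \<tau>], rule conjI[OF \<open>0 < \<tau>\<close>], rule exI[of _ M], rule conjI[OF \<open>0 < M\<close>],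
      intro allI impI)
    fix kstar kbar :: "nat \<Rightarrow> nat" and K :: "nat \<Rightarrow> nat measure" and T V :: "nat \<Rightarrow> (nat \<Rightarrow> real) measure"
    assume ks: "\<forall>n\<ge>1. k0 \<le> kstar n \<and> kstar n \<le> kbar n"
      and kb: "\<forall>n\<ge>3. real (kbar n) \<le> C * (ln (real n) / ln (ln (real n)))"
      and prior: "prior_family L K T V" "prior_P1 kbar A c1 c2 c3 K" "prior_P2 c4 c5 V" "prior_P3 L c6 c7 T"
    let ?f = "\<lambda>n. SUP \<nu>star \<in> {\<nu> \<in> mixing_dists L (kstar n). W1 \<nu> \<nu>0 < \<tau>}.
             \<integral>\<^sup>+x. emeasure (posterior (mixing_prior L (K n) T V) n x)
                    {\<nu> \<in> all_mixing_dists L. W1 \<nu> \<nu>star \<ge> M * rate n (kstar n) k0}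
               \<partial>sample_law n \<nu>star"
    \<comment> \<open>Gives C log n \<le> n eventually, from which the number of components is seen
      to be at most n.\<close>
    have "(\<lambda>n. ln (real n) / real n) \<longlonglongrightarrow> 0" by (rule lim_ln_over_n)
    then have "eventually (\<lambda>n. ln (real n) / real n < 1 / C) sequentially"
      using c by (intro order_tendstoD) auto
    then have "eventually (\<lambda>n. ?f n \<le> ennreal (H / real n)) sequentially"
      using eventually_ge_at_top[of "nat \<lceil>27 + (4 * L + 4) + 2 * c1\<rceil>"]
    proof eventually_elim
      case (elim n)
      have "27 + (4 * L + 4) + 2 * c1 \<le> real n" using elim(2) by linarith
      then have n: "27 \<le> n" "4 * L + 4 \<le> real n" "2 * c1 \<le> real n" using assms c by linarith+
      have Cn: "C * ln (real n) \<le> real n" using elim(1) c n(1) by (simp add: field_simps)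
      show ?case
      proof (rule SUP_least)
        fix \<nu>star assume "\<nu>star \<in> {\<nu> \<in> mixing_dists L (kstar n). W1 \<nu> \<nu>0 < \<tau>}"
        then obtain w0 \<theta>0 where eq: "\<nu>star = mixing (kstar n) w0 \<theta>0"
          and w0: "w0 \<in> weight_simplex (kstar n)" and \<theta>0: "\<theta>0 \<in> atom_cube L (kstar n)"
          and near: "W1 (mixing (kstar n) w0 \<theta>0) \<nu>0 < \<tau>" by (auto simp: mixing_dists_def)
        show "(\<integral>\<^sup>+x. emeasure (posterior (mixing_prior L (K n) T V) n x)
            {\<nu> \<in> all_mixing_dists L. W1 \<nu> \<nu>star \<ge> M * rate n (kstar n) k0} \<partial>sample_law n \<nu>star)
            \<le> ennreal (H / real n)"
          unfolding eq H_def
        proof (rule posterior_expectation_le_inverse[OF assms(1) c(1-3) assms(2-5) A prior n Cn _ _ w0 \<theta>0])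
          show "kstar n \<le> kbar n" "real (kbar n) \<le> C * (ln (real n) / ln (ln (real n)))"
            using ks kb n(1) by auto
          show "((3 * (c5 + c7) + c3 * C + 1) / 2 + 8) * real (kstar n) * (ln (real n))\<^sup>2
              \<le> real n * (1 - affinity (gmix (kstar n) w \<theta>) (gmix (kstar n) w0 \<theta>0))"
            if "w \<in> weight_simplex (kstar n)" "\<theta> \<in> atom_cube L (kstar n)"
              "M * rate n (kstar n) k0 \<le> W1 (mixing (kstar n) w \<theta>) (mixing (kstar n) w0 \<theta>0)" for w \<theta>
            unfolding \<Lambda>_def[symmetric] using ks n(1) by (intro sep[OF _ _ that(1) w0 that(2) \<theta>0 near that(3)]) auto
        qed
      qed
    qed
    moreover have "(\<lambda>n. ennreal (H / real n)) \<longlonglongrightarrow> ennreal 0"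
      by (intro tendsto_ennrealI lim_const_over_n)
    then have "(\<lambda>n. ennreal (H / real n)) \<longlonglongrightarrow> 0" by simp
    ultimately show "?f \<longlonglongrightarrow> 0"
      by (rule tendsto_sandwich[OF always_eventually _ tendsto_const, rotated]) simp
  qed
qed

end
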